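(* The oriented Gaussian parity functor $(P^{og},\mathcal G^{og})$ is correctly defined (i.e. it is an oriented parity functor on the diagrams of every free knot), and it is the universal oriented parity functor on free knots: for every oriented parity functor $(P,\mathcal G)$ on the diagrams of a free knot there exists a unique family of group homomorphisms $\phi_D\colon\mathcal G^{og}(D)\to\mathcal G(D)$, indexed by the diagrams $D$, such that $P_D=\phi_D\circ P^{og}_D$ for all $D$.
   Context: Free knots. A diagram is a chord diagram: an oriented core circle with finitely many unlabelled chords with pairwise distinct ends. A free knot is an equivalence class of chord diagrams modulo isomorphism (orientation-preserving homeomorphism of circles carrying chords to chords) and the moves: R1, adding/removing a chord whose two ends are adjacent on the circle; R2, adding/removing two chords $a,b$ such that an end of $a$ is adjacent to an end of $b$ and the other end of $a$ is adjacent to the other end of $b$; R3, for three chords $a,b,c$ such that there are three disjoint arcs of the circle containing exactly one end of $a$ and one of $b$, one of $b$ and one of $c$, one of $c$ and one of $a$ respectively, transposing the two ends on each of the three arcs. Category. For a free knot, objects are its diagrams and morphisms are formal compositions of elementary morphisms (isomorphisms and Reidemeister moves). $\mathcal V(D)$ is the set of chords. An elementary $f\colon D\to D'$ induces a partial bijection $f_*$ identifying surviving chords; $dom(f_* )$ omits only the disappearing chords of a decreasing R1 or R2. A partial isomorphism of groups is an isomorphism between subgroups; its domain is denoted $dom$. Oriented parity functor on a free knot. A functor $\mathcal G$ from the diagram category to commutative groups with partial isomorphisms, and maps $P_D\colon\mathcal V(D)\to\mathcal G(D)$, such that for each elementary $f\colon D\to D'$: (P0) for $v\in dom(f_* )$,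 $P_D(v)\in dom(\mathcal G(f))$ and $P_{D'}(f_*(v))=\mathcal G(f)(P_D(v))$; (P1) $P_D(v)=0$ if $f$ is a decreasing R1 removing $v$; (P2) $P_D(v_1)+P_D(v_2)=0$ if $f$ is a decreasing R2 removing $v_1,v_2$; (P3+) $\epsilon(a)P_D(a)+\epsilon(b)P_D(b)+\epsilon(c)P_D(c)=0$ if $f$ is an R3 move on $a,b,c$. Here one goes around the triangle formed alternately by the three chords and the three short arcs; $\epsilon(a)=+1$ if the arcs just before and just after the chord $a$ are both traversed along, or both against, the orientation of the core circle, and $\epsilon(a)=-1$ otherwise; similarly for $b,c$. Gaussian parity. A chord $a$ is Gaussian even (odd) if the number of chord ends lying on either of the two open arcs into which the ends of $a$ divide the circle is even (odd). Two chords are linked if their ends alternate on the circle. Classes of chords. $E_0$ (resp. $E_1$) is the set of Gaussian even chords linked with an even (resp. odd) number of Gaussian odd chords. For two distinct Gaussian odd chords $a,b$, the four ends of $a,b$ divide the circle into four arcs; take two opposite arcs each having one end of $a$ and one end of $b$ as boundary points; let $k_e,k_o$ be the numbers of ends of Gaussian even, resp. odd, chords in the interior of the first arc and $l_e,l_o$ the analogous numbers for the second arc. The set of Gaussian odd chords is split into two classes $O',O''$ (one possibly empty), two odd chords being in the same class iff $k_e+l_o+1$ is even. Oriented Gaussian parity functor. $\mathcal G^{og}(D)=0$ if $D$ has no Gaussian odd chords. Otherwise $\mathcal G^{og}(D)$ is the four-element set of symbols $\{E_0,E_1,O',O''\}$ with group structure $\cong\mathbb Z_4$ such that $E_0\leftrightarrow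 0$, $E_1\leftrightarrow 2$ and $O',O''$ correspond to $1$ and $3$ (the choice which is which does not affect the group structure). $P^{og}_D$ sends a chord to its class (to $0$ if $\mathcal G^{og}(D)=0$). For an elementary $f\colon D\to D'$: if $\mathcal G^{og}(D)$ or $\mathcal G^{og}(D')$ is trivial, $\mathcal G^{og}(f)$ is the isomorphism between trivial subgroups; otherwise $\mathcal G^{og}(f)\colon\mathcal G^{og}(D)\to\mathcal G^{og}(D')$ sends $E_0\mapsto E_0$, $E_1\mapsto E_1$ and the class of each surviving odd chord $a$ to the class of $f_*(a)$. *)

theory Defs
  imports "HOL-Analysis.Analysis" "HOL-Algebra.Group"
begin

section \<open>Chord diagrams\<close>

text \<open>
  All diagrams share one core circle, the unit circle of the complex plane with its
  counterclockwise orientation.  A chord is the two-element set of its ends.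
\<close>

type_synonym chord = "complex set"
type_synonym diagram = "chord set"

abbreviation core :: "complex set" where
  "core \<equiv> sphere 0 1"

definition chord_diagram :: "diagram \<Rightarrow> bool" where
  "chord_diagram D \<longleftrightarrow> finite D \<and> (\<forall>c\<in>D. c \<subseteq> core \<and> card c = 2) \<and> disjoint D"

abbreviation chord_ends :: "diagram \<Rightarrow> complex set" where
  "chord_ends D \<equiv> \<Union>D"

text \<open>The open arc from \<open>p\<close> to \<open>q\<close> along the orientation (empty if \<open>p = q\<close>).\<close>

definition open_arc :: "complex \<Rightarrow> complex \<Rightarrow> complex set" where
  "open_arc p q = {z \<in> core. 0 < Arg2pi (z / p) \<and> Arg2pi (z / p) < Arg2pi (q / p)}"

definition next_end :: "diagram \<Rightarrow> complex \<Rightarrow> complex \<Rightarrow> bool" where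
  "next_end D p q \<longleftrightarrow> p \<in> chord_ends D \<and> q \<in> chord_ends D \<and> p \<noteq> q \<and>
     open_arc p q \<inter> chord_ends D = {}"

definition adjacent :: "diagram \<Rightarrow> complex \<Rightarrow> complex \<Rightarrow> bool" where
  "adjacent D p q \<longleftrightarrow> next_end D p q \<or> next_end D q p"

text \<open>
  A homeomorphism of the circle preserves the orientation iff it preserves the cyclic order of
  triples of points.  Extensionality makes functions agreeing on the circle equal.
\<close>

definition orientation_preserving_homeo :: "(complex \<Rightarrow> complex) \<Rightarrow> bool" where
  "orientation_preserving_homeo h \<longleftrightarrow>
     h \<in> extensional core \<and> (\<exists>g. homeomorphism core core h g) \<and>
     (\<forall>x\<in>core. \<forall>y\<in>core. \<forall>z\<in>core. y \<in> open_arc x z \<longrightarrow> h y \<in> open_arc (h x) (h z))"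


section \<open>Elementary morphisms and free knots\<close>

definition R1_chord :: "diagram \<Rightarrow> chord \<Rightarrow> bool" where
  "R1_chord D a \<longleftrightarrow> a \<in> D \<and> (\<exists>p q. a = {p, q} \<and> adjacent D p q)"

definition R2_pair :: "diagram \<Rightarrow> chord set \<Rightarrow> bool" where
  "R2_pair D A \<longleftrightarrow>
     (\<exists>a b p q r s. A = {a, b} \<and> a \<in> D \<and> b \<in> D \<and> a \<noteq> b \<and> a = {p, q} \<and> b = {r, s} \<and>
        adjacent D p r \<and> adjacent D q s)"

text \<open>
  The chords of an R3 move are \<open>a = {a1, a3}\<close>, \<open>b = {b1, b2}\<close>, \<open>c = {c2, c3}\<close>; the digit names
  the short arc (first: \<open>a, b\<close>; second: \<open>b, c\<close>; third: \<open>c, a\<close>) that contains the end.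
\<close>

definition R3_triangle ::
    "diagram \<Rightarrow> complex \<Rightarrow> complex \<Rightarrow> complex \<Rightarrow> complex \<Rightarrow> complex \<Rightarrow> complex \<Rightarrow> bool" where
  "R3_triangle D a1 b1 b2 c2 c3 a3 \<longleftrightarrow>
     {a1, a3} \<in> D \<and> {b1, b2} \<in> D \<and> {c2, c3} \<in> D \<and>
     {a1, a3} \<noteq> {b1, b2} \<and> {b1, b2} \<noteq> {c2, c3} \<and> {c2, c3} \<noteq> {a1, a3} \<and>
     adjacent D a1 b1 \<and> adjacent D b2 c2 \<and> adjacent D c3 a3"

definition R3_swap ::
    "complex \<Rightarrow> complex \<Rightarrow> complex \<Rightarrow> complex \<Rightarrow> complex \<Rightarrow> complex \<Rightarrow> complex \<Rightarrow> complex" where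
  "R3_swap a1 b1 b2 c2 c3 a3 =
     Transposition.transpose a1 b1 \<circ> Transposition.transpose b2 c2 \<circ> Transposition.transpose c3 a3"

text \<open>
  An R3 move is recorded by the permutation of the six ends, because three chords alone need
  not determine the three arcs.
\<close>


datatype move =
    Iso "complex \<Rightarrow> complex"
  | R1_dec chord
  | R1_inc chord
  | R2_dec "chord set"
  | R2_inc "chord set"
  | R3 "complex \<Rightarrow> complex"

fun target :: "diagram \<Rightarrow> move \<Rightarrow> diagram" where
  "target D (Iso h) = (`) h ` D"
| "target D (R1_dec a) = D - {a}"
| "target D (R1_inc a) = insert a D"
| "target D (R2_dec A) = D - A"
| "target D (R2_inc A) = D \<union> A"
| "target D (R3 s) = (`) s ` D"

text \<open>\<open>elementary D f\<close>: \<open>f\<close> is an elementary morphism from \<open>D\<close> to \<open>target D f\<close>.\<close>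

fun elementary :: "diagram \<Rightarrow> move \<Rightarrow> bool" where
  "elementary D (Iso h) \<longleftrightarrow> chord_diagram D \<and> orientation_preserving_homeo h"
| "elementary D (R1_dec a) \<longleftrightarrow> chord_diagram D \<and> R1_chord D a"
| "elementary D (R1_inc a) \<longleftrightarrow>
     a \<notin> D \<and> chord_diagram (insert a D) \<and> R1_chord (insert a D) a"
| "elementary D (R2_dec A) \<longleftrightarrow> chord_diagram D \<and> R2_pair D A"
| "elementary D (R2_inc A) \<longleftrightarrow>
     A \<inter> D = {} \<and> chord_diagram (D \<union> A) \<and> R2_pair (D \<union> A) A"
| "elementary D (R3 s) \<longleftrightarrow> chord_diagram D \<and>
     (\<exists>a1 b1 b2 c2 c3 a3. R3_triangle D a1 b1 b2 c2 c3 a3 \<and> s = R3_swap a1 b1 b2 c2 c3 a3)"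

text \<open>The partial bijection \<open>f\<^sub>*\<close> on chords.\<close>

fun push :: "diagram \<Rightarrow> move \<Rightarrow> chord \<rightharpoonup> chord" where
  "push D (Iso h) = (\<lambda>v. Some (h ` v)) |` D"
| "push D (R1_dec a) = Some |` (D - {a})"
| "push D (R1_inc a) = Some |` D"
| "push D (R2_dec A) = Some |` (D - A)"
| "push D (R2_inc A) = Some |` D"
| "push D (R3 s) = (\<lambda>v. Some (s ` v)) |` D"

definition free_knot :: "diagram set \<Rightarrow> bool" where
  "free_knot K \<longleftrightarrow>
     (\<exists>D0. chord_diagram D0 \<and>
        K = {D. equivclp (\<lambda>D D'. \<exists>f. elementary D f \<and> D' = target D f) D0 D})"

text \<open>Morphisms are formal compositions: composable lists, the first move being applied first.\<close>

fun morphism :: "diagram \<Rightarrow> move list \<Rightarrow> bool" where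
  "morphism D [] \<longleftrightarrow> chord_diagram D"
| "morphism D (f # fs) \<longleftrightarrow> elementary D f \<and> morphism (target D f) fs"

abbreviation targets :: "diagram \<Rightarrow> move list \<Rightarrow> diagram" where
  "targets \<equiv> foldl target"


section \<open>Oriented parity functors\<close>

definition partial_iso :: "'a monoid \<Rightarrow> 'b monoid \<Rightarrow> ('a \<rightharpoonup> 'b) \<Rightarrow> bool" where
  "partial_iso G H m \<longleftrightarrow>
     subgroup (dom m) G \<and> subgroup (ran m) H \<and>
     (\<lambda>x. the (m x)) \<in> iso (G\<lparr>carrier := dom m\<rparr>) (H\<lparr>carrier := ran m\<rparr>)"

definition diagram_functor ::
    "diagram set \<Rightarrow> (diagram \<Rightarrow> 'g monoid) \<Rightarrow> (diagram \<Rightarrow> move list \<Rightarrow> 'g \<rightharpoonup> 'g) \<Rightarrow> bool" where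
  "diagram_functor K G M \<longleftrightarrow>
     (\<forall>D\<in>K. comm_group (G D)) \<and>
     (\<forall>D\<in>K. \<forall>fs. morphism D fs \<longrightarrow> partial_iso (G D) (G (targets D fs)) (M D fs)) \<and>
     (\<forall>D\<in>K. M D [] = Some |` carrier (G D)) \<and>
     (\<forall>D\<in>K. \<forall>fs gs. morphism D (fs @ gs) \<longrightarrow>
        M D (fs @ gs) = M (targets D fs) gs \<circ>\<^sub>m M D fs)"

text \<open>
  The triangle is traversed as \<open>c3 a3 a1 b1 b2 c2 c3\<close>.  The sign of a chord compares the
  directions of the arc run through just before it (from \<open>p\<close> to \<open>q\<close>) and of the one just after
  it (from \<open>r\<close> to \<open>s\<close>).  At least six ends being present, of two adjacent ends exactly one
  is followed by the other.
\<close>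

definition chord_sign :: "diagram \<Rightarrow> complex \<Rightarrow> complex \<Rightarrow> complex \<Rightarrow> complex \<Rightarrow> int" where
  "chord_sign D p q r s = (if next_end D p q \<longleftrightarrow> next_end D r s then 1 else -1)"

text \<open>Groups are written multiplicatively.\<close>

definition oriented_parity_functor ::
    "diagram set \<Rightarrow> (diagram \<Rightarrow> 'g monoid) \<Rightarrow> (diagram \<Rightarrow> move list \<Rightarrow> 'g \<rightharpoonup> 'g) \<Rightarrow>
     (diagram \<Rightarrow> chord \<Rightarrow> 'g) \<Rightarrow> bool" where
  "oriented_parity_functor K G M P \<longleftrightarrow>
     diagram_functor K G M \<and>
     (\<forall>D\<in>K. \<forall>v\<in>D. P D v \<in> carrier (G D)) \<and>
     (\<forall>D\<in>K. \<forall>f v v'. elementary D f \<and> push D f v = Some v' \<longrightarrow>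
        M D [f] (P D v) = Some (P (target D f) v')) \<and>
     (\<forall>D\<in>K. \<forall>v. elementary D (R1_dec v) \<longrightarrow> P D v = \<one>\<^bsub>G D\<^esub>) \<and>
     (\<forall>D\<in>K. \<forall>v w. v \<noteq> w \<and> elementary D (R2_dec {v, w}) \<longrightarrow>
        P D v \<otimes>\<^bsub>G D\<^esub> P D w = \<one>\<^bsub>G D\<^esub>) \<and>
     (\<forall>D\<in>K. \<forall>a1 b1 b2 c2 c3 a3. R3_triangle D a1 b1 b2 c2 c3 a3 \<longrightarrow>
        P D {a1, a3} [^]\<^bsub>G D\<^esub> chord_sign D c3 a3 a1 b1 \<otimes>\<^bsub>G D\<^esub>
        P D {b1, b2} [^]\<^bsub>G D\<^esub> chord_sign D a1 b1 b2 c2 \<otimes>\<^bsub>G D\<^esub>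
        P D {c2, c3} [^]\<^bsub>G D\<^esub> chord_sign D b2 c2 c3 a3 = \<one>\<^bsub>G D\<^esub>)"


section \<open>The oriented Gaussian parity functor\<close>

definition gauss_even :: "diagram \<Rightarrow> chord \<Rightarrow> bool" where
  "gauss_even D a \<longleftrightarrow> (\<forall>p q. a = {p, q} \<longrightarrow> even (card (chord_ends D \<inter> open_arc p q)))"

definition gauss_odd :: "diagram \<Rightarrow> chord \<Rightarrow> bool" where
  "gauss_odd D a \<longleftrightarrow> (\<forall>p q. a = {p, q} \<longrightarrow> odd (card (chord_ends D \<inter> open_arc p q)))"

definition even_chords :: "diagram \<Rightarrow> chord set" where
  "even_chords D = {a \<in> D. gauss_even D a}"

definition odd_chords :: "diagram \<Rightarrow> chord set" where
  "odd_chords D = {a \<in> D. gauss_odd D a}"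

definition linked :: "chord \<Rightarrow> chord \<Rightarrow> bool" where
  "linked a b \<longleftrightarrow> (\<exists>p q r s. a = {p, q} \<and> b = {r, s} \<and> r \<in> open_arc p q \<and> s \<in> open_arc q p)"

text \<open>
  \<open>w\<close>, \<open>x\<close>, \<open>y\<close>, \<open>z\<close> are the four ends of \<open>a\<close> and \<open>b\<close> in cyclic order, and each of the opposite arcs
  from \<open>w\<close> to \<open>x\<close> and from \<open>y\<close> to \<open>z\<close> is bounded by one end of \<open>a\<close> and one end of \<open>b\<close>.
\<close>

definition opposite_arcs ::
    "chord \<Rightarrow> chord \<Rightarrow> complex \<Rightarrow> complex \<Rightarrow> complex \<Rightarrow> complex \<Rightarrow> bool" where
  "opposite_arcs a b w x y z \<longleftrightarrow>
     a \<union> b = {w, x, y, z} \<and> x \<in> open_arc w y \<and> y \<in> open_arc x z \<and> z \<in> open_arc y w \<and>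
     w \<in> open_arc z x \<and>
     (w \<in> a \<longleftrightarrow> x \<in> b) \<and> (y \<in> a \<longleftrightarrow> z \<in> b)"

text \<open>
  \<open>S\<close> is one of the two classes of odd chords, its complement in the odd chords the other one.
\<close>

definition odd_class :: "diagram \<Rightarrow> chord set \<Rightarrow> bool" where
  "odd_class D S \<longleftrightarrow>
     S \<subseteq> odd_chords D \<and>
     (\<forall>a\<in>odd_chords D. \<forall>b\<in>odd_chords D. \<forall>w x y z.
        a \<noteq> b \<and> opposite_arcs a b w x y z \<longrightarrow>
        ((a \<in> S \<longleftrightarrow> b \<in> S) \<longleftrightarrow>
         even (card (chord_ends (even_chords D) \<inter> open_arc w x) +
               card (chord_ends (odd_chords D) \<inter> open_arc y z) + 1)))"

datatype og = E0 | O1 | E1 | O2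

fun og_num :: "og \<Rightarrow> nat" where
  "og_num E0 = 0"
| "og_num O1 = 1"
| "og_num E1 = 2"
| "og_num O2 = 3"

definition og_group :: "diagram \<Rightarrow> og monoid" where
  "og_group D =
     \<lparr>carrier = (if odd_chords D = {} then {E0} else UNIV),
      mult = (\<lambda>x y. THE z. og_num z = (og_num x + og_num y) mod 4),
      one = E0\<rparr>"

text \<open>
  In the following \<open>C D\<close> is the class of odd chords of \<open>D\<close> that is represented by the symbol
  \<open>O1\<close>; the other class (or the empty one) is represented by \<open>O2\<close>.
\<close>

definition og_parity :: "(diagram \<Rightarrow> chord set) \<Rightarrow> diagram \<Rightarrow> chord \<Rightarrow> og" where
  "og_parity C D v =
     (if odd_chords D = {} then E0
      else if v \<in> odd_chords D then (if v \<in> C D then O1 else O2)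
      else if even (card {b \<in> odd_chords D. linked v b}) then E0 else E1)"

definition og_map :: "(diagram \<Rightarrow> chord set) \<Rightarrow> diagram \<Rightarrow> move \<Rightarrow> (og \<rightharpoonup> og) \<Rightarrow> bool" where
  "og_map C D f m \<longleftrightarrow>
     (let D' = target D f in
      if odd_chords D = {} \<or> odd_chords D' = {} then m = [E0 \<mapsto> E0]
      else partial_iso (og_group D) (og_group D') m \<and>
           dom m = carrier (og_group D) \<and> ran m = carrier (og_group D') \<and>
           m E0 = Some E0 \<and> m E1 = Some E1 \<and>
           (\<forall>a\<in>odd_chords D. \<forall>a'. push D f a = Some a' \<longrightarrow>
              m (og_parity C D a) = Some (og_parity C D' a')))"

fun og_mor :: "(diagram \<Rightarrow> chord set) \<Rightarrow> diagram \<Rightarrow> move list \<Rightarrow> og \<rightharpoonup> og" where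
  "og_mor C D [] = Some |` carrier (og_group D)"
| "og_mor C D (f # fs) = og_mor C (target D f) fs \<circ>\<^sub>m (THE m. og_map C D f m)"

end

theory Submission
  imports Defs "HOL-Number_Theory.Cong" "HOL-Algebra.FiniteProduct" "HOL-Algebra.Generated_Groups"
begin

text \<open>
  Cut the core circle at a base point and give an end \<open>p\<close> the weight \<open>w(p) = 2 o(p) - (n(p) mod 2)\<close>, where
  \<open>n(p)\<close> counts all ends and \<open>o(p)\<close> the ends of Gaussian odd chords before \<open>p\<close>.  Modulo 4, a
  chord \<open>{p, q}\<close> gets the value \<open>1 + w(p) + w(q)\<close>.  Up to a global sign, this is the class of the
  chord in \<open>\<int>\<^sub>4\<close>, and each parity axiom becomes a finite check on the few ends that a move touches.

  For universality let \<open>P\<close> be any oriented parity.  Insert by a second Reidemeister move a band, that is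
  a pair of parallel or crossing chords, joining two gaps between ends.  Two R3 relations, with a
  second band that joins the other end of a chord \<open>c\<close> to the same gap, show that sliding an end of the
  band over an end of \<open>c\<close> exchanges parallel and crossing bands and changes the value by
  \<open>\<plusminus>2 P(c)\<close>, where both signs occur; hence \<open>4 P(c) = 0\<close>.  A band parallel to a chord has the value of
  this chord up to sign.  Slide its ends, for every chord, to the same two gaps: for an even chord one arrives at a
  trivial (R1) band, for any two odd chords at bands of equal value.  This expresses all values of
  \<open>P\<close> by that of a single odd chord, as \<open>1 + w(p) + w(q)\<close> prescribes.
\<close>

section \<open>Angular coordinates on the core circle\<close>

text \<open>No base point suits all moves, since a cut through a short arc spoils the local
  computation. So each local lemma brings its own; modulo 4, changing it multiplies all values by a
  common sign, and so does exchanging the names \<open>O1\<close> and \<open>O2\<close>.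
  \<open>og_sign\<close> absorbs both, and the homogeneous axioms do not see the sign.

  The weight itself is read off from sliding a band: each end passed adds \<open>2 P(c)\<close>,
  which turns out to vanish for even \<open>c\<close> and to be the same for all odd
  \<open>c\<close>, whence the term with \<open>o\<close>; and it exchanges parallel and crossing,
  whence only the parity of \<open>n\<close> matters.

  The obstacle to universality is that \<open>P\<close> takes values in another group for each
  diagram, with only partial isomorphisms in between, while auxiliary bands must come and go. The
  argument therefore handles integer exponents \<open>f\<close> for which the product of the powers
  \<open>P(v)^f(v)\<close> is trivial. A partial isomorphism is injective and defined on the values
  of all surviving chords, so inserting or removing a band neither creates nor destroys such
  relations among the other chords.\<close>

definition ang :: "complex \<Rightarrow> complex \<Rightarrow> real" where
  "ang r z = Arg2pi (z / r)"

lemma ang_ge_0 [simp]: "0 \<le> ang r z"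
  and ang_lt_2pi [simp]: "ang r z < 2 * pi"
  by (simp_all add: ang_def Arg2pi_ge_0 Arg2pi_lt_2pi)

lemma core_nonzero: "z \<in> core \<Longrightarrow> z \<noteq> 0"
  by auto

lemma ang_self [simp]: "r \<in> core \<Longrightarrow> ang r r = 0"
  using Arg2pi_of_real[of 1] by (auto simp: ang_def)

lemma exp_ang: "r \<in> core \<Longrightarrow> z \<in> core \<Longrightarrow> r * exp (\<i> * of_real (ang r z)) = z"
  using complex_norm_eq_1_exp[of "z / r"] by (auto simp: ang_def norm_divide)

lemma ang_inj: "r \<in> core \<Longrightarrow> z \<in> core \<Longrightarrow> w \<in> core \<Longrightarrow> ang r z = ang r w \<longleftrightarrow> z = w"
  using exp_ang by metis

text \<open>Dividing unit complex numbers subtracts angles; the second case brings a negative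
  difference back to \<open>[0, 2 * pi)\<close>. All cyclic notions become order conditions on reals
  through this.\<close>

lemma Arg2pi_divide_ang:
  assumes "r \<in> core" "p \<in> core" "z \<in> core"
  shows "Arg2pi (z / p) = (if ang r p \<le> ang r z then ang r z - ang r p
           else ang r z - ang r p + 2 * pi)"
proof -
  define t where "t = (if ang r p \<le> ang r z then ang r z - ang r p
           else ang r z - ang r p + 2 * pi)"
  have "exp (\<i> * of_real t) = exp (\<i> * of_real (ang r z)) / exp (\<i> * of_real (ang r p))"
    by (auto simp: t_def algebra_simps exp_add exp_diff)
  also have "\<dots> = z / p"
    using exp_ang[of r z] exp_ang[of r p] assms core_nonzero[of r]
    by (metis nonzero_mult_divide_mult_cancel_left)
  finally have "of_real 1 * exp (\<i> * of_real t) = z / p"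
    by simp
  moreover have "0 \<le> t" "t < 2 * pi"
    using ang_ge_0[of r z] ang_lt_2pi[of r z] ang_ge_0[of r p] ang_lt_2pi[of r p]
    by (auto simp: t_def simp del: ang_ge_0 ang_lt_2pi)
  ultimately show ?thesis
    using Arg2pi_unique[of 1 t "z / p"] by (simp add: t_def)
qed

text \<open>The second branch is the arc that passes the base point; its strict inequality excludes
  \<open>p = q\<close>, where the arc is empty.\<close>

lemma in_open_arc_iff:
  assumes "r \<in> core" "p \<in> core" "q \<in> core"
  shows "z \<in> open_arc p q \<longleftrightarrow> z \<in> core \<and>
    (if ang r p < ang r q then ang r p < ang r z \<and> ang r z < ang r q
     else ang r q < ang r p \<and> (ang r p < ang r z \<or> ang r z < ang r q))"
proof (cases "z \<in> core")
  case True
  have bounds: "0 \<le> ang r z" "ang r z < 2 * pi" "0 \<le> ang r p" "ang r p < 2 * pi"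
      "0 \<le> ang r q" "ang r q < 2 * pi"
    by simp_all
  have "z \<in> open_arc p q \<longleftrightarrow> 0 < Arg2pi (z / p) \<and> Arg2pi (z / p) < Arg2pi (q / p)"
    using True by (simp add: open_arc_def)
  also have "\<dots> \<longleftrightarrow> (if ang r p < ang r q then ang r p < ang r z \<and> ang r z < ang r q
     else ang r q < ang r p \<and> (ang r p < ang r z \<or> ang r z < ang r q))"
    unfolding Arg2pi_divide_ang[OF assms(1,2) True] Arg2pi_divide_ang[OF assms(1,2,3)]
    using bounds by (smt (verit))
  finally show ?thesis
    using True by simp
qed (simp add: open_arc_def)

definition below :: "complex \<Rightarrow> complex set \<Rightarrow> complex \<Rightarrow> nat" where
  "below r F z = card {e \<in> F. ang r e < ang r z}"

text \<open>Modulo 2 the count on an arc is a sum of counts at its two ends. The point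
  \<open>p\<close> is counted before \<open>q\<close> but is not on the open arc, which accounts for
  the last summand. Since \<open>card F\<close> is even, an arc and its complement behave alike, so
  it does not matter which of them contains the base point.\<close>

lemma even_card_arc_iff:
  assumes r: "r \<in> core" and F: "finite F" "F \<subseteq> core" "even (card F)"
    and pq: "p \<in> core" "q \<in> core" "p \<noteq> q"
  shows "even (card (F \<inter> open_arc p q)) \<longleftrightarrow> even (below r F p + below r F q + of_bool (p \<in> F))"
proof -
  have inj: "ang r p \<noteq> ang r q"
    using ang_inj r pq by blast
  have fin: "finite {e \<in> F. Q e}" for Q
    using F by simp
  \<comment> \<open>The points up to and including \<open>p\<close>.\<close>
  have P: "card ({e \<in> F. ang r e < ang r p} \<union> {e \<in> F. e = p}) = below r F p + of_bool (p \<in> F)"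
  proof -
    have "card {e \<in> F. e = p} = of_bool (p \<in> F)"
    proof (cases "p \<in> F")
      case True
      then have "{e \<in> F. e = p} = {p}"
        by auto
      then show ?thesis
        using True by simp
    qed auto
    moreover have "{e \<in> F. ang r e < ang r p} \<inter> {e \<in> F. e = p} = {}"
      by auto
    ultimately show ?thesis
      unfolding below_def by (subst card_Un_disjoint) (use fin in auto)
  qed
  have eqp: "ang r e = ang r p \<longleftrightarrow> e = p" if "e \<in> F" for e
    using ang_inj r pq that F by blast
  have arc: "e \<in> open_arc p q \<longleftrightarrow> (if ang r p < ang r q then ang r p < ang r e \<and> ang r e < ang r q
     else ang r q < ang r p \<and> (ang r p < ang r e \<or> ang r e < ang r q))" if "e \<in> F" for e
    using in_open_arc_iff[OF r pq(1,2), of e] that F(2) by blast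
  show ?thesis
  proof (cases "ang r p < ang r q")
    case True
    have "{e \<in> F. ang r e < ang r q} =
        ({e \<in> F. ang r e < ang r p} \<union> {e \<in> F. e = p}) \<union> (F \<inter> open_arc p q)"
    proof (rule Set.set_eqI)
      fix e
      show "e \<in> {e \<in> F. ang r e < ang r q} \<longleftrightarrow>
          e \<in> ({e \<in> F. ang r e < ang r p} \<union> {e \<in> F. e = p}) \<union> (F \<inter> open_arc p q)"
        using eqp[of e] arc[of e] True by (cases "e \<in> F") (simp_all, linarith)
    qed
    moreover have "({e \<in> F. ang r e < ang r p} \<union> {e \<in> F. e = p}) \<inter> (F \<inter> open_arc p q) = {}"
      using arc True by fastforce
    ultimately have "below r F q = below r F p + of_bool (p \<in> F) + card (F \<inter> open_arc p q)"
      unfolding P[symmetric] unfolding below_def by (subst card_Un_disjoint[symmetric]) (use F in auto)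
    then show ?thesis
      by auto
  next
    case False
    have "F \<inter> open_arc p q = {e \<in> F. ang r p < ang r e} \<union> {e \<in> F. ang r e < ang r q}"
      using False inj arc by (intro Set.set_eqI) (simp, metis linorder_neqE_linordered_idom)
    moreover have "{e \<in> F. ang r p < ang r e} \<inter> {e \<in> F. ang r e < ang r q} = {}"
      using False by (intro equals0I) simp
    ultimately have *: "card (F \<inter> open_arc p q) = card {e \<in> F. ang r p < ang r e} + below r F q"
      unfolding below_def by (subst card_Un_disjoint[symmetric]) (use F in auto)
    \<comment> \<open>The arc passes the base point, so the points after \<open>p\<close> are
      counted through the even total.\<close>
    have "F = ({e \<in> F. ang r e < ang r p} \<union> {e \<in> F. e = p}) \<union> {e \<in> F. ang r p < ang r e}"
      using eqp by (intro Set.set_eqI) (simp, metis linorder_neqE_linordered_idom)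
    moreover have "({e \<in> F. ang r e < ang r p} \<union> {e \<in> F. e = p}) \<inter> {e \<in> F. ang r p < ang r e} = {}"
      by auto
    ultimately have "card F = below r F p + of_bool (p \<in> F) + card {e \<in> F. ang r p < ang r e}"
      unfolding P[symmetric] by (subst card_Un_disjoint[symmetric]) (use F in auto)
    then show ?thesis
      using * F(3) by presburger
  qed
qed

section \<open>Weights of chord ends\<close>

abbreviation odd_ends :: "diagram \<Rightarrow> complex set" where
  "odd_ends D \<equiv> chord_ends (odd_chords D)"

definition wt :: "complex \<Rightarrow> diagram \<Rightarrow> complex \<Rightarrow> int" where
  "wt r D z = 2 * int (below r (odd_ends D) z) - int (below r (chord_ends D) z mod 2)"

text \<open>For an even chord the parities of \<open>n\<close> at its ends differ, and the constant
  1 cancels their contribution, leaving twice a number of odd ends. For an odd chord they agree, and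
  what is left besides is a sign: 1 if both are even, -1 if both are odd.\<close>

definition val :: "complex \<Rightarrow> diagram \<Rightarrow> chord \<Rightarrow> int" where
  "val r D c = 1 + (\<Sum>p\<in>c. wt r D p)"

lemma val_doubleton: "p \<noteq> q \<Longrightarrow> val r D {p, q} = 1 + wt r D p + wt r D q"
  by (simp add: val_def)

lemma chordE:
  assumes "chord_diagram D" "c \<in> D"
  obtains p q where "c = {p, q}" "p \<noteq> q" "p \<in> core" "q \<in> core"
proof -
  have "card c = 2" "c \<subseteq> core"
    using assms by (auto simp: chord_diagram_def)
  then show ?thesis
    using that by (auto simp: card_2_iff)
qed

lemma chord_unique:
  "chord_diagram D \<Longrightarrow> c \<in> D \<Longrightarrow> d \<in> D \<Longrightarrow> p \<in> c \<Longrightarrow> p \<in> d \<Longrightarrow> c = d"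
  unfolding chord_diagram_def pairwise_def disjnt_def by blast

lemma chord_diagram_mono: "chord_diagram D \<Longrightarrow> S \<subseteq> D \<Longrightarrow> chord_diagram S"
  unfolding chord_diagram_def by (metis finite_subset pairwise_subset subsetD)

lemma chord_ends_subset_core: "chord_diagram D \<Longrightarrow> chord_ends D \<subseteq> core"
  unfolding chord_diagram_def by blast

lemma finite_chord_ends: "chord_diagram D \<Longrightarrow> finite (chord_ends D)"
  unfolding chord_diagram_def by (metis card.infinite finite_Union zero_neq_numeral)

lemma even_card_chord_ends: "chord_diagram D \<Longrightarrow> even (card (chord_ends D))"
proof -
  assume D: "chord_diagram D"
  have "card (chord_ends D) = (\<Sum>c\<in>D. card c)"
    using D by (subst card_Union_disjoint)
      (auto simp: chord_diagram_def intro: card_ge_0_finite)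
  also have "\<dots> = (\<Sum>c\<in>D. 2)"
    using D by (intro sum.cong) (auto simp: chord_diagram_def)
  finally show ?thesis
    by simp
qed

lemma odd_chords_subset: "odd_chords D \<subseteq> D"
  by (auto simp: odd_chords_def)

lemma chord_diagram_odd_chords: "chord_diagram D \<Longrightarrow> chord_diagram (odd_chords D)"
  using chord_diagram_mono odd_chords_subset by blast

text \<open>Here \<open>p\<close> is itself one of the counted ends, so the last summand of
  \<open>even_card_arc_iff\<close> is 1 and exchanges odd and even.\<close>

lemma arc_parity_iff:
  assumes D: "chord_diagram D" and r: "r \<in> core" and pq: "{p, q} \<in> D" "p \<noteq> q"
  shows "odd (card (chord_ends D \<inter> open_arc p q)) \<longleftrightarrow>
    even (below r (chord_ends D) p + below r (chord_ends D) q)"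
proof -
  have "p \<in> chord_ends D" "p \<in> core" "q \<in> core"
    using pq D by (auto simp: chord_diagram_def)
  then show ?thesis
    using even_card_arc_iff[OF r finite_chord_ends[OF D] chord_ends_subset_core[OF D]
        even_card_chord_ends[OF D], of p q] pq by simp
qed

lemma gauss_odd_iff:
  assumes D: "chord_diagram D" and r: "r \<in> core" and pq: "{p, q} \<in> D" "p \<noteq> q"
  shows "gauss_odd D {p, q} \<longleftrightarrow> even (below r (chord_ends D) p + below r (chord_ends D) q)"
    and "gauss_even D {p, q} \<longleftrightarrow> odd (below r (chord_ends D) p + below r (chord_ends D) q)"
proof -
  have qp: "{q, p} \<in> D" "q \<noteq> p"
    using pq by (auto simp: insert_commute)
  show "gauss_odd D {p, q} \<longleftrightarrow> even (below r (chord_ends D) p + below r (chord_ends D) q)"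
    unfolding gauss_odd_def
    using arc_parity_iff[OF D r pq] arc_parity_iff[OF D r qp] by (auto simp: doubleton_eq_iff)
  show "gauss_even D {p, q} \<longleftrightarrow> odd (below r (chord_ends D) p + below r (chord_ends D) q)"
    unfolding gauss_even_def
    using arc_parity_iff[OF D r pq] arc_parity_iff[OF D r qp] by (auto simp: doubleton_eq_iff)
qed

lemma odd_chords_iff:
  assumes "chord_diagram D" "r \<in> core" "{p, q} \<in> D" "p \<noteq> q"
  shows "{p, q} \<in> odd_chords D \<longleftrightarrow> even (below r (chord_ends D) p + below r (chord_ends D) q)"
  using gauss_odd_iff(1)[OF assms] assms by (simp add: odd_chords_def)

lemma even_chords_eq:
  assumes D: "chord_diagram D"
  shows "even_chords D = D - odd_chords D"
proof -
  have "gauss_even D c \<longleftrightarrow> \<not> gauss_odd D c" if "c \<in> D" for c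
    using chordE[OF D that] gauss_odd_iff[OF D, of 1] that by (metis dist_0_norm mem_sphere norm_one)
  then show ?thesis
    by (auto simp: even_chords_def odd_chords_def)
qed

lemma odd_val_iff:
  assumes D: "chord_diagram D" and r: "r \<in> core" and c: "c \<in> D"
  shows "odd (val r D c) \<longleftrightarrow> c \<in> odd_chords D"
proof -
  obtain p q where pq: "c = {p, q}" "p \<noteq> q"
    using chordE[OF D c] by metis
  show ?thesis
    using odd_chords_iff[OF D r] c pq
    by (auto simp: val_doubleton wt_def mod2_eq_if)
qed

lemma mem_odd_ends_iff:
  assumes D: "chord_diagram D" and c: "c \<in> D" and p: "p \<in> c"
  shows "p \<in> odd_ends D \<longleftrightarrow> c \<in> odd_chords D"
  using chord_unique[OF D _ c] p odd_chords_subset by blast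

text \<open>Distinct chords share no end, so each end of \<open>b\<close> lies on exactly one of the
  two arcs; alternating ends mean one on each.\<close>

lemma linked_iff_odd_card:
  assumes D: "chord_diagram D" and r: "r \<in> core" and v: "{p, q} \<in> D" "p \<noteq> q"
    and b: "b \<in> D" "b \<noteq> {p, q}"
  shows "linked {p, q} b \<longleftrightarrow> odd (card (b \<inter> open_arc p q))"
proof -
  obtain u w where uw: "b = {u, w}" "u \<noteq> w" "u \<in> core" "w \<in> core"
    using chordE[OF D b(1)] by metis
  have pqc: "p \<in> core" "q \<in> core"
    using v D by (auto simp: chord_diagram_def)
  have "u \<noteq> p" "u \<noteq> q" "w \<noteq> p" "w \<noteq> q"
    using chord_unique[OF D b(1) v(1)] b(2) uw by auto
  then have ne: "ang r u \<noteq> ang r p" "ang r u \<noteq> ang r q" "ang r w \<noteq> ang r p" "ang r w \<noteq> ang r q"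
      "ang r p \<noteq> ang r q"
    using ang_inj r uw pqc v by blast+
  have arc: "z \<in> open_arc q p \<longleftrightarrow> z \<notin> open_arc p q" if "z = u \<or> z = w" for z
    using that ne uw unfolding in_open_arc_iff[OF r pqc] in_open_arc_iff[OF r pqc(2,1)] by auto
  have "linked {p, q} b \<longleftrightarrow> (u \<in> open_arc p q \<longleftrightarrow> w \<notin> open_arc p q)"
  proof
    assume "linked {p, q} b"
    then obtain p' q' u' w' where "{p, q} = {p', q'}" "b = {u', w'}"
        "u' \<in> open_arc p' q'" "w' \<in> open_arc q' p'"
      unfolding linked_def by blast
    then show "u \<in> open_arc p q \<longleftrightarrow> w \<notin> open_arc p q"
      using arc[of u] arc[of w] uw(1,2) v(2) by (auto simp: doubleton_eq_iff)
  next
    assume "u \<in> open_arc p q \<longleftrightarrow> w \<notin> open_arc p q"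
    then have "u \<in> open_arc p q \<and> w \<in> open_arc q p \<or> w \<in> open_arc p q \<and> u \<in> open_arc q p"
      using arc by blast
    moreover have "b = {w, u}"
      using uw(1) by (simp add: insert_commute)
    ultimately show "linked {p, q} b"
      unfolding linked_def using uw(1) by blast
  qed
  also have "\<dots> \<longleftrightarrow> odd (card (b \<inter> open_arc p q))"
    unfolding uw(1) using uw(2) by (cases "u \<in> open_arc p q"; cases "w \<in> open_arc p q") auto
  finally show ?thesis .
qed

lemma cong_double_int: "(even m \<longleftrightarrow> even n) \<Longrightarrow> [2 * int m = 2 * int n] (mod 4)"
  unfolding cong_def by presburger

text \<open>Count the odd ends on one side of \<open>v\<close>: an unlinked odd chord contributes 0
  or 2, a linked one 1. As \<open>v\<close> is even, its own ends are not among those counted and no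
  shift occurs.\<close>

lemma even_chord_val:
  assumes D: "chord_diagram D" and r: "r \<in> core" and v: "v \<in> D" "v \<notin> odd_chords D"
  shows "[val r D v = 2 * int (card {b \<in> odd_chords D. linked v b})] (mod 4)"
proof -
  obtain p q where pq: "v = {p, q}" "p \<noteq> q" "p \<in> core" "q \<in> core"
    using chordE[OF D v(1)] by metis
  have O: "chord_diagram (odd_chords D)"
    using D by (rule chord_diagram_odd_chords)
  have fin: "finite (odd_chords D)"
    using O by (simp add: chord_diagram_def)
  have "card (odd_ends D \<inter> open_arc p q) = card (\<Union>b\<in>odd_chords D. b \<inter> open_arc p q)"
    by (rule arg_cong[where f = card]) auto
  also have "\<dots> = (\<Sum>b\<in>odd_chords D. card (b \<inter> open_arc p q))"
  proof (rule card_UN_disjoint[OF fin])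
    show "\<forall>i\<in>odd_chords D. finite (i \<inter> open_arc p q)"
      using finite_chord_ends[OF O] by (meson Union_upper finite_Int finite_subset)
    show "\<forall>i\<in>odd_chords D. \<forall>j\<in>odd_chords D. i \<noteq> j \<longrightarrow>
        i \<inter> open_arc p q \<inter> (j \<inter> open_arc p q) = {}"
      using chord_unique[OF O] by blast
  qed
  finally have "even (card (odd_ends D \<inter> open_arc p q)) \<longleftrightarrow>
      even (card {b \<in> odd_chords D. odd (card (b \<inter> open_arc p q))})"
    using even_sum_iff[OF fin] by simp
  also have "{b \<in> odd_chords D. odd (card (b \<inter> open_arc p q))} = {b \<in> odd_chords D. linked v b}"
    using linked_iff_odd_card[OF D r] v pq odd_chords_subset by blast
  finally have *: "even (card {b \<in> odd_chords D. linked v b}) \<longleftrightarrow>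
      even (below r (odd_ends D) p + below r (odd_ends D) q)"
    using even_card_arc_iff[OF r finite_chord_ends[OF O] chord_ends_subset_core[OF O]
        even_card_chord_ends[OF O] pq(3,4,2)] mem_odd_ends_iff[OF D v(1), of p] v(2) pq(1) by simp
  have "odd (below r (chord_ends D) p + below r (chord_ends D) q)"
    using odd_chords_iff[OF D r, of p q] v pq by simp
  then have "val r D v = 2 * int (below r (odd_ends D) p + below r (odd_ends D) q)"
    unfolding pq(1) val_doubleton[OF pq(2)] wt_def by (auto simp: mod2_eq_if)
  then show ?thesis
    using cong_double_int[OF *[symmetric]] by simp
qed

section \<open>The two classes of odd chords\<close>

lemma chord_ends_even_chords:
  assumes "chord_diagram D"
  shows "chord_ends (even_chords D) = chord_ends D - odd_ends D"
proof (rule Set.set_eqI)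
  fix z
  show "z \<in> chord_ends (even_chords D) \<longleftrightarrow> z \<in> chord_ends D - odd_ends D"
  proof (cases "\<exists>c\<in>D. z \<in> c")
    case True
    then obtain c where c: "c \<in> D" "z \<in> c"
      by blast
    then have "z \<in> chord_ends (even_chords D) \<longleftrightarrow> c \<notin> odd_chords D"
      unfolding even_chords_eq[OF assms] using chord_unique[OF assms, of _ c z] by blast
    then show ?thesis
      using mem_odd_ends_iff[OF assms c] c by blast
  next
    case False
    then show ?thesis
      by (auto simp: even_chords_def)
  qed
qed

lemma below_even_odd:
  assumes "chord_diagram D"
  shows "below r (chord_ends (even_chords D)) z + below r (odd_ends D) z = below r (chord_ends D) z"
proof -
  have "finite (chord_ends D)"
    by (rule finite_chord_ends[OF assms])
  moreover have "odd_ends D \<subseteq> chord_ends D"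
    using odd_chords_subset by blast
  ultimately have "below r (chord_ends D) z =
      card ({e \<in> chord_ends (even_chords D). ang r e < ang r z} \<union> {e \<in> odd_ends D. ang r e < ang r z})"
    unfolding below_def chord_ends_even_chords[OF assms] by (intro arg_cong[where f = card]) auto
  also have "\<dots> = below r (chord_ends (even_chords D)) z + below r (odd_ends D) z"
    unfolding below_def
  proof (rule card_Un_disjoint)
    show "finite {e \<in> chord_ends (even_chords D). ang r e < ang r z}"
      "finite {e \<in> odd_ends D. ang r e < ang r z}"
      using finite_chord_ends[OF assms] odd_chords_subset
      unfolding chord_ends_even_chords[OF assms] by (auto intro: finite_subset[of _ "chord_ends D"])
    show "{e \<in> chord_ends (even_chords D). ang r e < ang r z} \<inter> {e \<in> odd_ends D. ang r e < ang r z} = {}"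
      unfolding chord_ends_even_chords[OF assms] by auto
  qed
  finally show ?thesis by simp
qed

text \<open>The chords are \<open>{w, y}\<close> and \<open>{x, z}\<close>. Both are odd, so the
  difference of their values is twice an integer, which matters only modulo 2. There
  \<open>nw\<close> and \<open>nx\<close> may be replaced by \<open>ew + ow\<close> and
  \<open>ex + ox\<close>, and the odd counts at \<open>w\<close> and \<open>x\<close>
  cancel.\<close>

lemma odd_weights_cong_iff:
  fixes ew ow nw :: nat
  assumes "ew + ow = nw" "ex + ox = nx" "even (nw + ny)" "even (nx + nz)"
  shows "[1 + (2 * int ow - int (nw mod 2)) + (2 * int oy - int (ny mod 2)) =
          1 + (2 * int ox - int (nx mod 2)) + (2 * int oz - int (nz mod 2))] (mod 4) \<longleftrightarrow>
    even (ew + ex + oy + oz)"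
proof -
  have "ny mod 2 = nw mod 2" "nz mod 2 = nx mod 2"
    using assms by presburger+
  then have "1 + (2 * int ow - int (nw mod 2)) + (2 * int oy - int (ny mod 2)) -
      (1 + (2 * int ox - int (nx mod 2)) + (2 * int oz - int (nz mod 2))) =
      2 * (int ow + int oy - int (nw mod 2) - int ox - int oz + int (nx mod 2))"
    by (simp add: algebra_simps)
  moreover have "(4::int) dvd 2 * k \<longleftrightarrow> even k" for k
    by presburger
  ultimately have "[1 + (2 * int ow - int (nw mod 2)) + (2 * int oy - int (ny mod 2)) =
          1 + (2 * int ox - int (nx mod 2)) + (2 * int oz - int (nz mod 2))] (mod 4) \<longleftrightarrow>
      even (int ow + int oy - int (nw mod 2) - int ox - int oz + int (nx mod 2))"
    by (simp only: cong_iff_dvd_diff)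
  also have "\<dots> \<longleftrightarrow> even (ew + ex + oy + oz)"
    using assms(1,2) by (auto simp: mod2_eq_if)
  finally show ?thesis .
qed

text \<open>The summand 1 in the arc condition compensates the shift of
  \<open>even_card_arc_iff\<close> at \<open>y\<close>, which is an odd end; at \<open>w\<close>,
  which is not an even end, there is no shift. What remains is the sum of four counts that also
  governs the difference of the two values.\<close>

lemma same_class_iff:
  assumes D: "chord_diagram D" and r: "r \<in> core"
    and ab: "a \<in> odd_chords D" "b \<in> odd_chords D" "a \<noteq> b" and arcs: "opposite_arcs a b w x y z"
  shows "even (card (chord_ends (even_chords D) \<inter> open_arc w x) +
               card (odd_ends D \<inter> open_arc y z) + 1) \<longleftrightarrow> [val r D a = val r D b] (mod 4)"
proof -
  define be bo bn where "be = below r (chord_ends (even_chords D))" and "bo = below r (odd_ends D)"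
    and "bn = below r (chord_ends D)"
  have abD: "a \<in> D" "b \<in> D"
    using ab odd_chords_subset by blast+
  have "a \<inter> b = {}"
    using chord_unique[OF D abD] ab(3) by blast
  moreover have "card a = 2" "card b = 2" "finite a" "finite b"
    using abD D by (auto simp: chord_diagram_def intro: card_ge_0_finite)
  ultimately have "card (a \<union> b) = 4"
    by (simp add: card_Un_disjoint)
  moreover have ab_eq: "a \<union> b = {w, x, y, z}"
    using arcs by (simp add: opposite_arcs_def)
  ultimately have dist: "distinct [w, x, y, z]"
    using card_distinct[of "[w, x, y, z]"] by simp
  have "chord_diagram (even_chords D)"
    using chord_diagram_mono[OF D] even_chords_eq[OF D] by blast
  note ev = finite_chord_ends[OF this] chord_ends_subset_core[OF this] even_card_chord_ends[OF this]
  note O = chord_diagram_odd_chords[OF D]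
  note od = finite_chord_ends[OF O] chord_ends_subset_core[OF O] even_card_chord_ends[OF O]
  have "{w, x, y, z} \<subseteq> odd_ends D"
    using ab ab_eq by blast
  moreover have "{w, x, y, z} \<inter> chord_ends (even_chords D) = {}"
    using \<open>{w, x, y, z} \<subseteq> odd_ends D\<close> unfolding chord_ends_even_chords[OF D] by blast
  moreover have "{w, x, y, z} \<subseteq> core"
    using \<open>{w, x, y, z} \<subseteq> odd_ends D\<close> od(2) by blast
  ultimately have count: "even (card (chord_ends (even_chords D) \<inter> open_arc w x) +
               card (odd_ends D \<inter> open_arc y z) + 1) \<longleftrightarrow> even (be w + be x + bo y + bo z)"
    using even_card_arc_iff[OF r ev, of w x] even_card_arc_iff[OF r od, of y z] dist
    by (auto simp: be_def bo_def)
  have eo: "be t + bo t = bn t" for t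
    unfolding be_def bo_def bn_def by (rule below_even_odd[OF D])
  have wt: "wt r D t = 2 * int (bo t) - int (bn t mod 2)" for t
    by (simp add: wt_def bo_def bn_def)
  have par: "even (bn s + bn t)" if "{s, t} \<in> odd_chords D" "s \<noteq> t" for s t
    using odd_chords_iff[OF D r, of s t] that odd_chords_subset by (auto simp: bn_def)
  have main: "[val r D {s, t} = val r D {s', t'}] (mod 4) \<longleftrightarrow> even (be s + be s' + bo t + bo t')"
    if "{s, t} \<in> odd_chords D" "s \<noteq> t" "{s', t'} \<in> odd_chords D" "s' \<noteq> t'" for s t s' t'
    unfolding val_doubleton[OF that(2)] val_doubleton[OF that(4)] wt
    by (rule odd_weights_cong_iff[OF eo eo par[OF that(1,2)] par[OF that(3,4)]])
  have w: "w \<in> a \<longleftrightarrow> x \<in> b" "y \<in> a \<longleftrightarrow> z \<in> b"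
    using arcs by (auto simp: opposite_arcs_def)
  have other: "t \<in> b \<longleftrightarrow> t \<notin> a" if "t \<in> {w, x, y, z}" for t
    using that ab_eq \<open>a \<inter> b = {}\<close> by blast
  have sub: "a \<subseteq> {w, x, y, z}" "b \<subseteq> {w, x, y, z}"
    using ab_eq by blast+
  have set_eq: "c = {s, t}" if "c \<subseteq> {w, x, y, z}" "\<And>u. u \<in> {w, x, y, z} \<Longrightarrow> u \<in> c \<longleftrightarrow> u = s \<or> u = t"
      "s \<in> {w, x, y, z}" "t \<in> {w, x, y, z}" for c s t
    using that by blast
  have in_a: "x \<in> a \<longleftrightarrow> w \<notin> a" "z \<in> a \<longleftrightarrow> y \<notin> a" "\<And>u. u \<in> {w, x, y, z} \<Longrightarrow> u \<in> b \<longleftrightarrow> u \<notin> a"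
    using w other by auto
  \<comment> \<open>Each arc is bounded by one end of each chord, so whether \<open>w\<close> and
    \<open>y\<close> belong to \<open>a\<close> decides everything. The first and the last case are
    the linked ones.\<close>
  consider "a = {w, y}" "b = {x, z}" | "a = {w, z}" "b = {x, y}"
    | "a = {x, y}" "b = {w, z}" | "a = {x, z}" "b = {w, y}"
  proof (cases "w \<in> a"; cases "y \<in> a")
    assume "w \<in> a" "y \<in> a"
    then show ?thesis
      using in_a dist by (intro that(1) set_eq sub) auto
  next
    assume "w \<in> a" "y \<notin> a"
    then show ?thesis
      using in_a dist by (intro that(2) set_eq sub) auto
  next
    assume "w \<notin> a" "y \<in> a"
    then show ?thesis
      using in_a dist by (intro that(3) set_eq sub) auto
  next
    assume "w \<notin> a" "y \<notin> a"
    then show ?thesis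
      using in_a dist by (intro that(4) set_eq sub) auto
  qed
  then show ?thesis
  proof cases
    case 1
    then show ?thesis
      unfolding count using main[of w y x z] ab dist by simp
  next
    case 2
    then show ?thesis
      unfolding count using main[of w z x y] ab dist by (simp add: ac_simps)
  next
    case 3
    then show ?thesis
      unfolding count using main[of x y w z] ab dist by (simp add: ac_simps)
  next
    case 4
    then show ?thesis
      unfolding count using main[of x z w y] ab dist by (simp add: ac_simps)
  qed
qed

text \<open>Ensures that the condition in \<open>odd_class\<close> is never vacuous for a pair of
  distinct odd chords. The six cases are the possible interleavings of the four ends along the cut
  circle.\<close>

lemma opposite_arcs_exist:
  assumes D: "chord_diagram D" and ab: "a \<in> D" "b \<in> D" "a \<noteq> b"
  shows "\<exists>w x y z. opposite_arcs a b w x y z"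
proof -
  have r: "1 \<in> core"
    by simp
  have ordered: "\<exists>p q. c = {p, q} \<and> p \<in> core \<and> q \<in> core \<and> ang 1 p < ang 1 q" if c: "c \<in> D" for c
  proof -
    obtain p q where pq: "c = {p, q}" "p \<noteq> q" "p \<in> core" "q \<in> core"
      using chordE[OF D c] by metis
    then show ?thesis
      using ang_inj[OF r pq(3,4)] insert_commute[of p q "{}"] by (metis linorder_neqE_linordered_idom)
  qed
  obtain p q where a: "a = {p, q}" "p \<in> core" "q \<in> core" "ang 1 p < ang 1 q"
    using ordered[OF ab(1)] by blast
  obtain u v where b: "b = {u, v}" "u \<in> core" "v \<in> core" "ang 1 u < ang 1 v"
    using ordered[OF ab(2)] by blast
  have "a \<inter> b = {}"
    using chord_unique[OF D ab(1,2)] ab(3) by blast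
  then have ne: "p \<noteq> u" "p \<noteq> v" "q \<noteq> u" "q \<noteq> v"
    using a b by auto
  then have ne': "ang 1 p \<noteq> ang 1 u" "ang 1 p \<noteq> ang 1 v" "ang 1 q \<noteq> ang 1 u" "ang 1 q \<noteq> ang 1 v"
    using ang_inj[OF r] a b by simp_all
  \<comment> \<open>Two positions of the base point suffice for the names used below: between
    \<open>z\<close> and \<open>w\<close>, or between \<open>y\<close> and \<open>z\<close>.\<close>
  have cyc: "x \<in> open_arc w y \<and> y \<in> open_arc x z \<and> z \<in> open_arc y w \<and> w \<in> open_arc z x"
    if "w \<in> core" "x \<in> core" "y \<in> core" "z \<in> core"
      "ang 1 w < ang 1 x \<and> ang 1 x < ang 1 y \<and> ang 1 y < ang 1 z \<or>
       ang 1 z < ang 1 w \<and> ang 1 w < ang 1 x \<and> ang 1 x < ang 1 y" for w x y z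
    using that by (auto simp: in_open_arc_iff[OF r])
  have pq: "p \<noteq> q" "u \<noteq> v"
    using a b by auto
  consider "ang 1 q < ang 1 u" | "ang 1 v < ang 1 p"
    | "ang 1 p < ang 1 u" "ang 1 u < ang 1 q" "ang 1 q < ang 1 v"
    | "ang 1 p < ang 1 u" "ang 1 v < ang 1 q"
    | "ang 1 u < ang 1 p" "ang 1 p < ang 1 v" "ang 1 v < ang 1 q"
    | "ang 1 u < ang 1 p" "ang 1 q < ang 1 v"
    using ne' by linarith
  then show ?thesis
  proof cases
    case 1
    then have "opposite_arcs a b q u v p"
      unfolding opposite_arcs_def using cyc[of q u v p] a b ne pq by auto
    then show ?thesis by blast
  next
    case 2
    then have "opposite_arcs a b v p q u"
      unfolding opposite_arcs_def using cyc[of v p q u] a b ne pq by auto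
    then show ?thesis by blast
  next
    case 3
    then have "opposite_arcs a b p u q v"
      unfolding opposite_arcs_def using cyc[of p u q v] a b ne pq by auto
    then show ?thesis by blast
  next
    case 4
    then have "opposite_arcs a b p u v q"
      unfolding opposite_arcs_def using cyc[of p u v q] a b ne pq by auto
    then show ?thesis by blast
  next
    case 5
    then have "opposite_arcs a b u p v q"
      unfolding opposite_arcs_def using cyc[of u p v q] a b ne pq by auto
    then show ?thesis by blast
  next
    case 6
    then have "opposite_arcs a b u p q v"
      unfolding opposite_arcs_def using cyc[of u p q v] a b ne pq by auto
    then show ?thesis by blast
  qed
qed

text \<open>That the arc condition is an equivalence relation with at most two classes cannot be
  seen from the arcs. It holds because the condition is congruence of values, and odd values have
  only the residues 1 and 3 modulo 4.\<close>

lemma odd_class_exists: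
  assumes D: "chord_diagram D"
  shows "\<exists>S. odd_class D S"
proof -
  have r: "1 \<in> core"
    by simp
  define S where "S = {a \<in> odd_chords D. [val 1 D a = 1] (mod 4)}"
  have odd4: "([x = 1] (mod 4) \<longleftrightarrow> [y = 1] (mod 4)) \<longleftrightarrow> [x = y] (mod 4)" if "odd x" "odd y" for x y :: int
    using that unfolding cong_def by presburger
  have "(a \<in> S \<longleftrightarrow> b \<in> S) \<longleftrightarrow> [val 1 D a = val 1 D b] (mod 4)"
    if "a \<in> odd_chords D" "b \<in> odd_chords D" for a b
    using odd4[of "val 1 D a" "val 1 D b"] that odd_val_iff[OF D r] odd_chords_subset
    unfolding S_def by blast
  then have "odd_class D S"
    unfolding odd_class_def using same_class_iff[OF D r] by (auto simp: S_def)
  then show ?thesis ..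
qed

text \<open>Whether \<open>O1\<close> corresponds to residue 1 or 3 depends on \<open>C\<close> and
  on \<open>r\<close>, but one sign corrects it for all odd chords at once; even chords are not
  affected, as 0 and 2 are their own negatives modulo 4.\<close>

lemma og_sign:
  assumes D: "chord_diagram D" and r: "r \<in> core" and C: "odd_class D (C D)"
  obtains s :: int where "s = 1 \<or> s = -1"
    "\<And>v. v \<in> D \<Longrightarrow> [int (og_num (og_parity C D v)) = s * val r D v] (mod 4)"
proof (cases "odd_chords D = {}")
  case True
  show ?thesis
  proof (rule that[of 1])
    show "[int (og_num (og_parity C D v)) = 1 * val r D v] (mod 4)" if "v \<in> D" for v
      using even_chord_val[OF D r that] True by (simp add: og_parity_def cong_def)
  qed simp
next
  case False
  then obtain a where a: "a \<in> odd_chords D"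
    by blast
  have same: "(v \<in> C D \<longleftrightarrow> a \<in> C D) \<longleftrightarrow> [val r D v = val r D a] (mod 4)" if v: "v \<in> odd_chords D" for v
  proof (cases "v = a")
    case False
    obtain w x y z where arcs: "opposite_arcs v a w x y z"
      using opposite_arcs_exist[OF D] v a False odd_chords_subset by blast
    show ?thesis
      using C arcs same_class_iff[OF D r v a False arcs] v a False unfolding odd_class_def by blast
  qed simp
  have odd: "odd (val r D v)" if "v \<in> odd_chords D" for v
    using odd_val_iff[OF D r] odd_chords_subset that by blast
  \<comment> \<open>A single odd chord \<open>a\<close> fixes the sign; all other odd chords are
    compared with \<open>a\<close> by \<open>same\<close>.\<close>
  define s :: int where "s = (if a \<in> C D \<longleftrightarrow> [val r D a = 1] (mod 4) then 1 else -1)"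
  have 4: "x mod 4 = 1 \<or> x mod 4 = 3" if "odd x" for x :: int
    using that by presburger
  show ?thesis
  proof (rule that[of s])
    show "s = 1 \<or> s = -1"
      by (simp add: s_def)
    fix v assume v: "v \<in> D"
    show "[int (og_num (og_parity C D v)) = s * val r D v] (mod 4)"
    proof (cases "v \<in> odd_chords D")
      case True
      have mod_minus: "- x mod 4 = (if x mod 4 = 1 then 3 else 1)" if "odd x" for x :: int
        using that by presburger
      have "og_num (og_parity C D v) = (if v \<in> C D then 1 else 3)"
        using True False by (simp add: og_parity_def)
      then show ?thesis
        using same[OF True] 4[OF odd[OF True]] 4[OF odd[OF a]] mod_minus[OF odd[OF True]]
        by (auto simp: s_def cong_def split: if_splits)
    next
      case nodd: False
      define k where "k = card {b \<in> odd_chords D. linked v b}"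
      have k: "[val r D v = 2 * int k] (mod 4)"
        using even_chord_val[OF D r v nodd] by (simp add: k_def)
      have "int (og_num (og_parity C D v)) = (if even k then 0 else 2)"
        using nodd False by (simp add: og_parity_def k_def)
      moreover have k2: "[(if even k then 0 else 2) = 2 * int k] (mod 4)"
        using cong_double_int[of 0 k] cong_double_int[of 1 k] by (cases "even k") auto
      moreover have "[2 * int k = - (2 * int k)] (mod 4)"
        by (simp add: cong_iff_dvd_diff)
      then have "[(if even k then 0 else 2) = - (2 * int k)] (mod 4)"
        by (rule cong_trans[OF k2])
      moreover have "[- val r D v = - (2 * int k)] (mod 4)"
        using k by (simp add: cong_minus_minus_iff)
      ultimately show ?thesis
        using k by (auto simp: s_def intro: cong_trans cong_sym)
    qed
  qed
qed

section \<open>Adjacent ends in angular coordinates\<close>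

text \<open>Adjacency on the circle cut open at \<open>r\<close>. It is stronger than
  \<open>adjacent\<close>, because the arc between the two ends must not pass the cut.\<close>

definition adj :: "complex \<Rightarrow> diagram \<Rightarrow> complex \<Rightarrow> complex \<Rightarrow> bool" where
  "adj r D u v \<longleftrightarrow> u \<in> chord_ends D \<and> v \<in> chord_ends D \<and> u \<noteq> v \<and>
     (\<forall>z\<in>chord_ends D. \<not> (ang r u < ang r z \<and> ang r z < ang r v) \<and>
        \<not> (ang r v < ang r z \<and> ang r z < ang r u))"

lemma adj_commute: "adj r D u v \<longleftrightarrow> adj r D v u"
  by (auto simp: adj_def)

text \<open>If the arc from \<open>u\<close> to \<open>v\<close> passed the base point, then
  \<open>r\<close>, an end other than \<open>v\<close>, would lie inside it.\<close>

lemma next_end_adj: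
  assumes D: "chord_diagram D" and uv: "next_end D u v" and r: "r \<in> chord_ends D" "r \<noteq> v"
  shows "adj r D u v"
proof -
  have mem: "u \<in> chord_ends D" "v \<in> chord_ends D" "u \<noteq> v" and empty: "open_arc u v \<inter> chord_ends D = {}"
    using uv by (auto simp: next_end_def)
  have core: "r \<in> core" "u \<in> core" "v \<in> core"
    using chord_ends_subset_core[OF D] mem r by blast+
  have "ang r v \<noteq> ang r r"
    using ang_inj[of r v r] core r(2) by blast
  then have v0: "ang r r < ang r v"
    using core by (metis ang_ge_0 ang_self order_le_imp_less_or_eq)
  have "ang r u \<noteq> ang r v"
    using ang_inj[of r u v] core mem by blast
  moreover have "\<not> ang r v < ang r u"
    using in_open_arc_iff[OF core, of r] core v0 r(1) empty by auto
  ultimately have less: "ang r u < ang r v"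
    by linarith
  have "\<not> (ang r u < ang r z \<and> ang r z < ang r v)" if "z \<in> chord_ends D" for z
    using in_open_arc_iff[OF core, of z] chord_ends_subset_core[OF D] that less empty by auto
  then show ?thesis
    using mem less by (auto simp: adj_def)
qed

text \<open>The base point is taken at the start of one of the short arcs, so that it cuts none of them.\<close>

lemma adjacent_base:
  assumes D: "chord_diagram D" and uv: "adjacent D u v"
  obtains r where "r \<in> core" "adj r D u v"
    "\<And>u' v'. adjacent D u' v' \<Longrightarrow> u' \<notin> {u, v} \<Longrightarrow> v' \<notin> {u, v} \<Longrightarrow> adj r D u' v'"
proof -
  note result = that
  have *: thesis if rt_uv: "next_end D r t" "{r, t} = {u, v}" for r t
  proof (rule result)
    have rt: "r \<in> chord_ends D" "r \<noteq> t"
      using rt_uv(1) by (auto simp: next_end_def)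
    then show "r \<in> core"
      using chord_ends_subset_core[OF D] by blast
    have "adj r D r t"
      using next_end_adj[OF D rt_uv(1)] rt by blast
    then show "adj r D u v"
      using rt_uv(2) adj_commute by (auto simp: doubleton_eq_iff)
    fix u' v' assume "adjacent D u' v'" "u' \<notin> {u, v}" "v' \<notin> {u, v}"
    moreover have "r \<in> {u, v}"
      using rt_uv(2) by blast
    ultimately show "adj r D u' v'"
      unfolding adjacent_def using next_end_adj[OF D _ rt(1)] adj_commute by metis
  qed
  show thesis
    using uv * insert_commute unfolding adjacent_def by metis
qed

lemma adj_less_iff:
  assumes D: "chord_diagram D" and r: "r \<in> core" and uv: "adj r D u v"
    and z: "z \<in> chord_ends D" "z \<noteq> u" "z \<noteq> v"
  shows "ang r z < ang r u \<longleftrightarrow> ang r z < ang r v" and "ang r u < ang r z \<longleftrightarrow> ang r v < ang r z"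
proof -
  have "u \<in> core" "v \<in> core" "z \<in> core"
    using chord_ends_subset_core[OF D] uv z by (auto simp: adj_def)
  then have "ang r z \<noteq> ang r u" "ang r z \<noteq> ang r v"
    using ang_inj[OF r] z by blast+
  then show "ang r z < ang r u \<longleftrightarrow> ang r z < ang r v" "ang r u < ang r z \<longleftrightarrow> ang r v < ang r z"
    using uv z unfolding adj_def by (meson linorder_neqE_linordered_idom order.strict_trans)+
qed

lemma below_adj:
  assumes D: "chord_diagram D" and r: "r \<in> core" and uv: "adj r D u v" "ang r u < ang r v"
    and F: "F \<subseteq> chord_ends D"
  shows "below r F v = below r F u + of_bool (u \<in> F)"
proof -
  have fin: "finite F"
    using F finite_chord_ends[OF D] finite_subset by blast
  have "e \<in> {e \<in> F. ang r e < ang r v} \<longleftrightarrow> e \<in> {e \<in> F. ang r e < ang r u} \<union> (F \<inter> {u})" for e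
  proof (cases "e = u \<or> e = v")
    case False
    then show ?thesis
      using adj_less_iff(1)[OF D r uv(1), of e] F by auto
  qed (use uv in auto)
  then have "{e \<in> F. ang r e < ang r v} = {e \<in> F. ang r e < ang r u} \<union> (F \<inter> {u})"
    by blast
  moreover have "card ({e \<in> F. ang r e < ang r u} \<union> (F \<inter> {u})) =
      card {e \<in> F. ang r e < ang r u} + card (F \<inter> {u})"
    using fin by (intro card_Un_disjoint) auto
  ultimately show ?thesis
    by (simp add: below_def)
qed

abbreviation parity :: "complex \<Rightarrow> diagram \<Rightarrow> complex \<Rightarrow> int" where
  "parity r D z \<equiv> int (below r (chord_ends D) z mod 2)"

text \<open>A step to a neighbour changes \<open>n\<close> by one, and \<open>o\<close> by one
  precisely if the chord of the lower of the two ends is odd. Since 2 and -2 agree modulo 4, the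
  direction of the step matters only through the question which chord is the lower one.\<close>

lemma adj_weights:
  assumes D: "chord_diagram D" and r: "r \<in> core" and uv: "adj r D u v"
    and a: "a \<in> D" "u \<in> a" and b: "b \<in> D" "v \<in> b"
  shows "parity r D v = 1 - parity r D u"
    and "[wt r D v = wt r D u + 2 * of_bool ((if ang r u < ang r v then a else b) \<in> odd_chords D)
           - 1 + 2 * parity r D u] (mod 4)"
proof -
  define n ob where "n = below r (chord_ends D)" and "ob = below r (odd_ends D)"
  have sub: "odd_ends D \<subseteq> chord_ends D" "chord_ends D \<subseteq> chord_ends D"
    using odd_chords_subset by blast+
  have mem: "u \<in> chord_ends D" "v \<in> chord_ends D" "u \<in> odd_ends D \<longleftrightarrow> a \<in> odd_chords D"
      "v \<in> odd_ends D \<longleftrightarrow> b \<in> odd_chords D"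
    using mem_odd_ends_iff[OF D a] mem_odd_ends_iff[OF D b] a b by auto
  have core: "u \<in> core" "v \<in> core" "u \<noteq> v"
    using chord_ends_subset_core[OF D] mem uv by (auto simp: adj_def)
  then have "ang r u \<noteq> ang r v"
    using ang_inj[OF r] by blast
  then consider "ang r u < ang r v" | "ang r v < ang r u"
    by linarith
  then have "parity r D v = 1 - parity r D u \<and>
      [wt r D v = wt r D u + 2 * of_bool ((if ang r u < ang r v then a else b) \<in> odd_chords D)
           - 1 + 2 * parity r D u] (mod 4)"
  proof cases
    case 1
    have "n v = Suc (n u)" "ob v = ob u + of_bool (a \<in> odd_chords D)"
      using below_adj[OF D r uv 1] sub mem by (simp_all add: n_def ob_def)
    then have "int (n v mod 2) = 1 - int (n u mod 2)"
        "int (ob v) = int (ob u) + of_bool (a \<in> odd_chords D)"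
      by (simp_all add: mod2_eq_if)
    moreover from this have "2 * int (ob v) - int (n v mod 2) = 2 * int (ob u) - int (n u mod 2) +
        2 * of_bool (a \<in> odd_chords D) - 1 + 2 * int (n u mod 2)"
      by linarith
    moreover have "(if ang r u < ang r v then a else b) = a"
      using 1 by simp
    ultimately show ?thesis
      unfolding wt_def n_def[symmetric] ob_def[symmetric] by (simp only: cong_refl simp_thms)
  next
    case 2
    have "n u = Suc (n v)" "ob u = ob v + of_bool (b \<in> odd_chords D)"
      using below_adj[OF D r _ 2] uv adj_commute sub mem by (simp_all add: n_def ob_def)
    then have "int (n v mod 2) = 1 - int (n u mod 2)"
        "int (ob u) = int (ob v) + of_bool (b \<in> odd_chords D)"
      by (simp_all add: mod2_eq_if)
    then show ?thesis
      using 2 by (simp add: wt_def n_def[symmetric] ob_def[symmetric] cong_iff_dvd_diff)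
  qed
  then show "parity r D v = 1 - parity r D u"
    and "[wt r D v = wt r D u + 2 * of_bool ((if ang r u < ang r v then a else b) \<in> odd_chords D)
           - 1 + 2 * parity r D u] (mod 4)"
    by blast+
qed

lemma parity_cases: "parity r D z = 0 \<or> parity r D z = 1"
  by auto

lemma odd_chords_iff_parity:
  assumes "chord_diagram D" "r \<in> core" "{p, q} \<in> D" "p \<noteq> q"
  shows "{p, q} \<in> odd_chords D \<longleftrightarrow> parity r D p = parity r D q"
  unfolding odd_chords_iff[OF assms] by (auto simp: mod2_eq_if)

lemma wt_parity: "\<exists>k. wt r D z = 2 * k - parity r D z"
  by (auto simp: wt_def)

text \<open>If the circle carried only the two ends, each would follow the other. The third end
  \<open>z\<close> occupies the arc between them that contains the cut.\<close>

lemma next_end_iff_less: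
  assumes D: "chord_diagram D" and r: "r \<in> core" and uv: "adj r D u v"
    and z: "z \<in> chord_ends D" "z \<noteq> u" "z \<noteq> v"
  shows "next_end D u v \<longleftrightarrow> ang r u < ang r v"
proof
  have core: "u \<in> core" "v \<in> core" "z \<in> core"
    using chord_ends_subset_core[OF D] uv z by (auto simp: adj_def)
  have mem: "u \<in> chord_ends D" "v \<in> chord_ends D" "u \<noteq> v"
    using uv by (auto simp: adj_def)
  show "ang r u < ang r v" if "next_end D u v"
  proof (rule ccontr)
    assume "\<not> ang r u < ang r v"
    moreover have "ang r u \<noteq> ang r v" "ang r z \<noteq> ang r u" "ang r z \<noteq> ang r v"
      using ang_inj[OF r] core mem z by blast+
    ultimately have "z \<in> open_arc u v"
      using in_open_arc_iff[OF r core(1,2), of z] uv z core unfolding adj_def by force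
    then show False
      using that z by (auto simp: next_end_def)
  qed
  show "next_end D u v" if "ang r u < ang r v"
    using mem uv that in_open_arc_iff[OF r core(1,2)] unfolding next_end_def adj_def by auto
qed


section \<open>Parity relations of the three moves\<close>

text \<open>The ends of \<open>a\<close> are neighbours, so \<open>n\<close> has different parities
  there and \<open>a\<close> is even; the step formula makes the value a multiple of 4. The last
  claim, needed for deleting \<open>a\<close>, holds because any other end has both ends of
  \<open>a\<close> before it or neither.\<close>

lemma R1_val:
  assumes D: "chord_diagram D" and a: "R1_chord D a"
  obtains r where "r \<in> core" "[val r D a = 0] (mod 4)" "a \<notin> odd_chords D"
    "\<And>z. z \<in> chord_ends D - a \<Longrightarrow> even (below r a z)"
proof -
  obtain p q where pq: "a = {p, q}" "adjacent D p q" "a \<in> D"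
    using a by (auto simp: R1_chord_def)
  obtain r where r: "r \<in> core" "adj r D p q"
    using adjacent_base[OF D pq(2)] by metis
  have ne: "p \<noteq> q"
    using r by (auto simp: adj_def)
  note w = adj_weights[OF D r pq(3) _ pq(3)]
  have even: "a \<notin> odd_chords D"
    using odd_chords_iff_parity[OF D r(1), of p q] pq ne w(1) parity_cases[of r D p] by auto
  moreover have "[val r D a = 0] (mod 4)"
  proof -
    obtain k where k: "wt r D p = 2 * k - parity r D p"
      using wt_parity by blast
    have "[wt r D q = wt r D p - 1 + 2 * parity r D p] (mod 4)"
      using w(2) pq even by simp
    then have "[1 + wt r D p + wt r D q = 1 + wt r D p + (wt r D p - 1 + 2 * parity r D p)] (mod 4)"
      by (intro cong_add cong_refl)
    also have "1 + wt r D p + (wt r D p - 1 + 2 * parity r D p) = 4 * k"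
      by (simp add: k)
    finally show ?thesis
      unfolding pq(1) val_doubleton[OF ne] by (simp add: cong_def)
  qed
  moreover have "even (below r a z)" if z: "z \<in> chord_ends D - a" for z
  proof -
    have "ang r p < ang r z \<longleftrightarrow> ang r q < ang r z"
      using adj_less_iff[OF D r] z pq by auto
    then have "{e \<in> a. ang r e < ang r z} = (if ang r p < ang r z then {p, q} else {})"
      using pq by auto
    then show ?thesis
      using ne by (simp add: below_def)
  qed
  ultimately show thesis
    using that r(1) by blast
qed

text \<open>From one chord to the other, \<open>n\<close> changes by one at both ends, so both
  chords have the same Gaussian parity. The two weight steps then add up to the negative of the
  first value modulo 4.\<close>

lemma R2_val:
  assumes D: "chord_diagram D" and A: "R2_pair D A"
  obtains a b r where "A = {a, b}" "a \<in> D" "b \<in> D" "a \<noteq> b" "r \<in> core"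
    "[val r D a + val r D b = 0] (mod 4)" "a \<in> odd_chords D \<longleftrightarrow> b \<in> odd_chords D"
    "\<And>z. z \<in> chord_ends D - \<Union>A \<Longrightarrow> even (below r (\<Union>A) z)"
proof -
  obtain a b p q u v where ab: "A = {a, b}" "a \<in> D" "b \<in> D" "a \<noteq> b" "a = {p, q}" "b = {u, v}"
      "adjacent D p u" "adjacent D q v"
    using A unfolding R2_pair_def by metis
  have "a \<inter> b = {}"
    using chord_unique[OF D ab(2,3)] ab(4) by blast
  then have disj: "p \<noteq> u" "p \<noteq> v" "q \<noteq> u" "q \<noteq> v"
    using ab by auto
  have "card a = 2" "card b = 2"
    using D ab by (auto simp: chord_diagram_def)
  then have ne: "p \<noteq> q" "u \<noteq> v"
    using ab by auto
  obtain r where r: "r \<in> core" and adj: "adj r D p u" "adj r D q v"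
    using adjacent_base[OF D ab(7)] ab(8) disj ne by (metis insertE singletonD)
  note w = adj_weights[OF D r adj(1) ab(2) _ ab(3)] adj_weights[OF D r adj(2) ab(2) _ ab(3)]
  have par: "parity r D u = 1 - parity r D p" "parity r D v = 1 - parity r D q"
    using w(1,3) ab by auto
  have same: "a \<in> odd_chords D \<longleftrightarrow> b \<in> odd_chords D"
    using odd_chords_iff_parity[OF D r, of p q] odd_chords_iff_parity[OF D r, of u v] par ab ne by auto
  define k :: int where "k = of_bool (a \<in> odd_chords D)"
  obtain i j where ij: "wt r D p = 2 * i - parity r D p" "wt r D q = 2 * j - parity r D q"
    using wt_parity by meson
  \<comment> \<open>The order of the ends on either short arc becomes irrelevant here, so parallel
    and crossing pairs need no distinction.\<close>
  have if_eq: "(if Q then a else b) \<in> odd_chords D \<longleftrightarrow> a \<in> odd_chords D" for Q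
    using same by simp
  have in_ab: "p \<in> a" "u \<in> b" "q \<in> a" "v \<in> b"
    using ab by auto
  have "[wt r D u = wt r D p + 2 * k - 1 + 2 * parity r D p] (mod 4)"
    using w(2)[OF in_ab(1,2)] unfolding if_eq k_def .
  moreover have "[wt r D v = wt r D q + 2 * k - 1 + 2 * parity r D q] (mod 4)"
    using w(4)[OF in_ab(3,4)] unfolding if_eq k_def .
  ultimately have "[(1 + wt r D p + wt r D q) + (1 + wt r D u + wt r D v) =
      (1 + wt r D p + wt r D q) + (1 + (wt r D p + 2 * k - 1 + 2 * parity r D p) +
        (wt r D q + 2 * k - 1 + 2 * parity r D q))] (mod 4)"
    by (intro cong_add cong_refl)
  also have "(1 + wt r D p + wt r D q) + (1 + (wt r D p + 2 * k - 1 + 2 * parity r D p) +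
        (wt r D q + 2 * k - 1 + 2 * parity r D q)) = 4 * (i + j + k)"
    by (simp add: ij)
  finally have "[val r D a + val r D b = 0] (mod 4)"
    unfolding ab(5,6) val_doubleton[OF ne(1)] val_doubleton[OF ne(2)] by (simp add: cong_def)
  moreover have "even (below r (\<Union>A) z)" if z: "z \<in> chord_ends D - \<Union>A" for z
  proof -
    have less: "ang r p < ang r z \<longleftrightarrow> ang r u < ang r z" "ang r q < ang r z \<longleftrightarrow> ang r v < ang r z"
      using adj_less_iff[OF D r adj(1)] adj_less_iff[OF D r adj(2)] z ab by auto
    have "{e \<in> \<Union>A. ang r e < ang r z} =
        (if ang r p < ang r z then {p, u} else {}) \<union> (if ang r q < ang r z then {q, v} else {})"
      using ab less by auto
    then show ?thesis
      using ne disj by (simp add: below_def)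
  qed
  ultimately show thesis
    using that[OF ab(1-4) r _ same] by blast
qed

text \<open>\<open>p1\<close>, \<open>p2\<close>, \<open>p3\<close> are the parities at
  \<open>a1\<close>, \<open>b2\<close>, \<open>c3\<close>, and \<open>d1\<close>, \<open>d2\<close>,
  \<open>d3\<close> the directions of the short arcs. Each unknown \<open>k1\<close>,
  \<open>k2\<close>, \<open>k3\<close> enters twice with coefficients 2 or -2, so it drops out
  modulo 4, and finitely many cases remain.\<close>

lemma R3_weights_arith:
  fixes p1 p2 p3 :: int
  assumes p: "p1 = 0 \<or> p1 = 1" "p2 = 0 \<or> p2 = 1" "p3 = 0 \<or> p3 = 1"
    and odd: "a \<longleftrightarrow> p1 = 1 - p3" "b \<longleftrightarrow> 1 - p1 = p2" "c \<longleftrightarrow> 1 - p2 = p3"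
  shows "(4::int) dvd
      (if d3 = d1 then 1 else -1) * (1 + (2 * k1 - p1) + ((2 * k3 - p3) + 2 * of_bool (if d3 then c else a) - 1 + 2 * p3)) +
      (if d1 = d2 then 1 else -1) * (1 + ((2 * k1 - p1) + 2 * of_bool (if d1 then a else b) - 1 + 2 * p1) + (2 * k2 - p2)) +
      (if d2 = d3 then 1 else -1) * (1 + ((2 * k2 - p2) + 2 * of_bool (if d2 then b else c) - 1 + 2 * p2) + (2 * k3 - p3))"
  using p unfolding odd by (elim disjE; hypsubst; cases d1; cases d2; cases d3; simp; presburger)

lemma R3_adj:
  assumes D: "chord_diagram D" and tri: "R3_triangle D a1 b1 b2 c2 c3 a3"
  obtains r where "r \<in> core" "adj r D a1 b1" "adj r D b2 c2" "adj r D c3 a3"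
    "distinct [a1, b1, b2, c2, c3, a3]"
proof -
  have mem: "{a1, a3} \<in> D" "{b1, b2} \<in> D" "{c2, c3} \<in> D"
    and ne: "{a1, a3} \<noteq> {b1, b2}" "{b1, b2} \<noteq> {c2, c3}" "{c2, c3} \<noteq> {a1, a3}"
    and adjacent: "adjacent D a1 b1" "adjacent D b2 c2" "adjacent D c3 a3"
    using tri by (auto simp: R3_triangle_def)
  have "card {a1, a3} = 2" "card {b1, b2} = 2" "card {c2, c3} = 2"
    using D mem by (auto simp: chord_diagram_def)
  then have "a1 \<noteq> a3" "b1 \<noteq> b2" "c2 \<noteq> c3"
    by auto
  moreover have "{a1, a3} \<inter> {b1, b2} = {}" "{b1, b2} \<inter> {c2, c3} = {}" "{c2, c3} \<inter> {a1, a3} = {}"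
    using chord_unique[OF D] mem ne by blast+
  ultimately have dist: "distinct [a1, b1, b2, c2, c3, a3]"
    by auto
  obtain r where "r \<in> core" "adj r D a1 b1"
      "\<And>u' v'. adjacent D u' v' \<Longrightarrow> u' \<notin> {a1, b1} \<Longrightarrow> v' \<notin> {a1, b1} \<Longrightarrow> adj r D u' v'"
    using adjacent_base[OF D adjacent(1)] by metis
  then show thesis
    using that adjacent dist by auto
qed

lemma R3_val:
  assumes D: "chord_diagram D" and tri: "R3_triangle D a1 b1 b2 c2 c3 a3"
  obtains r where "r \<in> core"
    "[chord_sign D c3 a3 a1 b1 * val r D {a1, a3} + chord_sign D a1 b1 b2 c2 * val r D {b1, b2} +
      chord_sign D b2 c2 c3 a3 * val r D {c2, c3} = 0] (mod 4)"
proof -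
  have mem: "{a1, a3} \<in> D" "{b1, b2} \<in> D" "{c2, c3} \<in> D"
    using tri by (auto simp: R3_triangle_def)
  obtain r where r: "r \<in> core" and adj: "adj r D a1 b1" "adj r D b2 c2" "adj r D c3 a3"
      and dist: "distinct [a1, b1, b2, c2, c3, a3]"
    using R3_adj[OF D tri] by blast
  have ends: "a1 \<in> chord_ends D" "b2 \<in> chord_ends D"
    using mem by blast+
  define d1 d2 d3 where "d1 = (ang r a1 < ang r b1)" and "d2 = (ang r b2 < ang r c2)"
    and "d3 = (ang r c3 < ang r a3)"
  have dir: "next_end D a1 b1 = d1" "next_end D b2 c2 = d2" "next_end D c3 a3 = d3"
    using next_end_iff_less[OF D r adj(1) ends(2)] next_end_iff_less[OF D r adj(2) ends(1)]
      next_end_iff_less[OF D r adj(3) ends(1)] dist by (auto simp: d1_def d2_def d3_def)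
  define a b c where "a = ({a1, a3} \<in> odd_chords D)" and "b = ({b1, b2} \<in> odd_chords D)"
    and "c = ({c2, c3} \<in> odd_chords D)"
  note w1 = adj_weights[OF D r adj(1) mem(1) _ mem(2)]
  note w2 = adj_weights[OF D r adj(2) mem(2) _ mem(3)]
  note w3 = adj_weights[OF D r adj(3) mem(3) _ mem(1)]
  have par: "parity r D b1 = 1 - parity r D a1" "parity r D c2 = 1 - parity r D b2"
      "parity r D a3 = 1 - parity r D c3"
    using w1(1) w2(1) w3(1) by auto
  obtain k1 k2 k3 where k: "wt r D a1 = 2 * k1 - parity r D a1" "wt r D b2 = 2 * k2 - parity r D b2"
      "wt r D c3 = 2 * k3 - parity r D c3"
    using wt_parity by meson
  have w: "[wt r D b1 = (2 * k1 - parity r D a1) + 2 * of_bool (if d1 then a else b) - 1 + 2 * parity r D a1] (mod 4)"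
      "[wt r D c2 = (2 * k2 - parity r D b2) + 2 * of_bool (if d2 then b else c) - 1 + 2 * parity r D b2] (mod 4)"
      "[wt r D a3 = (2 * k3 - parity r D c3) + 2 * of_bool (if d3 then c else a) - 1 + 2 * parity r D c3] (mod 4)"
    unfolding k[symmetric] using w1(2) w2(2) w3(2)
    by (auto simp: d1_def d2_def d3_def a_def b_def c_def split: if_splits)
  have "a \<longleftrightarrow> parity r D a1 = 1 - parity r D c3" "b \<longleftrightarrow> 1 - parity r D a1 = parity r D b2"
      "c \<longleftrightarrow> 1 - parity r D b2 = parity r D c3"
    using odd_chords_iff_parity[OF D r mem(1)] odd_chords_iff_parity[OF D r mem(2)]
      odd_chords_iff_parity[OF D r mem(3)] par dist by (simp_all add: a_def b_def c_def)
  note arith = R3_weights_arith[OF parity_cases[of r D a1] parity_cases[of r D b2]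
      parity_cases[of r D c3] this, of d3 d1 k1 k3 d2 k2]
  show thesis
  proof (rule that[OF r])
    have vals: "val r D {a1, a3} = 1 + (2 * k1 - parity r D a1) + wt r D a3"
        "val r D {b1, b2} = 1 + wt r D b1 + (2 * k2 - parity r D b2)"
        "val r D {c2, c3} = 1 + wt r D c2 + (2 * k3 - parity r D c3)"
      using dist by (simp_all add: val_doubleton k)
    show "[chord_sign D c3 a3 a1 b1 * val r D {a1, a3} + chord_sign D a1 b1 b2 c2 * val r D {b1, b2} +
      chord_sign D b2 c2 c3 a3 * val r D {c2, c3} = 0] (mod 4)"
      unfolding chord_sign_def dir vals
      by (rule cong_trans[OF _ arith[folded cong_0_iff]])
        (intro cong_add cong_mult cong_refl w)
  qed
qed

section \<open>Invariance of the weights under elementary morphisms\<close>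

lemma below_Un:
  assumes "finite F" "finite G" "F \<inter> G = {}"
  shows "below r (F \<union> G) z = below r F z + below r G z"
proof -
  have "{e \<in> F \<union> G. ang r e < ang r z} = {e \<in> F. ang r e < ang r z} \<union> {e \<in> G. ang r e < ang r z}"
    by blast
  then show ?thesis
    unfolding below_def using assms by (simp add: card_Un_disjoint disjoint_iff)
qed

text \<open>A remaining end has an even number of deleted ends before it, so its parity is kept.
  Since the deleted chords are all even or all odd, also the number of odd ends before it changes by
  an even amount, and twice that amount vanishes modulo 4.\<close>

lemma delete_chords:
  assumes D: "chord_diagram D" and A: "A \<subseteq> D" and r: "r \<in> core"
    and even: "\<And>z. z \<in> chord_ends D - \<Union>A \<Longrightarrow> even (below r (\<Union>A) z)"
    and odd: "A \<inter> odd_chords D = {} \<or> A \<subseteq> odd_chords D"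
  shows "odd_chords (D - A) = odd_chords D - A"
    and "v \<in> D - A \<Longrightarrow> [val r (D - A) v = val r D v] (mod 4)"
proof -
  have D': "chord_diagram (D - A)"
    using chord_diagram_mono[OF D] by blast
  have fin: "finite (\<Union>S)" if "S \<subseteq> D" for S
    using finite_chord_ends[OF chord_diagram_mono[OF D that]] .
  have split: "below r (\<Union>S) z = below r (\<Union>(S - A)) z + below r (\<Union>(S \<inter> A)) z" if S: "S \<subseteq> D" for S z
  proof -
    have "\<Union>S = \<Union>(S - A) \<union> \<Union>(S \<inter> A)"
      by blast
    moreover have "\<Union>(S - A) \<inter> \<Union>(S \<inter> A) = {}"
    proof (rule equals0I)
      fix e assume "e \<in> \<Union>(S - A) \<inter> \<Union>(S \<inter> A)"
      then obtain c c' where c: "e \<in> c" "c \<in> S - A" "e \<in> c'" "c' \<in> S \<inter> A"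
        by blast
      then have "c = c'"
        using chord_unique[OF D, of c c' e] S by blast
      then show False
        using c by blast
    qed
    moreover have "finite (\<Union>(S - A))" "finite (\<Union>(S \<inter> A))"
      using S by (intro fin; blast)+
    ultimately show ?thesis
      using below_Un by metis
  qed
  have outside: "z \<in> chord_ends D - \<Union>A" if "v \<in> D - A" "z \<in> v" for v z
  proof -
    have "z \<notin> c" if "c \<in> A" for c
      using chord_unique[OF D, of v c z] that A \<open>v \<in> D - A\<close> \<open>z \<in> v\<close> by blast
    then show ?thesis
      using that by blast
  qed
  have n: "even (below r (chord_ends D) z) \<longleftrightarrow> even (below r (chord_ends (D - A)) z)"
    if "z \<in> chord_ends D - \<Union>A" for z
    using split[of D z] even[OF that] A by (simp add: Int_absorb1)
  show odds: "odd_chords (D - A) = odd_chords D - A"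
  proof (rule Set.set_eqI)
    fix v
    show "v \<in> odd_chords (D - A) \<longleftrightarrow> v \<in> odd_chords D - A"
    proof (cases "v \<in> D - A")
      case True
      obtain p q where pq: "v = {p, q}" "p \<noteq> q"
        using chordE[OF D] True by (metis DiffD1)
      have "even (below r (chord_ends D) p + below r (chord_ends D) q) \<longleftrightarrow>
          even (below r (chord_ends (D - A)) p + below r (chord_ends (D - A)) q)"
        using n[OF outside[OF True, of p]] n[OF outside[OF True, of q]] pq by simp
      then show ?thesis
        using odd_chords_iff[OF D r, of p q] odd_chords_iff[OF D' r, of p q] pq True by simp
    next
      case False
      then show ?thesis
        using odd_chords_subset[of D] odd_chords_subset[of "D - A"] by blast
    qed
  qed
  show "[val r (D - A) v = val r D v] (mod 4)" if v: "v \<in> D - A"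
  proof -
    have "[wt r (D - A) z = wt r D z] (mod 4)" if z: "z \<in> v" for z
    proof -
      have zo: "z \<in> chord_ends D - \<Union>A"
        using outside[OF v z] .
      have "odd_chords D \<inter> A = {} \<or> odd_chords D \<inter> A = A"
        using odd by blast
      then have "even (below r (\<Union>(odd_chords D \<inter> A)) z)"
        using even[OF zo] by (auto simp: below_def)
      then have "even (below r (odd_ends (D - A)) z) \<longleftrightarrow> even (below r (odd_ends D) z)"
        unfolding odds using split[OF odd_chords_subset, of z] by simp
      then have "[2 * int (below r (odd_ends (D - A)) z) = 2 * int (below r (odd_ends D) z)] (mod 4)"
        by (rule cong_double_int)
      moreover have "below r (chord_ends D) z mod 2 = below r (chord_ends (D - A)) z mod 2"
        using n[OF zo] by (auto simp: mod2_eq_if)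
      ultimately show ?thesis
        unfolding wt_def by (simp add: cong_diff)
    qed
    then show ?thesis
      unfolding val_def by (intro cong_add cong_sum cong_refl)
  qed
qed

lemma below_image_cong:
  assumes "inj_on s F" "\<And>e. e \<in> F \<Longrightarrow> ang r' (s e) < ang r' (s z) \<longleftrightarrow> ang r e < ang r z"
  shows "below r' (s ` F) (s z) = below r F z"
proof -
  have "{e \<in> s ` F. ang r' e < ang r' (s z)} = s ` {e \<in> F. ang r e < ang r z}"
    using assms(2) by auto
  then show ?thesis
    unfolding below_def using assms(1) by (auto intro!: card_image inj_on_subset[OF assms(1)])
qed

lemma chord_ends_image: "chord_ends ((`) s ` D) = s ` chord_ends D"
  by blast

lemma chord_diagram_image:
  assumes D: "chord_diagram D" and s: "inj_on s (chord_ends D)" "s ` chord_ends D \<subseteq> core"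
  shows "chord_diagram ((`) s ` D)"
proof -
  show ?thesis
    unfolding chord_diagram_def pairwise_def disjnt_def
  proof (intro conjI ballI impI)
    show "finite ((`) s ` D)"
      using D by (simp add: chord_diagram_def)
  next
    fix x assume "x \<in> (`) s ` D"
    then obtain c where c: "c \<in> D" "x = s ` c"
      by blast
    have "c \<subseteq> chord_ends D"
      using c by blast
    then show "x \<subseteq> core"
      unfolding c(2) using s(2) by (meson image_mono subset_trans)
    have "card x = card c"
      unfolding c(2) by (rule card_image[OF inj_on_subset[OF s(1) \<open>c \<subseteq> chord_ends D\<close>]])
    then show "card x = 2"
      using D c(1) by (simp add: chord_diagram_def)
  next
    fix x y assume "x \<in> (`) s ` D" "y \<in> (`) s ` D" "x \<noteq> y"
    then obtain c d where c: "c \<in> D" "x = s ` c" "d \<in> D" "y = s ` d" "c \<noteq> d"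
      by blast
    have "c \<inter> d = {}"
      using chord_unique[OF D c(1,3)] c(5) by blast
    then show "x \<inter> y = {}"
      using inj_on_image_Int[OF s(1), of c d] c by (metis Sup_upper image_empty)
  qed
qed

lemma odd_chords_image:
  assumes D: "chord_diagram D" and D': "chord_diagram ((`) s ` D)" and s: "inj_on s (chord_ends D)"
    and r: "r \<in> core" "r' \<in> core"
    and par: "\<And>p q. {p, q} \<in> D \<Longrightarrow> p \<noteq> q \<Longrightarrow>
      even (below r' (chord_ends ((`) s ` D)) (s p) + below r' (chord_ends ((`) s ` D)) (s q)) \<longleftrightarrow>
      even (below r (chord_ends D) p + below r (chord_ends D) q)"
  shows "odd_chords ((`) s ` D) = (`) s ` odd_chords D"
proof -
  have *: "s ` c \<in> odd_chords ((`) s ` D) \<longleftrightarrow> c \<in> odd_chords D" if c: "c \<in> D" for c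
  proof -
    obtain p q where pq: "c = {p, q}" "p \<noteq> q"
      using chordE[OF D c] by metis
    have "p \<in> chord_ends D" "q \<in> chord_ends D"
      using c pq by blast+
    then have "s p \<noteq> s q" "s ` c = {s p, s q}" "s ` c \<in> (`) s ` D"
      using c pq inj_onD[OF s, of p q] by blast+
    then show ?thesis
      using odd_chords_iff[OF D r(1), of p q] odd_chords_iff[OF D' r(2), of "s p" "s q"] par[of p q] pq c
      by simp
  qed
  show ?thesis
  proof (rule Set.set_eqI)
    fix x
    have "x \<in> odd_chords ((`) s ` D) \<longleftrightarrow> (\<exists>c\<in>D. x = s ` c \<and> s ` c \<in> odd_chords ((`) s ` D))"
      using odd_chords_subset by blast
    also have "\<dots> \<longleftrightarrow> (\<exists>c\<in>D. x = s ` c \<and> c \<in> odd_chords D)"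
      using * by blast
    also have "\<dots> \<longleftrightarrow> x \<in> (`) s ` odd_chords D"
      using odd_chords_subset by blast
    finally show "x \<in> odd_chords ((`) s ` D) \<longleftrightarrow> x \<in> (`) s ` odd_chords D" .
  qed
qed

text \<open>The new base point is the image of the old one. For \<open>x\<close> other than
  \<open>r\<close>, the condition \<open>ang r x < ang r y\<close> says that \<open>x\<close> lies
  on the arc from \<open>r\<close> to \<open>y\<close>, which \<open>h\<close> respects. So all
  counts, and with them the values, agree as integers and not only modulo 4.\<close>

lemma homeo_val:
  assumes D: "chord_diagram D" and h: "orientation_preserving_homeo h"
  obtains r r' where "r \<in> core" "r' \<in> core" "chord_diagram ((`) h ` D)"
    "\<And>v. v \<in> D \<Longrightarrow> val r' ((`) h ` D) (h ` v) = val r D v"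
proof -
  obtain g where g: "homeomorphism core core h g"
    using h by (auto simp: orientation_preserving_homeo_def)
  have inj: "inj_on h core" and img: "h ` core = core"
    using g unfolding homeomorphism_def by (metis inj_on_inverseI, blast)
  have arc: "h y \<in> open_arc (h x) (h z)" if "x \<in> core" "y \<in> core" "z \<in> core" "y \<in> open_arc x z" for x y z
    using h that by (auto simp: orientation_preserving_homeo_def)
  define r :: complex where "r = 1"
  have r: "r \<in> core" "h r \<in> core"
    using img by (auto simp: r_def)
  have hcore: "h x \<in> core" if "x \<in> core" for x
    using img that by blast
  have mono: "ang (h r) (h x) < ang (h r) (h y)" if xy: "x \<in> core" "y \<in> core" "ang r x < ang r y" for x y
  proof (cases "x = r")
    case True
    have "ang (h r) (h y) \<noteq> ang (h r) (h r)"
      using ang_inj[OF r(2) hcore[OF xy(2)] r(2)] inj_onD[OF inj, of y r] xy r True by auto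
    then show ?thesis
      using True r by (metis ang_ge_0 ang_self order_le_imp_less_or_eq)
  next
    case False
    have "ang r x \<noteq> ang r r"
      using ang_inj[OF r(1) xy(1) r(1)] False by blast
    then have "ang r r < ang r x"
      using r by (metis ang_ge_0 ang_self order_le_imp_less_or_eq)
    then have "x \<in> open_arc r y"
      using in_open_arc_iff[OF r(1) r(1) xy(2), of x] xy by auto
    then have "h x \<in> open_arc (h r) (h y)"
      using arc r xy by blast
    then show ?thesis
      using in_open_arc_iff[OF r(2) r(2) hcore[OF xy(2)], of "h x"] r
        ang_ge_0[of "h r" "h y"] by (auto split: if_splits simp del: ang_ge_0)
  qed
  have iff: "ang (h r) (h x) < ang (h r) (h y) \<longleftrightarrow> ang r x < ang r y" if "x \<in> core" "y \<in> core" for x y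
    using mono[OF that] mono[OF that(2,1)] ang_inj[OF r(1) that] by (metis linorder_neqE_linordered_idom less_asym less_irrefl)
  have below: "below (h r) (h ` F) (h z) = below r F z" if Fz: "F \<subseteq> chord_ends D" "z \<in> chord_ends D" for F z
  proof (rule below_image_cong)
    have core: "F \<subseteq> core" "z \<in> core"
      using chord_ends_subset_core[OF D] Fz by blast+
    show "inj_on h F"
      using inj core inj_on_subset by blast
    show "ang (h r) (h e) < ang (h r) (h z) \<longleftrightarrow> ang r e < ang r z" if "e \<in> F" for e
      using iff core that by blast
  qed
  have injD: "inj_on h (chord_ends D)"
    using inj chord_ends_subset_core[OF D] inj_on_subset by blast
  have D': "chord_diagram ((`) h ` D)"
    using chord_diagram_image[OF D injD] chord_ends_subset_core[OF D] hcore by blast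
  have odds: "odd_chords ((`) h ` D) = (`) h ` odd_chords D"
  proof (rule odd_chords_image[OF D D' injD r])
    fix p q assume "{p, q} \<in> D"
    then have "p \<in> chord_ends D" "q \<in> chord_ends D"
      by blast+
    then show "even (below (h r) (chord_ends ((`) h ` D)) (h p) + below (h r) (chord_ends ((`) h ` D)) (h q)) \<longleftrightarrow>
      even (below r (chord_ends D) p + below r (chord_ends D) q)"
      unfolding chord_ends_image using below[of "chord_ends D"] by simp
  qed
  have wt: "wt (h r) ((`) h ` D) (h z) = wt r D z" if "z \<in> chord_ends D" for z
    unfolding wt_def odds chord_ends_image
    using below[of "chord_ends D" z] below[of "odd_ends D" z] that odd_chords_subset[of D]
    by (simp add: Union_mono)
  show thesis
  proof (rule that[OF r D'])
    fix v assume v: "v \<in> D"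
    then have "inj_on h v"
      using injD inj_on_subset by blast
    then have "val (h r) ((`) h ` D) (h ` v) = 1 + (\<Sum>p\<in>v. wt (h r) ((`) h ` D) (h p))"
      unfolding val_def by (simp add: sum.reindex)
    also have "(\<Sum>p\<in>v. wt (h r) ((`) h ` D) (h p)) = (\<Sum>p\<in>v. wt r D p)"
      using v wt by (intro sum.cong) auto
    finally show "val (h r) ((`) h ` D) (h ` v) = val r D v"
      by (simp add: val_def)
  qed
qed

section \<open>Exchanging neighbouring ends, as in a third Reidemeister move\<close>

lemma swap_below:
  assumes D: "chord_diagram D" and r: "r \<in> core"
    and s: "\<And>e. e \<in> chord_ends D \<Longrightarrow> s e \<in> chord_ends D \<and> s (s e) = e"
      "\<And>e. e \<in> chord_ends D \<Longrightarrow> s e \<noteq> e \<Longrightarrow> adj r D e (s e)"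
    and F: "F \<subseteq> chord_ends D" and z: "z \<in> chord_ends D"
  shows "even (below r (s ` F) (s z)) \<longleftrightarrow> even (below r F z + of_bool (s z \<noteq> z \<and> s z \<in> F))"
proof -
  have fin: "finite F"
    using F finite_chord_ends[OF D] finite_subset by blast
  have inj: "inj_on s F"
    using s(1) F by (metis inj_on_inverseI subsetD)
  define X where "X = {e \<in> F. ang r (s e) < ang r (s z)}"
  define Y where "Y = {e \<in> F. ang r e < ang r z}"
  have "{x \<in> s ` F. ang r x < ang r (s z)} = s ` X"
    unfolding X_def by blast
  then have bX: "below r (s ` F) (s z) = card X"
    unfolding below_def using inj by (simp add: card_image inj_on_subset X_def)
  have bY: "below r F z = card Y"
    by (simp add: below_def Y_def)
  \<comment> \<open>An exchange of two neighbours changes no comparison with a third end; it is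
    applied at \<open>e\<close> and then at \<open>z\<close>.\<close>
  have same: "e \<in> X \<longleftrightarrow> e \<in> Y" if e: "e \<in> F" "e \<noteq> z" "e \<noteq> s z" for e
  proof -
    have eD: "e \<in> chord_ends D" "s z \<in> chord_ends D" "s z \<noteq> s e" "s e \<in> chord_ends D"
      using e F s(1) z by (blast, blast, metis subsetD, blast)
    have "ang r (s e) < ang r (s z) \<longleftrightarrow> ang r e < ang r (s z)"
    proof (cases "s e = e")
      case False
      then show ?thesis
        using adj_less_iff(2)[OF D r s(2)[OF eD(1) False], of "s z"] eD e(3) by auto
    qed simp
    also have "\<dots> \<longleftrightarrow> ang r e < ang r z"
    proof (cases "s z = z")
      case False
      then show ?thesis
        using adj_less_iff(1)[OF D r s(2)[OF z False], of e] eD e by auto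
    qed simp
    finally show ?thesis
      using e by (simp add: X_def Y_def)
  qed
  have z_notin: "z \<notin> X" "z \<notin> Y"
    by (auto simp: X_def Y_def)
  show ?thesis
  proof (cases "s z \<noteq> z \<and> s z \<in> F")
    case False
    have "e \<in> X \<longleftrightarrow> e \<in> Y" for e
    proof (cases "e \<in> F \<and> e \<noteq> z \<and> e \<noteq> s z")
      case True
      then show ?thesis
        using same by blast
    next
      case nF: False
      then have "e \<notin> F \<or> e = z"
        using False by auto
      then show ?thesis
        using z_notin by (auto simp: X_def Y_def)
    qed
    then have "X = Y"
      by blast
    then show ?thesis
      using False by (simp add: bX bY)
  next
    case True
    have core: "z \<in> core" "s z \<in> core"
      using chord_ends_subset_core[OF D] z s(1) by blast+
    then have "ang r z \<noteq> ang r (s z)"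
      using ang_inj[OF r] True by metis
    \<comment> \<open>The exchange reverses the order of \<open>z\<close> and \<open>s z\<close>, so
      exactly one of the two counts includes \<open>s z\<close>.\<close>
    then have diff: "s z \<in> X \<longleftrightarrow> s z \<notin> Y"
      using True s(1)[OF z] by (auto simp: X_def Y_def)
    have "X - {s z} = Y - {s z}"
    proof (rule Set.set_eqI)
      fix e
      show "e \<in> X - {s z} \<longleftrightarrow> e \<in> Y - {s z}"
        using same[of e] z_notin by (cases "e \<in> F") (auto simp: X_def Y_def)
    qed
    moreover have "finite X" "finite Y"
      using fin by (auto simp: X_def Y_def)
    ultimately have "card X = Suc (card Y) \<or> card Y = Suc (card X)"
      using diff by (metis Diff_empty Diff_insert0 card.remove)
    then show ?thesis
      using True by (auto simp: bX bY)
  qed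
qed

text \<open>Each chord has both ends moved or none, so the sum of its two counts keeps its parity
  and odd chords remain odd. A moved end passes exactly one end, \<open>s z\<close>, which flips its
  parity and changes its odd count by one if \<open>s z\<close> belongs to an odd chord.\<close>

lemma swap_weights:
  assumes D: "chord_diagram D" and r: "r \<in> core"
    and s: "\<And>e. e \<in> chord_ends D \<Longrightarrow> s e \<in> chord_ends D \<and> s (s e) = e"
      "\<And>e. e \<in> chord_ends D \<Longrightarrow> s e \<noteq> e \<Longrightarrow> adj r D e (s e)"
      "\<And>p q. {p, q} \<in> D \<Longrightarrow> s p = p \<longleftrightarrow> s q = q"
  shows "chord_diagram ((`) s ` D)" "inj_on s (chord_ends D)"
    and "z \<in> chord_ends D \<Longrightarrow> [wt r ((`) s ` D) (s z) = wt r D z +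
      (if s z = z then 0 else 2 * of_bool (s z \<in> odd_ends D) - 1 + 2 * parity r D z)] (mod 4)"
proof -
  show inj: "inj_on s (chord_ends D)"
    using s(1) by (metis inj_on_inverseI)
  have img: "s ` chord_ends D = chord_ends D"
    using s(1) by (metis image_eqI subset_antisym subsetI image_subsetI)
  show D': "chord_diagram ((`) s ` D)"
    using chord_diagram_image[OF D inj] chord_ends_subset_core[OF D] img by simp
  define n where "n = below r (chord_ends D)"
  have n: "even (n (s z)) \<longleftrightarrow> even (n z + of_bool (s z \<noteq> z))" if "z \<in> chord_ends D" for z
    using swap_below[OF D r s(1,2) order_refl that] s(1)[OF that] by (simp add: img n_def)
  have odds: "odd_chords ((`) s ` D) = (`) s ` odd_chords D"
  proof (rule odd_chords_image[OF D D' inj r r])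
    fix p q assume pq: "{p, q} \<in> D"
    have "p \<in> chord_ends D" "q \<in> chord_ends D"
      using pq by blast+
    then show "even (below r (chord_ends ((`) s ` D)) (s p) + below r (chord_ends ((`) s ` D)) (s q)) \<longleftrightarrow>
        even (below r (chord_ends D) p + below r (chord_ends D) q)"
      unfolding chord_ends_image img n_def[symmetric] using n[of p] n[of q] s(3)[OF pq]
      by (cases "s p = p") simp_all
  qed
  have sub: "odd_ends D \<subseteq> chord_ends D"
    using odd_chords_subset by blast
  show "[wt r ((`) s ` D) (s z) = wt r D z +
      (if s z = z then 0 else 2 * of_bool (s z \<in> odd_ends D) - 1 + 2 * parity r D z)] (mod 4)"
    if z: "z \<in> chord_ends D"
  proof -
    define o1 o2 where "o1 = below r (odd_ends D) z" and "o2 = below r (s ` odd_ends D) (s z)"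
    have wts: "wt r ((`) s ` D) (s z) = 2 * int o2 - int (n (s z) mod 2)"
        "wt r D z = 2 * int o1 - int (n z mod 2)"
      by (simp_all add: wt_def odds chord_ends_image img o1_def o2_def n_def)
    have o: "[2 * int o2 = 2 * int (o1 + of_bool (s z \<noteq> z \<and> s z \<in> odd_ends D))] (mod 4)"
      unfolding o1_def o2_def by (rule cong_double_int[OF swap_below[OF D r s(1,2) sub z]])
    show ?thesis
    proof (cases "s z = z")
      case True
      then show ?thesis
        using o cong_diff[OF o cong_refl[of "int (n z mod 2)"]] unfolding wts by simp
    next
      case False
      have "int (n (s z) mod 2) = 1 - int (n z mod 2)"
        using n[OF z] False by (auto simp: mod2_eq_if)
      moreover have "int (o1 + of_bool (s z \<noteq> z \<and> s z \<in> odd_ends D)) = int o1 + of_bool (s z \<in> odd_ends D)"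
        using False by simp
      moreover have "2 * (k + t) - (1 - m) = 2 * k - m + (2 * t - 1 + 2 * m)" for k t m :: int
        by simp
      ultimately show ?thesis
        using cong_diff[OF o cong_refl[of "1 - int (n z mod 2)"]]
        unfolding wts n_def[symmetric] if_not_P[OF False] by metis
    qed
  qed
qed

text \<open>By the facts \<open>abc\<close>, each chord is odd exactly if the parities at the
  reference ends of its two short arcs differ. Hence an even number of the three chords are odd, and
  this makes the two weight changes on each chord cancel modulo 4.\<close>

lemma R3_invariant:
  assumes D: "chord_diagram D" and tri: "R3_triangle D a1 b1 b2 c2 c3 a3"
    and s: "s = R3_swap a1 b1 b2 c2 c3 a3"
  obtains r where "r \<in> core" "chord_diagram ((`) s ` D)"
    "\<And>v. v \<in> D \<Longrightarrow> [val r ((`) s ` D) (s ` v) = val r D v] (mod 4)"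
proof -
  have mem: "{a1, a3} \<in> D" "{b1, b2} \<in> D" "{c2, c3} \<in> D"
    using tri by (auto simp: R3_triangle_def)
  obtain r where r: "r \<in> core" and adj: "adj r D a1 b1" "adj r D b2 c2" "adj r D c3 a3"
      and dist: "distinct [a1, b1, b2, c2, c3, a3]"
    using R3_adj[OF D tri] by blast
  have s_eqs: "s a1 = b1" "s b1 = a1" "s b2 = c2" "s c2 = b2" "s c3 = a3" "s a3 = c3"
      "\<And>e. e \<notin> {a1, b1, b2, c2, c3, a3} \<Longrightarrow> s e = e"
    using dist by (auto simp: s R3_swap_def Transposition.transpose_def)
  have "{a1, a3} \<union> {b1, b2} \<union> {c2, c3} \<subseteq> chord_ends D"
    using mem by (intro Un_least Union_upper)
  then have six: "a1 \<in> chord_ends D" "b1 \<in> chord_ends D" "b2 \<in> chord_ends D"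
      "c2 \<in> chord_ends D" "c3 \<in> chord_ends D" "a3 \<in> chord_ends D"
    by simp_all
  have s1: "s e \<in> chord_ends D \<and> s (s e) = e" if "e \<in> chord_ends D" for e
  proof (cases "e \<in> {a1, b1, b2, c2, c3, a3}")
    case True
    then show ?thesis
      using s_eqs(1-6) six by (elim insertE emptyE) simp_all
  next
    case False
    then show ?thesis
      using s_eqs(7) that by simp
  qed
  have moved: "s e \<noteq> e \<longleftrightarrow> e \<in> {a1, b1, b2, c2, c3, a3}" for e
  proof
    show "s e \<noteq> e" if "e \<in> {a1, b1, b2, c2, c3, a3}"
      using that s_eqs(1-6) dist by (elim insertE emptyE) auto
  qed (use s_eqs(7) in blast)
  have s2: "adj r D e (s e)" if "s e \<noteq> e" for e
    using that[unfolded moved] adj adj[THEN adj_commute[THEN iffD1]] s_eqs(1-6)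
    by (elim insertE emptyE) simp_all
  have tri_cases: "{p, q} = {a1, a3} \<or> {p, q} = {b1, b2} \<or> {p, q} = {c2, c3} \<or>
      p \<notin> {a1, b1, b2, c2, c3, a3} \<and> q \<notin> {a1, b1, b2, c2, c3, a3}" if pq: "{p, q} \<in> D" for p q
  proof (rule ccontr)
    assume *: "\<not> ?thesis"
    have "x \<notin> {a1, a3} \<and> x \<notin> {b1, b2} \<and> x \<notin> {c2, c3}" if "x \<in> {p, q}" for x
      using chord_unique[OF D pq mem(1) that] chord_unique[OF D pq mem(2) that]
        chord_unique[OF D pq mem(3) that] * by blast
    from this[of p] this[of q] show False
      using * by simp
  qed
  have s3: "s p = p \<longleftrightarrow> s q = q" if pq: "{p, q} \<in> D" for p q
  proof -
    have "p \<in> {a1, b1, b2, c2, c3, a3} \<longleftrightarrow> q \<in> {a1, b1, b2, c2, c3, a3}"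
      using tri_cases[OF pq] by (elim disjE) (auto simp: doubleton_eq_iff)
    then show ?thesis
      using moved by blast
  qed
  note sw = swap_weights[OF D r s1 s2 s3]
  have par: "parity r D b1 = 1 - parity r D a1" "parity r D c2 = 1 - parity r D b2"
      "parity r D a3 = 1 - parity r D c3"
    using adj_weights(1)[OF D r adj(1) mem(1) _ mem(2)] adj_weights(1)[OF D r adj(2) mem(2) _ mem(3)]
      adj_weights(1)[OF D r adj(3) mem(3) _ mem(1)] by auto
  define a b c :: bool where "a = ({a1, a3} \<in> odd_chords D)" and "b = ({b1, b2} \<in> odd_chords D)"
    and "c = ({c2, c3} \<in> odd_chords D)"
  have odd_end: "a1 \<in> odd_ends D \<longleftrightarrow> a" "a3 \<in> odd_ends D \<longleftrightarrow> a" "b1 \<in> odd_ends D \<longleftrightarrow> b"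
      "b2 \<in> odd_ends D \<longleftrightarrow> b" "c2 \<in> odd_ends D \<longleftrightarrow> c" "c3 \<in> odd_ends D \<longleftrightarrow> c"
    using mem_odd_ends_iff[OF D mem(1)] mem_odd_ends_iff[OF D mem(2)] mem_odd_ends_iff[OF D mem(3)]
    by (auto simp: a_def b_def c_def)
  have abc: "a \<longleftrightarrow> parity r D a1 = 1 - parity r D c3" "b \<longleftrightarrow> 1 - parity r D a1 = parity r D b2"
      "c \<longleftrightarrow> 1 - parity r D b2 = parity r D c3"
    using odd_chords_iff_parity[OF D r mem(1)] odd_chords_iff_parity[OF D r mem(2)]
      odd_chords_iff_parity[OF D r mem(3)] par dist by (simp_all add: a_def b_def c_def)
  \<comment> \<open>The change of the weight of \<open>z\<close> caused by the exchange, as computed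
    in \<open>swap_weights\<close>.\<close>
  define \<delta> where "\<delta> z = (if s z = z then 0 else 2 * of_bool (s z \<in> odd_ends D) - 1 + 2 * parity r D z)" for z
  have cong: "[\<delta> p + \<delta> q = 0] (mod 4)" if pq: "{p, q} \<in> D" for p q
  proof -
    have move: "s z \<noteq> z" if "z \<in> {a1, b1, b2, c2, c3, a3}" for z
      using moved that by blast
    have "\<delta> a1 = 2 * of_bool b - 1 + 2 * parity r D a1" "\<delta> b1 = 2 * of_bool a - 1 + 2 * parity r D b1"
        "\<delta> b2 = 2 * of_bool c - 1 + 2 * parity r D b2" "\<delta> c2 = 2 * of_bool b - 1 + 2 * parity r D c2"
        "\<delta> c3 = 2 * of_bool a - 1 + 2 * parity r D c3" "\<delta> a3 = 2 * of_bool c - 1 + 2 * parity r D a3"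
      using move[of a1] move[of b1] move[of b2] move[of c2] move[of c3] move[of a3]
      unfolding \<delta>_def by (simp_all add: odd_end s_eqs(1-6) del: Union_iff)
    note \<delta> = this[unfolded par]
    have sums: "4 dvd \<delta> a1 + \<delta> a3" "4 dvd \<delta> b1 + \<delta> b2" "4 dvd \<delta> c2 + \<delta> c3"
      unfolding \<delta> abc using parity_cases[of r D a1] parity_cases[of r D b2] parity_cases[of r D c3]
      by (elim disjE; simp)+
    consider "{p, q} = {a1, a3}" | "{p, q} = {b1, b2}" | "{p, q} = {c2, c3}"
      | "p \<notin> {a1, b1, b2, c2, c3, a3}" "q \<notin> {a1, b1, b2, c2, c3, a3}"
      using tri_cases[OF pq] by blast
    then show ?thesis
    proof cases
      case 4
      then have "\<delta> p = 0" "\<delta> q = 0"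
        using s_eqs(7) by (simp_all add: \<delta>_def)
      then show ?thesis
        by simp
    qed (use sums in \<open>auto simp: doubleton_eq_iff cong_0_iff add.commute\<close>)
  qed
  show thesis
  proof (rule that[OF r sw(1)])
    fix v assume v: "v \<in> D"
    obtain p q where pq: "v = {p, q}" "p \<noteq> q"
      using chordE[OF D v] by metis
    have ends: "p \<in> chord_ends D" "q \<in> chord_ends D"
      using v pq by blast+
    then have "s p \<noteq> s q" "s ` v = {s p, s q}"
      using inj_onD[OF sw(2)] pq by auto
    then have "val r ((`) s ` D) (s ` v) = 1 + wt r ((`) s ` D) (s p) + wt r ((`) s ` D) (s q)"
      by (simp add: val_doubleton)
    also have "[\<dots> = 1 + (wt r D p + \<delta> p) + (wt r D q + \<delta> q)] (mod 4)"
      unfolding \<delta>_def using sw(3) ends by (intro cong_add cong_refl) auto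
    also have "1 + (wt r D p + \<delta> p) + (wt r D q + \<delta> q) = val r D v + (\<delta> p + \<delta> q)"
      by (simp add: pq val_doubleton)
    also have "[val r D v + (\<delta> p + \<delta> q) = val r D v + 0] (mod 4)"
      using cong v pq by (intro cong_add cong_refl) auto
    finally show "[val r ((`) s ` D) (s ` v) = val r D v] (mod 4)"
      by simp
  qed auto
qed

lemma elementary_source: "elementary D f \<Longrightarrow> chord_diagram D"
proof (cases f)
  fix a assume "f = R1_inc a" "elementary D f"
  then show ?thesis
    using chord_diagram_mono[of "insert a D" D] by auto
next
  fix A assume "f = R2_inc A" "elementary D f"
  then show ?thesis
    using chord_diagram_mono[of "D \<union> A" D] by auto
qed auto

lemma R1_delete:
  assumes D: "chord_diagram D" and a: "R1_chord D a"
  obtains r where "r \<in> core" "\<And>v. v \<in> D - {a} \<Longrightarrow> [val r (D - {a}) v = val r D v] (mod 4)"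
proof -
  obtain r where r: "r \<in> core" "a \<notin> odd_chords D" "\<And>z. z \<in> chord_ends D - a \<Longrightarrow> even (below r a z)"
    using R1_val[OF D a] by metis
  moreover have "a \<in> D"
    using a by (simp add: R1_chord_def)
  ultimately show thesis
    using that[OF r(1)] delete_chords(2)[OF D _ r(1), of "{a}"] by auto
qed

lemma R2_delete:
  assumes D: "chord_diagram D" and A: "R2_pair D A"
  obtains r where "r \<in> core" "\<And>v. v \<in> D - A \<Longrightarrow> [val r (D - A) v = val r D v] (mod 4)"
proof -
  obtain a b r where ab: "A = {a, b}" "a \<in> D" "b \<in> D" and r: "r \<in> core"
    and odd: "a \<in> odd_chords D \<longleftrightarrow> b \<in> odd_chords D"
    and even: "\<And>z. z \<in> chord_ends D - \<Union>A \<Longrightarrow> even (below r (\<Union>A) z)"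
    using R2_val[OF D A] by metis
  have "A \<subseteq> D" "A \<inter> odd_chords D = {} \<or> A \<subseteq> odd_chords D"
    using ab odd by auto
  then show thesis
    using that[OF r] delete_chords(2)[OF D _ r even] by blast
qed

text \<open>Increasing moves are read backwards: the source arises from the target by deleting the
  new chords. Only an isomorphism needs two different base points.\<close>

lemma elementary_val:
  assumes f: "elementary D f"
  obtains r r' where "r \<in> core" "r' \<in> core" "chord_diagram (target D f)"
    "\<And>v v'. push D f v = Some v' \<Longrightarrow> v \<in> D \<and> v' \<in> target D f \<and>
       [val r' (target D f) v' = val r D v] (mod 4)"
proof (cases f)
  case (Iso h)
  obtain r r' where r: "r \<in> core" "r' \<in> core" "chord_diagram ((`) h ` D)"
      "\<And>v. v \<in> D \<Longrightarrow> val r' ((`) h ` D) (h ` v) = val r D v"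
    using homeo_val[of D h] f Iso by (metis elementary.simps(1))
  have push: "v \<in> D \<and> v' = h ` v" if "push D f v = Some v'" for v v'
    using that Iso by (simp add: restrict_map_def split: if_splits)
  show thesis
  proof (rule that[of r r'])
    fix v v' assume "push D f v = Some v'"
    from push[OF this] show "v \<in> D \<and> v' \<in> target D f \<and> [val r' (target D f) v' = val r D v] (mod 4)"
      using r(4)[of v] by (auto simp: Iso)
  qed (use r  in \<open>simp_all add: Iso\<close>)
next
  case (R1_dec a)
  have D: "chord_diagram D" "R1_chord D a"
    using f R1_dec by auto
  obtain r where r: "r \<in> core" "\<And>v. v \<in> D - {a} \<Longrightarrow> [val r (D - {a}) v = val r D v] (mod 4)"
    using R1_delete[OF D] by metis
  have push: "v \<in> D - {a} \<and> v' = v" if "push D f v = Some v'" for v v'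
    using that R1_dec by (simp add: restrict_map_def split: if_splits)
  show thesis
  proof (rule that[of r r])
    fix v v' assume "push D f v = Some v'"
    from push[OF this] show "v \<in> D \<and> v' \<in> target D f \<and> [val r (target D f) v' = val r D v] (mod 4)"
      using r(2)[of v] by (auto simp: R1_dec)
  qed (use r chord_diagram_mono[OF D(1), of "D - {a}"] in \<open>simp_all add: R1_dec\<close>)
next
  case (R1_inc a)
  have D: "chord_diagram (insert a D)" "R1_chord (insert a D) a" "insert a D - {a} = D"
    using f R1_inc by auto
  obtain r where r: "r \<in> core" "\<And>v. v \<in> D \<Longrightarrow> [val r D v = val r (insert a D) v] (mod 4)"
    using R1_delete[OF D(1,2)] unfolding D(3) by metis
  have push: "v \<in> D \<and> v' = v" if "push D f v = Some v'" for v v'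
    using that R1_inc by (simp add: restrict_map_def split: if_splits)
  show thesis
  proof (rule that[of r r])
    fix v v' assume "push D f v = Some v'"
    from push[OF this] show "v \<in> D \<and> v' \<in> target D f \<and> [val r (target D f) v' = val r D v] (mod 4)"
      using r(2)[of v] by (auto simp: R1_inc cong_sym_eq)
  qed (use r D(1) in \<open>simp_all add: R1_inc\<close>)
next
  case (R2_dec A)
  have D: "chord_diagram D" "R2_pair D A"
    using f R2_dec by auto
  obtain r where r: "r \<in> core" "\<And>v. v \<in> D - A \<Longrightarrow> [val r (D - A) v = val r D v] (mod 4)"
    using R2_delete[OF D] by metis
  have push: "v \<in> D - A \<and> v' = v" if "push D f v = Some v'" for v v'
    using that R2_dec by (simp add: restrict_map_def split: if_splits)
  show thesis
  proof (rule that[of r r])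
    fix v v' assume "push D f v = Some v'"
    from push[OF this] show "v \<in> D \<and> v' \<in> target D f \<and> [val r (target D f) v' = val r D v] (mod 4)"
      using r(2)[of v] by (auto simp: R2_dec)
  qed (use r chord_diagram_mono[OF D(1), of "D - A"] in \<open>simp_all add: R2_dec\<close>)
next
  case (R2_inc A)
  have D: "chord_diagram (D \<union> A)" "R2_pair (D \<union> A) A" "D \<union> A - A = D"
    using f R2_inc by auto
  obtain r where r: "r \<in> core" "\<And>v. v \<in> D \<Longrightarrow> [val r D v = val r (D \<union> A) v] (mod 4)"
    using R2_delete[OF D(1,2)] unfolding D(3) by metis
  have push: "v \<in> D \<and> v' = v" if "push D f v = Some v'" for v v'
    using that R2_inc by (simp add: restrict_map_def split: if_splits)
  show thesis
  proof (rule that[of r r])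
    fix v v' assume "push D f v = Some v'"
    from push[OF this] show "v \<in> D \<and> v' \<in> target D f \<and> [val r (target D f) v' = val r D v] (mod 4)"
      using r(2)[of v] by (auto simp: R2_inc cong_sym_eq)
  qed (use r D(1) in \<open>simp_all add: R2_inc\<close>)
next
  case (R3 s)
  have D: "chord_diagram D"
    using f R3 by simp
  obtain a1 b1 b2 c2 c3 a3 where tri: "R3_triangle D a1 b1 b2 c2 c3 a3" "s = R3_swap a1 b1 b2 c2 c3 a3"
    using f R3 by auto
  obtain r where r: "r \<in> core" "chord_diagram ((`) s ` D)"
      "\<And>v. v \<in> D \<Longrightarrow> [val r ((`) s ` D) (s ` v) = val r D v] (mod 4)"
    using R3_invariant[OF D tri] by metis
  have push: "v \<in> D \<and> v' = s ` v" if "push D f v = Some v'" for v v'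
    using that R3 by (simp add: restrict_map_def split: if_splits)
  show thesis
  proof (rule that[of r r])
    fix v v' assume "push D f v = Some v'"
    from push[OF this] show "v \<in> D \<and> v' \<in> target D f \<and> [val r (target D f) v' = val r D v] (mod 4)"
      using r(3)[of v] by (auto simp: R3)
  qed (use r  in \<open>simp_all add: R3\<close>)
qed

section \<open>The oriented Gaussian parity functor\<close>

lemma UNIV_og: "UNIV = {E0, O1, E1, O2}"
  using og.exhaust by blast

lemma og_num_eq_iff [simp]: "og_num x = og_num y \<longleftrightarrow> x = y"
  by (cases x; cases y) auto

lemma og_num_less [simp]: "og_num x < 4"
  by (cases x) auto

lemma og_num_surj:
  assumes "n < 4"
  obtains x where "og_num x = n"
proof -
  have "n = og_num E0 \<or> n = og_num O1 \<or> n = og_num E1 \<or> n = og_num O2"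
    using assms by auto
  then show ?thesis
    using that by blast
qed

lemma og_eqI: "[int (og_num x) = int (og_num y)] (mod 4) \<Longrightarrow> x = y"
  by (cases x; cases y) (simp_all add: cong_def)

lemma og_num_mult: "og_num (x \<otimes>\<^bsub>og_group D\<^esub> y) = (og_num x + og_num y) mod 4"
proof -
  obtain z where "og_num z = (og_num x + og_num y) mod 4"
    using og_num_surj[of "(og_num x + og_num y) mod 4"] by auto
  then have "og_num (THE z. og_num z = (og_num x + og_num y) mod 4) = (og_num x + og_num y) mod 4"
    by (metis (mono_tags, lifting) og_num_eq_iff the_equality)
  then show ?thesis
    by (simp add: og_group_def)
qed

lemma og_group_one [simp]: "\<one>\<^bsub>og_group D\<^esub> = E0"
  by (simp add: og_group_def)

lemma og_group_carrier: "carrier (og_group D) = (if odd_chords D = {} then {E0} else UNIV)"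
  by (simp add: og_group_def)

lemma og_mult_E0: "E0 \<otimes>\<^bsub>og_group D\<^esub> E0 = E0"
proof -
  have "og_num (E0 \<otimes>\<^bsub>og_group D\<^esub> E0) = og_num E0"
    by (simp add: og_num_mult)
  then show ?thesis
    by (simp only: og_num_eq_iff)
qed

lemma og_mult_closed: "x \<in> carrier (og_group D) \<Longrightarrow> y \<in> carrier (og_group D) \<Longrightarrow>
    x \<otimes>\<^bsub>og_group D\<^esub> y \<in> carrier (og_group D)"
  by (auto simp: og_group_carrier og_mult_E0 split: if_splits)

lemma comm_group_og: "comm_group (og_group D)"
proof (rule comm_groupI)
  fix x assume x: "x \<in> carrier (og_group D)"
  obtain y where y: "og_num y = (4 - og_num x) mod 4"
    using og_num_surj[of "(4 - og_num x) mod 4"] by auto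
  have "og_num (y \<otimes>\<^bsub>og_group D\<^esub> x) = og_num E0"
    using y by (cases x) (simp_all add: og_num_mult)
  then have "y \<otimes>\<^bsub>og_group D\<^esub> x = E0"
    by (simp only: og_num_eq_iff)
  moreover have "y \<in> carrier (og_group D)"
    using x y og_num_eq_iff[of y E0] by (auto simp: og_group_carrier split: if_splits)
  ultimately show "\<exists>y\<in>carrier (og_group D). y \<otimes>\<^bsub>og_group D\<^esub> x = \<one>\<^bsub>og_group D\<^esub>"
    by auto
next
  fix x y z
  have "og_num (x \<otimes>\<^bsub>og_group D\<^esub> y \<otimes>\<^bsub>og_group D\<^esub> z) = og_num (x \<otimes>\<^bsub>og_group D\<^esub> (y \<otimes>\<^bsub>og_group D\<^esub> z))"
    by (simp add: og_num_mult mod_simps add.assoc)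
  then show "x \<otimes>\<^bsub>og_group D\<^esub> y \<otimes>\<^bsub>og_group D\<^esub> z = x \<otimes>\<^bsub>og_group D\<^esub> (y \<otimes>\<^bsub>og_group D\<^esub> z)"
    by simp
next
  fix x y
  have "og_num (x \<otimes>\<^bsub>og_group D\<^esub> y) = og_num (y \<otimes>\<^bsub>og_group D\<^esub> x)"
    by (simp add: og_num_mult add.commute)
  then show "x \<otimes>\<^bsub>og_group D\<^esub> y = y \<otimes>\<^bsub>og_group D\<^esub> x"
    by simp
next
  fix x
  have "og_num (\<one>\<^bsub>og_group D\<^esub> \<otimes>\<^bsub>og_group D\<^esub> x) = og_num x"
    by (simp add: og_num_mult)
  then show "\<one>\<^bsub>og_group D\<^esub> \<otimes>\<^bsub>og_group D\<^esub> x = x"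
    by simp
qed (simp_all add: og_mult_closed, simp add: og_group_carrier)

lemma og_num_pow_sign:
  assumes x: "x \<in> carrier (og_group D)" and e: "e = 1 \<or> e = (-1::int)"
  shows "[int (og_num (x [^]\<^bsub>og_group D\<^esub> e)) = e * int (og_num x)] (mod 4)"
proof -
  interpret comm_group "og_group D"
    by (rule comm_group_og)
  show ?thesis
  proof (cases "e = 1")
    case True
    then show ?thesis
      using x by (simp add: int_pow_1)
  next
    case False
    then have e: "e = -1"
      using e by simp
    have "x [^]\<^bsub>og_group D\<^esub> e = inv\<^bsub>og_group D\<^esub> x"
      using x int_pow_neg[OF x, of 1] by (simp add: e int_pow_1)
    moreover have "og_num (x \<otimes>\<^bsub>og_group D\<^esub> inv\<^bsub>og_group D\<^esub> x) = 0"
      using x by simp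
    then have "[int (og_num x + og_num (inv\<^bsub>og_group D\<^esub> x)) = 0] (mod 4)"
      unfolding og_num_mult cong_def by presburger
    ultimately show ?thesis
      by (simp add: e cong_iff_dvd_diff add.commute)
  qed
qed

section \<open>Automorphisms and partial isomorphisms of the symbol groups\<close>

fun og_neg :: "og \<Rightarrow> og" where
  "og_neg E0 = E0"
| "og_neg O1 = O2"
| "og_neg E1 = E1"
| "og_neg O2 = O1"

text \<open>The two automorphisms of the cyclic group of order 4, indexed by a sign; every index
  other than 1 stands for negation.\<close>

definition og_aut :: "int \<Rightarrow> og \<Rightarrow> og" where
  "og_aut t = (if t = 1 then id else og_neg)"

lemma og_num_aut: "t = 1 \<or> t = -1 \<Longrightarrow> [int (og_num (og_aut t x)) = t * int (og_num x)] (mod 4)"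
  by (cases x) (auto simp: og_aut_def cong_def)

lemma og_aut_invol [simp]: "og_aut t (og_aut t x) = x"
  by (cases x) (auto simp: og_aut_def)

lemma og_aut_E [simp]: "og_aut t E0 = E0" "og_aut t E1 = E1" "og_aut t x = E0 \<longleftrightarrow> x = E0"
  by (cases x; simp add: og_aut_def)+

lemma og_aut_mult: "og_aut t (x \<otimes>\<^bsub>og_group D\<^esub> y) = og_aut t x \<otimes>\<^bsub>og_group D'\<^esub> og_aut t y"
proof -
  have "og_num (og_aut t (x \<otimes>\<^bsub>og_group D\<^esub> y)) = (if t = 1 then 1 else 3) * og_num (x \<otimes>\<^bsub>og_group D\<^esub> y) mod 4"
      "(og_num (og_aut t x) + og_num (og_aut t y)) mod 4 =
       (if t = 1 then 1 else 3) * (og_num x + og_num y) mod 4"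
    for x y
    by (cases "x \<otimes>\<^bsub>og_group D\<^esub> y"; simp add: og_aut_def) (cases x; cases y; simp add: og_aut_def)
  then have "og_num (og_aut t (x \<otimes>\<^bsub>og_group D\<^esub> y)) = og_num (og_aut t x \<otimes>\<^bsub>og_group D'\<^esub> og_aut t y)"
    by (simp add: og_num_mult mod_simps)
  then show ?thesis
    by simp
qed

text \<open>The partial isomorphisms that occur, described explicitly so that the class is closed
  under composition. Once a trivial group has been passed, only \<open>E0\<close> remains in the
  domain, even if both outer groups are nontrivial.\<close>

definition og_morphism :: "diagram \<Rightarrow> diagram \<Rightarrow> (og \<rightharpoonup> og) \<Rightarrow> bool" where
  "og_morphism D D' m \<longleftrightarrow> m = [E0 \<mapsto> E0] \<or>
     odd_chords D \<noteq> {} \<and> odd_chords D' \<noteq> {} \<and> (\<exists>t. m = Some \<circ> og_aut t)"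

lemma og_morphism_partial_iso:
  assumes "og_morphism D D' m"
  shows "partial_iso (og_group D) (og_group D') m"
  using assms unfolding og_morphism_def
proof (elim disjE conjE exE)
  interpret D: comm_group "og_group D" by (rule comm_group_og)
  interpret D': comm_group "og_group D'" by (rule comm_group_og)
  {
    assume m: "m = [E0 \<mapsto> E0]"
    have "subgroup {E0} (og_group D)" "subgroup {E0} (og_group D')"
      using D.triv_subgroup D'.triv_subgroup by simp_all
    then show ?thesis
      by (auto simp: m partial_iso_def iso_def hom_def bij_betw_def og_mult_E0)
  next
    fix t assume *: "odd_chords D \<noteq> {}" "odd_chords D' \<noteq> {}" "m = Some \<circ> og_aut t"
    have "ran m = UNIV"
      using og_aut_invol[of t] unfolding ran_def *(3) by (metis (mono_tags, lifting) UNIV_eq_I comp_apply mem_Collect_eq)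
    moreover have "dom m = UNIV"
      by (auto simp: *(3))
    moreover have "bij (og_aut t)"
      by (rule o_bij[of "og_aut t"]) auto
    moreover have "subgroup UNIV (og_group D)" "subgroup UNIV (og_group D')"
      using D.subgroup_self D'.subgroup_self * by (simp_all add: og_group_carrier)
    moreover have "(\<lambda>x. the (m x)) = og_aut t"
      by (simp add: *(3) fun_eq_iff)
    ultimately show ?thesis
      unfolding partial_iso_def iso_def hom_def by (simp add: og_aut_mult[where D = D and D' = D'])
  }
qed

lemma og_morphism_id: "og_morphism D D (Some |` carrier (og_group D))"
proof (cases "odd_chords D = {}")
  case True
  then have "Some |` carrier (og_group D) = [E0 \<mapsto> E0]"
    by (auto simp: og_group_carrier restrict_map_def fun_eq_iff)
  then show ?thesis
    by (simp add: og_morphism_def)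
next
  case False
  then have "Some |` carrier (og_group D) = Some \<circ> og_aut 1"
    by (auto simp: og_group_carrier og_aut_def restrict_map_def)
  then show ?thesis
    using False unfolding og_morphism_def by blast
qed

lemma og_morphism_comp:
  assumes "og_morphism D D' m" "og_morphism D' D'' m'"
  shows "og_morphism D D'' (m' \<circ>\<^sub>m m)"
proof -
  have aut: "\<exists>t''. og_aut t' \<circ> og_aut t = og_aut t''" for t t'
  proof -
    have "og_neg \<circ> og_neg = id"
      using og_aut_invol[of 0] by (auto simp: og_aut_def)
    then have "og_aut t' \<circ> og_aut t = og_aut (if (t = 1) = (t' = 1) then 1 else 0)"
      by (auto simp: og_aut_def)
    then show ?thesis
      by blast
  qed
  have comp: "(Some \<circ> g) \<circ>\<^sub>m (Some \<circ> f) = Some \<circ> (g \<circ> f)" for f g :: "og \<Rightarrow> og"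
    by (auto simp: map_comp_def)
  have triv: "[E0 \<mapsto> E0] \<circ>\<^sub>m [E0 \<mapsto> E0] = [E0 \<mapsto> E0]" "[E0 \<mapsto> E0] \<circ>\<^sub>m (Some \<circ> og_aut t) = [E0 \<mapsto> E0]"
      "(Some \<circ> og_aut t) \<circ>\<^sub>m [E0 \<mapsto> E0] = [E0 \<mapsto> E0]" for t
    by (auto simp: map_comp_def fun_eq_iff)
  show ?thesis
  proof (cases "m = [E0 \<mapsto> E0] \<or> m' = [E0 \<mapsto> E0]")
    case True
    then show ?thesis
      using assms triv unfolding og_morphism_def by auto
  next
    case False
    then obtain t t' where t: "m = Some \<circ> og_aut t" "m' = Some \<circ> og_aut t'"
        "odd_chords D \<noteq> {}" "odd_chords D'' \<noteq> {}"
      using assms unfolding og_morphism_def by blast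
    obtain t'' where "og_aut t' \<circ> og_aut t = og_aut t''"
      using aut by blast
    then have "m' \<circ>\<^sub>m m = Some \<circ> og_aut t''"
      using comp[of "og_aut t'" "og_aut t"] t by simp
    then show ?thesis
      using t unfolding og_morphism_def by blast
  qed
qed

text \<open>No move removes and adds chords at the same time. Hence, if source and target both have
  odd chords, some odd chord survives, and it ties the two namings together.\<close>

lemma push_total: "elementary D f \<Longrightarrow>
    (\<forall>v\<in>D. \<exists>v'. push D f v = Some v') \<or> (\<forall>v\<in>target D f. push D f v = Some v)"
  by (cases f) auto

text \<open>Values of surviving chords agree modulo 4, and on each side the classes are the values
  up to a sign. The product \<open>t\<close> of the two signs therefore gives the automorphism on
  all surviving chords simultaneously.\<close>

lemma og_map_unique:
  assumes f: "elementary D f" and C: "odd_class D (C D)" "odd_class (target D f) (C (target D f))"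
  obtains m where "\<And>m'. og_map C D f m' \<longleftrightarrow> m' = m" "og_morphism D (target D f) m"
    "\<And>v v'. push D f v = Some v' \<Longrightarrow> m (og_parity C D v) = Some (og_parity C (target D f) v')"
proof -
  define D' where "D' = target D f"
  have D: "chord_diagram D"
    using elementary_source[OF f] .
  obtain r r' where r: "r \<in> core" "r' \<in> core" and D': "chord_diagram D'"
    and push: "\<And>v v'. push D f v = Some v' \<Longrightarrow> v \<in> D \<and> v' \<in> D' \<and> [val r' D' v' = val r D v] (mod 4)"
    using elementary_val[OF f] unfolding D'_def by metis
  obtain s where s: "s = 1 \<or> s = -1"
      "\<And>v. v \<in> D \<Longrightarrow> [int (og_num (og_parity C D v)) = s * val r D v] (mod 4)"
    using og_sign[OF D r(1), of C, OF C(1)] by metis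
  obtain s' where s': "s' = 1 \<or> s' = -1"
      "\<And>v. v \<in> D' \<Longrightarrow> [int (og_num (og_parity C D' v)) = s' * val r' D' v] (mod 4)"
    using og_sign[of D' r' C] D' r(2) C(2) unfolding D'_def by metis
  define t where "t = s * s'"
  have t: "t = 1 \<or> t = -1"
    using s(1) s'(1) by (auto simp: t_def)
  have par: "og_parity C D' v' = og_aut t (og_parity C D v)" if vv: "push D f v = Some v'" for v v'
  proof (rule og_eqI)
    have v: "v \<in> D" "v' \<in> D'" "[val r' D' v' = val r D v] (mod 4)"
      using push[OF vv] by auto
    have "[int (og_num (og_parity C D' v')) = s' * val r' D' v'] (mod 4)"
      using s'(2) v by blast
    also have "[s' * val r' D' v' = s' * val r D v] (mod 4)"
      using v by (intro cong_scalar_left)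
    also have "s' * val r D v = t * (s * val r D v)"
      using s(1) by (auto simp: t_def)
    also have "[t * (s * val r D v) = t * int (og_num (og_parity C D v))] (mod 4)"
      using s(2) v by (intro cong_scalar_left) (simp add: cong_sym)
    also have "[t * int (og_num (og_parity C D v)) = int (og_num (og_aut t (og_parity C D v)))] (mod 4)"
      using og_num_aut[OF t] by (simp add: cong_sym)
    finally show "[int (og_num (og_parity C D' v')) = int (og_num (og_aut t (og_parity C D v)))] (mod 4)" .
  qed
  have odd: "v' \<in> odd_chords D' \<longleftrightarrow> v \<in> odd_chords D" if vv: "push D f v = Some v'" for v v'
    using push[OF vv] odd_val_iff[OF D r(1)] odd_val_iff[OF D' r(2)] cong_dvd_iff[of "val r' D' v'" "val r D v" 4]
    by (metis cong_dvd_iff cong_dvd_modulus dvd_triv_left mult_2 numeral_Bit0)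
  show thesis
  proof (cases "odd_chords D = {} \<or> odd_chords D' = {}")
    case True
    show thesis
    proof (rule that[of "[E0 \<mapsto> E0]"])
      show "og_map C D f m' \<longleftrightarrow> m' = [E0 \<mapsto> E0]" for m'
        using True by (auto simp: og_map_def D'_def Let_def)
      fix v v' assume vv: "push D f v = Some v'"
      \<comment> \<open>On the side without odd chords every class is \<open>E0\<close>, and the
        automorphism carries this to the other side: after the last odd chords disappear, no
        survivor was in \<open>E1\<close>.\<close>
      have "og_parity C D v = E0 \<or> og_parity C D' v' = E0"
        using True by (auto simp: og_parity_def)
      then have "og_parity C D v = E0" "og_parity C D' v' = E0"
        using par[OF vv] by auto
      then show "[E0 \<mapsto> E0] (og_parity C D v) = Some (og_parity C (target D f) v')"
        by (simp add: D'_def)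
    qed (simp add: og_morphism_def)
  next
    case False
    have mor: "og_morphism D D' (Some \<circ> og_aut t)"
      using False by (auto simp: og_morphism_def)
    obtain a a' where a: "push D f a = Some a'" "a \<in> odd_chords D"
      using push_total[OF f] False odd odd_chords_subset unfolding D'_def by blast
    have code_odd: "og_parity C D a = O1 \<or> og_parity C D a = O2"
      using a False by (auto simp: og_parity_def)
    have surj: "\<exists>y. og_aut t y = x" for x
      using og_aut_invol by blast
    show thesis
    proof (rule that[of "Some \<circ> og_aut t"])
      show "og_map C D f m' \<longleftrightarrow> m' = Some \<circ> og_aut t" for m'
      proof
        assume "m' = Some \<circ> og_aut t"
        then show "og_map C D f m'"
          using False og_morphism_partial_iso[OF mor] par surj
          by (auto simp: og_map_def D'_def Let_def og_group_carrier ran_def)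
      next
        assume "og_map C D f m'"
        then have m': "dom m' = UNIV" "ran m' = UNIV" "m' E0 = Some E0" "m' E1 = Some E1"
            "m' (og_parity C D a) = Some (og_aut t (og_parity C D a))"
          using False a par by (simp_all add: og_map_def D'_def Let_def og_group_carrier)
        define g where "g x = the (m' x)" for x
        have g: "m' x = Some (g x)" for x
          using m'(1) by (metis UNIV_I domIff g_def option.collapse)
        have "surj g"
          using m'(2) unfolding ran_def g surj_def by (simp add: set_eq_iff) metis
        then have inj: "inj g"
          using finite_UNIV_surj_inj[of g] finite[of UNIV] by (simp add: UNIV_og finite_UNIV_surj_inj)
        have "g E0 = E0" "g E1 = E1" "g (og_parity C D a) = og_aut t (og_parity C D a)"
          using m'(3-5) by (simp_all add: g)
        \<comment> \<open>A bijection of four symbols that fixes two of them and is known at a third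
          has no freedom left.\<close>
        then have "g x = og_aut t x" for x
          using code_odd inj_onD[OF inj, of x "og_parity C D a"] inj_onD[OF inj, of x E0] inj_onD[OF inj, of x E1]
          by (cases x; cases "g x"; cases "t = 1") (auto simp: og_aut_def)
        then show "m' = Some \<circ> og_aut t"
          using g by auto
      qed
      show "og_morphism D (target D f) (Some \<circ> og_aut t)"
        using mor by (simp add: D'_def)
      show "(Some \<circ> og_aut t) (og_parity C D v) = Some (og_parity C (target D f) v')"
        if "push D f v = Some v'" for v v'
        using par[OF that] by (simp add: D'_def)
    qed
  qed
qed

lemma free_knot_chord_diagram:
  assumes "free_knot K" "D \<in> K"
  shows "chord_diagram D"
proof -
  obtain D0 where D0: "chord_diagram D0"
      "K = {D. equivclp (\<lambda>D D'. \<exists>f. elementary D f \<and> D' = target D f) D0 D}"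
    using assms by (auto simp: free_knot_def)
  have "equivclp (\<lambda>D D'. \<exists>f. elementary D f \<and> D' = target D f) D0 D"
    using assms D0 by simp
  then show ?thesis
  proof (induction rule: equivclp_induct)
    case base
    show ?case by (rule D0)
  next
    case (step y z)
    then consider f where "elementary y f" "z = target y f" | f where "elementary z f" "y = target z f"
      by blast
    then show ?case
    proof cases
      case 1
      then show ?thesis
        using elementary_val by metis
    next
      case 2
      then show ?thesis
        using elementary_source by blast
    qed
  qed
qed

lemma free_knot_target:
  assumes "free_knot K" "elementary D f"
  shows "target D f \<in> K \<longleftrightarrow> D \<in> K"
proof -
  obtain D0 where D0: "K = {D. equivclp (\<lambda>D D'. \<exists>f. elementary D f \<and> D' = target D f) D0 D}"
    using assms by (auto simp: free_knot_def)
  have "equivclp (\<lambda>D D'. \<exists>f. elementary D f \<and> D' = target D f) D (target D f)"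
    using assms(2) by (intro r_into_equivclp) blast
  note step = this equivclp_sym[OF this]
  show ?thesis
    unfolding D0 mem_Collect_eq using equivclp_trans[OF _ step(1)] equivclp_trans[OF _ step(2)] by blast
qed

lemma og_mor_single:
  assumes f: "elementary D f" and C: "odd_class D (C D)" "odd_class (target D f) (C (target D f))"
  shows "og_morphism D (target D f) (THE m. og_map C D f m)"
    and "push D f v = Some v' \<Longrightarrow>
      (THE m. og_map C D f m) (og_parity C D v) = Some (og_parity C (target D f) v')"
    and "\<exists>!m. og_map C D f m"
proof -
  obtain m where m: "\<And>m'. og_map C D f m' \<longleftrightarrow> m' = m" "og_morphism D (target D f) m"
      "\<And>v v'. push D f v = Some v' \<Longrightarrow> m (og_parity C D v) = Some (og_parity C (target D f) v')"
    using og_map_unique[of D f C, OF f C] by metis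
  then have "(THE m. og_map C D f m) = m"
    by simp
  then show "og_morphism D (target D f) (THE m. og_map C D f m)"
    "push D f v = Some v' \<Longrightarrow>
      (THE m. og_map C D f m) (og_parity C D v) = Some (og_parity C (target D f) v')"
    "\<exists>!m. og_map C D f m"
    using m by auto
qed

lemma og_mor_morphism:
  assumes K: "free_knot K" and C: "\<forall>D\<in>K. odd_class D (C D)" and D: "D \<in> K" "morphism D fs"
  shows "og_morphism D (targets D fs) (og_mor C D fs)"
  using D
proof (induction fs arbitrary: D)
  case Nil
  then show ?case
    by (simp add: og_morphism_id)
next
  case (Cons f fs)
  have f: "elementary D f" "morphism (target D f) fs"
    using Cons.prems by auto
  have "target D f \<in> K"
    using free_knot_target[OF K f(1)] Cons.prems by blast
  then have "og_morphism D (target D f) (THE m. og_map C D f m)"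
      "og_morphism (target D f) (targets D (f # fs)) (og_mor C (target D f) fs)"
    using og_mor_single(1)[of D f C, OF f(1)] C Cons.prems Cons.IH f by auto
  then show ?case
    using og_morphism_comp by simp
qed

lemma og_morphism_dom: "og_morphism D D' m \<Longrightarrow> m \<circ>\<^sub>m (Some |` carrier (og_group D)) = m"
  by (auto simp: og_morphism_def og_group_carrier map_comp_def restrict_map_def fun_eq_iff)

lemma og_morphism_ran:
  assumes "og_morphism D D' m"
  shows "(Some |` carrier (og_group D')) \<circ>\<^sub>m m = m"
proof (rule ext)
  fix x
  show "((Some |` carrier (og_group D')) \<circ>\<^sub>m m) x = m x"
    using assms by (cases "m x")
      (auto simp: og_morphism_def og_group_carrier map_comp_def restrict_map_def split: if_splits)
qed

lemma map_comp_assoc: "(f \<circ>\<^sub>m g) \<circ>\<^sub>m h = f \<circ>\<^sub>m (g \<circ>\<^sub>m h)"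
  by (auto simp: map_comp_def fun_eq_iff split: option.splits)

lemma og_mor_append:
  assumes K: "free_knot K" and C: "\<forall>D\<in>K. odd_class D (C D)" and D: "D \<in> K" "morphism D (fs @ gs)"
  shows "og_mor C D (fs @ gs) = og_mor C (targets D fs) gs \<circ>\<^sub>m og_mor C D fs"
  using D
proof (induction fs arbitrary: D)
  case Nil
  then show ?case
    using og_morphism_dom[OF og_mor_morphism[OF K C]] by simp
next
  case (Cons f fs)
  then have "target D f \<in> K" "morphism (target D f) (fs @ gs)"
    using free_knot_target[OF K, of D f] by auto
  then show ?case
    using Cons.IH[of "target D f"] by (simp add: map_comp_assoc)
qed

lemma og_parity_functor:
  assumes K: "free_knot K" and C: "\<forall>D\<in>K. odd_class D (C D)"
  shows "oriented_parity_functor K og_group (og_mor C) (og_parity C)"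
proof -
  \<comment> \<open>The sign depends on the base point and hence differs from axiom to
    axiom.\<close>
  have sign: "\<exists>s. (s = 1 \<or> s = -1) \<and> (\<forall>v\<in>D. [int (og_num (og_parity C D v)) = s * val r D v] (mod 4))"
    if "D \<in> K" "r \<in> core" for D r
    using og_sign[of D r C, OF free_knot_chord_diagram[OF K that(1)] that(2)] C that by metis
  have carrier: "og_parity C D v \<in> carrier (og_group D)" for D v
    by (simp add: og_parity_def og_group_carrier)
  have P0: "og_mor C D [f] (og_parity C D v) = Some (og_parity C (target D f) v')"
    if D: "D \<in> K" and f: "elementary D f" and v: "push D f v = Some v'" for D f v v'
  proof -
    have CD: "odd_class D (C D)" "odd_class (target D f) (C (target D f))"
      using C D free_knot_target[OF K f] by auto
    have "og_mor C D [f] = (THE m. og_map C D f m)"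
      using og_morphism_ran[OF og_mor_single(1)[of D f C, OF f CD]] by simp
    then show ?thesis
      using og_mor_single(2)[of D f C, OF f CD v] by simp
  qed
  have P1: "og_parity C D v = E0" if D: "D \<in> K" and f: "elementary D (R1_dec v)" for D v
  proof -
    have R1: "chord_diagram D" "R1_chord D v"
      using f by auto
    obtain r where r: "r \<in> core" "[val r D v = 0] (mod 4)"
      using R1_val[OF R1] by metis
    obtain s where s: "\<forall>v\<in>D. [int (og_num (og_parity C D v)) = s * val r D v] (mod 4)"
      using sign[OF D r(1)] by blast
    have "v \<in> D"
      using R1 by (simp add: R1_chord_def)
    then have "[int (og_num (og_parity C D v)) = s * 0] (mod 4)"
      using s cong_scalar_left[OF r(2), of s] cong_trans by blast
    then show ?thesis
      by (intro og_eqI) simp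
  qed
  have P2: "og_parity C D v \<otimes>\<^bsub>og_group D\<^esub> og_parity C D w = E0"
    if D: "D \<in> K" and "v \<noteq> w" and f: "elementary D (R2_dec {v, w})" for D v w
  proof -
    have R2: "chord_diagram D" "R2_pair D {v, w}"
      using f by auto
    obtain a b r where ab: "{v, w} = {a, b}" "a \<in> D" "b \<in> D" "a \<noteq> b" and r: "r \<in> core"
        and val: "[val r D a + val r D b = 0] (mod 4)"
      using R2_val[OF R2] by metis
    obtain s where s: "\<forall>v\<in>D. [int (og_num (og_parity C D v)) = s * val r D v] (mod 4)"
      using sign[OF D r(1)] by blast
    have "[val r D v + val r D w = 0] (mod 4)" "v \<in> D" "w \<in> D"
      using ab val by (auto simp: doubleton_eq_iff add.commute)
    then have "[s * (val r D v + val r D w) = s * 0] (mod 4)"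
        "[int (og_num (og_parity C D v)) + int (og_num (og_parity C D w)) = s * (val r D v + val r D w)] (mod 4)"
      using s cong_add[of _ "s * val r D v" 4 _ "s * val r D w"]
      by (blast intro: cong_scalar_left, simp add: distrib_left)
    then have "[int (og_num (og_parity C D v)) + int (og_num (og_parity C D w)) = 0] (mod 4)"
      using cong_trans by fastforce
    then have "(og_num (og_parity C D v) + og_num (og_parity C D w)) mod 4 = 0"
      unfolding cong_def by presburger
    then have "og_num (og_parity C D v \<otimes>\<^bsub>og_group D\<^esub> og_parity C D w) = og_num E0"
      by (simp add: og_num_mult)
    then show ?thesis
      by (simp only: og_num_eq_iff)
  qed
  have P3: "og_parity C D {a1, a3} [^]\<^bsub>og_group D\<^esub> chord_sign D c3 a3 a1 b1 \<otimes>\<^bsub>og_group D\<^esub>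
        og_parity C D {b1, b2} [^]\<^bsub>og_group D\<^esub> chord_sign D a1 b1 b2 c2 \<otimes>\<^bsub>og_group D\<^esub>
        og_parity C D {c2, c3} [^]\<^bsub>og_group D\<^esub> chord_sign D b2 c2 c3 a3 = E0"
    if D: "D \<in> K" and tri: "R3_triangle D a1 b1 b2 c2 c3 a3" for D a1 b1 b2 c2 c3 a3
  proof -
    obtain r where r: "r \<in> core"
      and val: "[chord_sign D c3 a3 a1 b1 * val r D {a1, a3} + chord_sign D a1 b1 b2 c2 * val r D {b1, b2} +
      chord_sign D b2 c2 c3 a3 * val r D {c2, c3} = 0] (mod 4)"
      using R3_val[OF free_knot_chord_diagram[OF K D] tri] by metis
    obtain s where s: "\<forall>v\<in>D. [int (og_num (og_parity C D v)) = s * val r D v] (mod 4)"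
      using sign[OF D r(1)] by blast
    have mem: "{a1, a3} \<in> D" "{b1, b2} \<in> D" "{c2, c3} \<in> D"
      using tri by (auto simp: R3_triangle_def)
    have pow: "[int (og_num (og_parity C D v [^]\<^bsub>og_group D\<^esub> chord_sign D p q u w)) =
        chord_sign D p q u w * (s * val r D v)] (mod 4)" if "v \<in> D" for v p q u w
      using og_num_pow_sign[OF carrier, of "chord_sign D p q u w"] s that
      by (meson chord_sign_def cong_scalar_left cong_trans)
    have "[int (og_num (og_parity C D {a1, a3} [^]\<^bsub>og_group D\<^esub> chord_sign D c3 a3 a1 b1)) +
        int (og_num (og_parity C D {b1, b2} [^]\<^bsub>og_group D\<^esub> chord_sign D a1 b1 b2 c2)) +
        int (og_num (og_parity C D {c2, c3} [^]\<^bsub>og_group D\<^esub> chord_sign D b2 c2 c3 a3)) =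
        chord_sign D c3 a3 a1 b1 * (s * val r D {a1, a3}) + chord_sign D a1 b1 b2 c2 * (s * val r D {b1, b2}) +
        chord_sign D b2 c2 c3 a3 * (s * val r D {c2, c3})] (mod 4)"
      by (intro cong_add pow mem)
    also have "chord_sign D c3 a3 a1 b1 * (s * val r D {a1, a3}) + chord_sign D a1 b1 b2 c2 * (s * val r D {b1, b2}) +
        chord_sign D b2 c2 c3 a3 * (s * val r D {c2, c3}) =
        s * (chord_sign D c3 a3 a1 b1 * val r D {a1, a3} + chord_sign D a1 b1 b2 c2 * val r D {b1, b2} +
        chord_sign D b2 c2 c3 a3 * val r D {c2, c3})"
      by (simp add: algebra_simps)
    also have "[\<dots> = s * 0] (mod 4)"
      by (rule cong_scalar_left[OF val])
    finally have sum: "[int (og_num (og_parity C D {a1, a3} [^]\<^bsub>og_group D\<^esub> chord_sign D c3 a3 a1 b1)) +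
        int (og_num (og_parity C D {b1, b2} [^]\<^bsub>og_group D\<^esub> chord_sign D a1 b1 b2 c2)) +
        int (og_num (og_parity C D {c2, c3} [^]\<^bsub>og_group D\<^esub> chord_sign D b2 c2 c3 a3)) = 0] (mod 4)"
      by simp
    have "og_num (x \<otimes>\<^bsub>og_group D\<^esub> y \<otimes>\<^bsub>og_group D\<^esub> z) = og_num E0"
      if "[int (og_num x) + int (og_num y) + int (og_num z) = 0] (mod 4)" for x y z
    proof -
      have "(og_num x + og_num y + og_num z) mod 4 = 0"
        using that unfolding cong_def by presburger
      then show ?thesis
        by (simp add: og_num_mult mod_simps)
    qed
    from this[OF sum] show ?thesis
      by (simp only: og_num_eq_iff)
  qed
  show ?thesis
    unfolding oriented_parity_functor_def diagram_functor_def
    using P0 P1 P2 P3 carrier comm_group_og og_mor_append[OF K C]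
      og_morphism_partial_iso[OF og_mor_morphism[OF K C]] by auto
qed

section \<open>Relations between parities on a cut-open circle\<close>

text \<open>The core circle cut at a point that is no end; the cut corresponds to both 0 and
  \<open>T\<close>, so all ends lie strictly in between.\<close>

definition linear_diagram :: "real \<Rightarrow> real set set \<Rightarrow> bool" where
  "linear_diagram T R \<longleftrightarrow> finite R \<and> (\<forall>c\<in>R. c \<subseteq> {0<..<T} \<and> card c = 2) \<and> disjoint R"

definition between_free :: "real set set \<Rightarrow> real \<Rightarrow> real \<Rightarrow> bool" where
  "between_free R u v \<longleftrightarrow> u \<noteq> v \<and> (\<forall>z\<in>\<Union>R. \<not> (u < z \<and> z < v) \<and> \<not> (v < z \<and> z < u))"

abbreviation band :: "real \<Rightarrow> real \<Rightarrow> real \<Rightarrow> real \<Rightarrow> real set set" where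
  "band a a' b b' \<equiv> {{a, b}, {a', b'}}"

text \<open>The band can be inserted by a second Reidemeister move. The order within each pair of
  new ends is left open, so that parallel and crossing pairs are both covered.\<close>

definition band_ok :: "real \<Rightarrow> real set set \<Rightarrow> real \<Rightarrow> real \<Rightarrow> real \<Rightarrow> real \<Rightarrow> bool" where
  "band_ok T R a a' b b' \<longleftrightarrow> distinct [a, a', b, b'] \<and> {a, a', b, b'} \<subseteq> {0<..<T} \<and>
     {a, a', b, b'} \<inter> \<Union>R = {} \<and>
     between_free (R \<union> band a a' b b') a a' \<and> between_free (R \<union> band a a' b b') b b'"

abbreviation single :: "real set \<Rightarrow> real set \<Rightarrow> int" where
  "single c \<equiv> \<lambda>v. of_bool (v = c)"

abbreviation dir :: "real \<Rightarrow> real \<Rightarrow> int" where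
  "dir x y \<equiv> (if x < y then 1 else -1)"

lemma between_free_mono: "between_free R u v \<Longrightarrow> \<Union>S \<subseteq> \<Union>R \<Longrightarrow> between_free S u v"
  unfolding between_free_def by (meson subsetD)

lemma band_commute: "band b b' a a' = band a a' b b'"
  by (simp add: insert_commute)

lemma band_swap: "band a' a b' b = band a a' b b'"
  by (simp add: insert_commute)

lemma exists_room:
  fixes E :: "real set"
  assumes "finite E" "x < t"
  obtains g where "x < g" "g < t" "\<And>z. z \<in> E \<Longrightarrow> x < z \<Longrightarrow> g < z"
proof -
  define F where "F = insert t {z \<in> E. x < z}"
  have F: "finite F" "F \<noteq> {}"
    using assms by (auto simp: F_def)
  have "x < Min F"
    using F assms by (simp add: F_def)
  then obtain g where g: "x < g" "g < Min F"
    using dense by blast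
  show thesis
  proof (rule that[OF g(1)])
    show "g < t"
      using g(2) F Min_le[of F t] by (simp add: F_def)
    show "g < z" if "z \<in> E" "x < z" for z
      using g(2) F Min_le[of F z] that by (simp add: F_def)
  qed
qed

text \<open>Auxiliary ends will sit at distance \<open>e\<close> or \<open>2 * e\<close> from given
  points; the factor 10 keeps the clusters around different points well apart.\<close>

lemma exists_spacing:
  fixes S :: "real set"
  assumes "finite S"
  obtains e where "e > 0" "\<And>x y. x \<in> S \<Longrightarrow> y \<in> S \<Longrightarrow> x < y \<Longrightarrow> x + 10 * e < y"
proof -
  define F where "F = insert 1 ((\<lambda>(x, y). y - x) ` {(x, y) \<in> S \<times> S. x < y})"
  have "finite {(x, y) \<in> S \<times> S. x < y}"
    by (rule finite_subset[of _ "S \<times> S"]) (use assms in auto)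
  then have F: "finite F" "F \<noteq> {}"
    by (simp_all add: F_def)
  have pos: "0 < Min F"
    using F by (auto simp: F_def)
  show thesis
  \<comment> \<open>Dividing by 11 instead of 10 makes the inequality strict; the element 1 of
    \<open>F\<close> only prevents it from being empty.\<close>
  proof (rule that[of "Min F / 11"])
    show "Min F / 11 > 0"
      using pos by simp
    fix x y assume "x \<in> S" "y \<in> S" "x < y"
    then have "y - x \<in> F"
      by (force simp: F_def)
    then have "Min F \<le> y - x"
      using F by simp
    then show "x + 10 * (Min F / 11) < y"
      using pos by simp
  qed
qed

text \<open>\<open>rel R f\<close> is to be read as: the product of the powers
  \<open>P(v)^f(v)\<close> over the chords \<open>v\<close> of \<open>R\<close> is trivial.
  \<open>rel_band\<close> lets auxiliary bands come and go. In \<open>rel_R3\<close> each chord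
  carries the direction of the opposite short arc; this is its sign in (P3+), which is a product of
  two directions, multiplied by the product of all three.\<close>

locale linear_relations =
  fixes T :: real
    and dg :: "real set set \<Rightarrow> bool"
    and rel :: "real set set \<Rightarrow> (real set \<Rightarrow> int) \<Rightarrow> bool"
  assumes dg: "dg R \<Longrightarrow> linear_diagram T R"
    and rel_cong: "dg R \<Longrightarrow> rel R f \<Longrightarrow> (\<And>v. v \<in> R \<Longrightarrow> f v = g v) \<Longrightarrow> rel R g"
    and rel_zero: "dg R \<Longrightarrow> rel R (\<lambda>v. 0)"
    and rel_diff: "dg R \<Longrightarrow> rel R f \<Longrightarrow> rel R g \<Longrightarrow> rel R (\<lambda>v. f v - g v)"
    and dg_band: "dg R \<Longrightarrow> band_ok T R a a' b b' \<Longrightarrow> dg (R \<union> band a a' b b')"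
    and rel_band: "dg R \<Longrightarrow> band_ok T R a a' b b' \<Longrightarrow> f {a, b} = 0 \<Longrightarrow> f {a', b'} = 0 \<Longrightarrow>
      rel (R \<union> band a a' b b') f \<longleftrightarrow> rel R f"
    and rel_R1: "dg R \<Longrightarrow> {a, b} \<in> R \<Longrightarrow> between_free R a b \<Longrightarrow> rel R (single {a, b})"
    and rel_R2: "dg R \<Longrightarrow> {a, b} \<in> R \<Longrightarrow> {a', b'} \<in> R \<Longrightarrow> {a, b} \<noteq> {a', b'} \<Longrightarrow>
      between_free R a a' \<Longrightarrow> between_free R b b' \<Longrightarrow>
      rel R (\<lambda>v. single {a, b} v + single {a', b'} v)"
    and rel_R3: "dg R \<Longrightarrow> {a1, a3} \<in> R \<Longrightarrow> {b1, b2} \<in> R \<Longrightarrow> {c2, c3} \<in> R \<Longrightarrow>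
      {a1, a3} \<noteq> {b1, b2} \<Longrightarrow> {b1, b2} \<noteq> {c2, c3} \<Longrightarrow> {c2, c3} \<noteq> {a1, a3} \<Longrightarrow>
      between_free R a1 b1 \<Longrightarrow> between_free R b2 c2 \<Longrightarrow> between_free R c3 a3 \<Longrightarrow>
      rel R (\<lambda>v. dir b2 c2 * single {a1, a3} v + dir c3 a3 * single {b1, b2} v + dir a1 b1 * single {c2, c3} v)"
begin

lemma rel_uminus: "dg R \<Longrightarrow> rel R f \<Longrightarrow> rel R (\<lambda>v. - f v)"
  using rel_diff[OF _ rel_zero, of R f] by simp

lemma rel_add: "dg R \<Longrightarrow> rel R f \<Longrightarrow> rel R g \<Longrightarrow> rel R (\<lambda>v. f v + g v)"
  using rel_diff[OF _ _ rel_uminus, of R f g] by simp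

lemma rel_scale: "dg R \<Longrightarrow> rel R f \<Longrightarrow> rel R (\<lambda>v. k * f v)"
proof -
  assume R: "dg R" "rel R f"
  have nat: "rel R (\<lambda>v. int n * f v)" for n
  proof (induction n)
    case 0
    then show ?case
      using rel_zero R by simp
  next
    case (Suc n)
    then show ?case
      using rel_add[OF R(1) R(2) Suc] by (simp add: algebra_simps)
  qed
  show ?thesis
  proof (cases "k \<ge> 0")
    case True
    then show ?thesis
      using nat[of "nat k"] by simp
  next
    case False
    then show ?thesis
      using rel_uminus[OF R(1) nat[of "nat (- k)"]] by simp
  qed
qed

lemma rel_sum:
  assumes "dg R" "finite A" "\<And>a. a \<in> A \<Longrightarrow> rel R (h a)"
  shows "rel R (\<lambda>v. \<Sum>a\<in>A. h a v)"
  using assms(2,3)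
proof (induction A rule: finite_induct)
  case empty
  then show ?case
    using rel_zero assms by simp
next
  case (insert a A)
  then show ?case
    using rel_add[OF assms(1), of "h a" "\<lambda>v. \<Sum>a\<in>A. h a v"] by simp
qed

lemma finite_ends: "dg R \<Longrightarrow> finite (\<Union>R)"
  using dg unfolding linear_diagram_def by (metis card.infinite finite_Union zero_neq_numeral)

lemma ends_bounds: "dg R \<Longrightarrow> z \<in> \<Union>R \<Longrightarrow> 0 < z \<and> z < T"
  using dg unfolding linear_diagram_def by fastforce

lemma band_notin: "band_ok T R a a' b b' \<Longrightarrow> {a, b} \<notin> R \<and> {a', b'} \<notin> R \<and> {a, b} \<noteq> {a', b'}"
  by (auto simp: band_ok_def doubleton_eq_iff)

section \<open>Values of bands and their change under one triangle relation\<close>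

definition supported :: "real set set \<Rightarrow> (real set \<Rightarrow> int) \<Rightarrow> bool" where
  "supported R f \<longleftrightarrow> (\<forall>c. c \<notin> R \<longrightarrow> f c = 0)"

text \<open>The value of a band is that of its first chord \<open>{a, b}\<close>, expressed as a
  product of powers of old values with exponents \<open>f\<close>; the second chord has the inverse
  value.\<close>

definition band_value ::
    "real set set \<Rightarrow> real \<Rightarrow> real \<Rightarrow> real \<Rightarrow> real \<Rightarrow> (real set \<Rightarrow> int) \<Rightarrow> bool" where
  "band_value R a a' b b' f \<longleftrightarrow> rel (R \<union> band a a' b b') (\<lambda>v. single {a, b} v - f v)"

lemma band_value_commute: "band_value R b b' a a' f \<longleftrightarrow> band_value R a a' b b' f"
  unfolding band_value_def band_commute[where a = a and a' = a' and b = b and b' = b'] by (simp add: insert_commute)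

lemma rel_band_supported:
  "dg R \<Longrightarrow> band_ok T R a a' b b' \<Longrightarrow> supported R f \<Longrightarrow> rel (R \<union> band a a' b b') f \<longleftrightarrow> rel R f"
  using rel_band band_notin unfolding supported_def by metis

lemma band_value_cong:
  assumes R: "dg R" "band_ok T R a a' b b'" and fg: "supported R f" "supported R g"
    and v: "band_value R a a' b b' f" and rel: "rel R (\<lambda>v. f v - g v)"
  shows "band_value R a a' b b' g"
proof -
  have "rel (R \<union> band a a' b b') (\<lambda>v. f v - g v)"
    using rel_band_supported[OF R, of "\<lambda>v. f v - g v"] fg rel by (simp add: supported_def)
  from rel_add[OF dg_band[OF R] v[unfolded band_value_def] this] show ?thesis
    by (simp add: band_value_def)
qed

text \<open>The source of relations in \<open>R\<close>: two computations of the same band differ by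
  a relation in which the band no longer occurs, so the band can be removed again.\<close>

lemma band_value_unique:
  assumes R: "dg R" "band_ok T R a a' b b'" and fg: "supported R f" "supported R g"
    and v: "band_value R a a' b b' f" "band_value R a a' b b' g"
  shows "rel R (\<lambda>v. f v - g v)"
proof -
  have "rel (R \<union> band a a' b b') (\<lambda>v. f v - g v)"
    using rel_diff[OF dg_band[OF R] v(2)[unfolded band_value_def] v(1)[unfolded band_value_def]] by simp
  then show ?thesis
    using rel_band_supported[OF R, of "\<lambda>v. f v - g v"] fg by (simp add: supported_def)
qed

lemma band_value_swap:
  assumes R: "dg R" "band_ok T R a a' b b'" and v: "band_value R a a' b b' f"
  shows "band_value R a' a b' b (\<lambda>v. - f v)"
proof -
  let ?R = "R \<union> band a a' b b'"
  have "rel ?R (\<lambda>v. single {a, b} v + single {a', b'} v)"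
    using R(2) band_notin[OF R(2)] by (intro rel_R2 dg_band R) (auto simp: band_ok_def)
  from rel_diff[OF dg_band[OF R] this v[unfolded band_value_def]] show ?thesis
    unfolding band_value_def band_swap[where a = a and a' = a' and b = b and b' = b'] by simp
qed

text \<open>The triangle consists of \<open>{p, q}\<close>, the first chord of a band at the end
  \<open>p\<close>, and the first chord of a second band at the other end \<open>q\<close>; the far
  ends of the two bands are neighbours. Both bands coexist while the triangle relation is used, then
  the first one is removed.\<close>

lemma hop:
  assumes R: "dg R" and c: "{p, q} \<in> R" and f: "supported R f"
    and X: "band_ok T R u u' v v'" "band_ok T (R \<union> band t t' w w') u u' v v'"
    and Y: "band_ok T R t t' w w'" "band_ok T (R \<union> band u u' v v') t t' w w'"
    and free: "between_free (R \<union> band u u' v v' \<union> band t t' w w') p u"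
      "between_free (R \<union> band u u' v v' \<union> band t t' w w') v w"
      "between_free (R \<union> band u u' v v' \<union> band t t' w w') t q"
    and v: "band_value R u u' v v' f"
  shows "band_value R t t' w w'
     (\<lambda>x. dir p u * - dir t q * f x + dir p u * - dir v w * single {p, q} x)"
proof -
  define R2 where "R2 = R \<union> band u u' v v' \<union> band t t' w w'"
  have RX: "dg (R \<union> band u u' v v')" and RY: "dg (R \<union> band t t' w w')"
    using dg_band[OF R] X(1) Y(1) by blast+
  have R2: "dg R2"
    unfolding R2_def by (rule dg_band[OF RX Y(2)])
  have R2': "R2 = R \<union> band t t' w w' \<union> band u u' v v'"
    unfolding R2_def by blast
  have new: "{u, v} \<notin> R" "{u', v'} \<notin> R" "{t, w} \<notin> R" "{t', w'} \<notin> R"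
    using band_notin X(1) Y(1) by blast+
  have ne: "{u, v} \<noteq> {t, w}" "{u, v} \<noteq> {t', w'}" "{u', v'} \<noteq> {t, w}" "{u', v'} \<noteq> {t', w'}"
  proof -
    have "{u, v} \<in> R \<union> band u u' v v'" "{u', v'} \<in> R \<union> band u u' v v'"
      by simp_all
    then show "{u, v} \<noteq> {t, w}" "{u, v} \<noteq> {t', w'}" "{u', v'} \<noteq> {t, w}" "{u', v'} \<noteq> {t', w'}"
      using band_notin[OF Y(2)] by metis+
  qed
  have vf: "rel R2 (\<lambda>x. single {u, v} x - f x)"
    using rel_band[OF RX Y(2), of "\<lambda>x. single {u, v} x - f x"] v f new ne
    by (simp add: R2_def band_value_def supported_def)
  have tri: "rel R2 (\<lambda>x. dir v w * single {p, q} x + dir t q * single {u, v} x + dir p u * single {w, t} x)"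
  proof (rule rel_R3[OF R2])
    show "{p, q} \<in> R2" "{u, v} \<in> R2" "{w, t} \<in> R2"
      using c by (auto simp: R2_def)
    show "{p, q} \<noteq> {u, v}" "{u, v} \<noteq> {w, t}" "{w, t} \<noteq> {p, q}"
      using c new ne by (metis, metis insert_commute, metis insert_commute)
  qed (use free in \<open>simp_all add: R2_def\<close>)
  have "rel R2 (\<lambda>x. dir p u * (dir v w * single {p, q} x + dir t q * single {u, v} x + dir p u * single {w, t} x)
      - dir p u * dir t q * (single {u, v} x - f x))"
    by (intro rel_diff rel_scale R2 vf tri)
  moreover have "dir p u * (dir v w * single {p, q} x + dir t q * single {u, v} x + dir p u * single {w, t} x)
      - dir p u * dir t q * (single {u, v} x - f x) =
      single {t, w} x - (dir p u * - dir t q * f x + dir p u * - dir v w * single {p, q} x)" for x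
    by (simp add: insert_commute)
  ultimately have "rel R2 (\<lambda>x. single {t, w} x -
      (dir p u * - dir t q * f x + dir p u * - dir v w * single {p, q} x))"
    by simp
  moreover have "{u, v} \<noteq> {p, q}" "{u', v'} \<noteq> {p, q}"
    using c new by metis+
  ultimately show ?thesis
    using rel_band[OF RY X(2), of "\<lambda>x. single {t, w} x -
      (dir p u * - dir t q * f x + dir p u * - dir v w * single {p, q} x)"] f new ne
    by (simp add: R2' band_value_def supported_def)
qed

text \<open>The signs \<open>s\<close>, \<open>t\<close>, \<open>k\<close> select the sides of
  \<open>p\<close>, \<open>q\<close> and \<open>r\<close> on which band ends are placed. The new
  band uses the other side of \<open>r\<close>, so that the innermost ends of both bands are
  neighbours across \<open>r\<close>, which is not an end.\<close>

lemma hop_near: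
  assumes R: "dg R" and c: "{p, q} \<in> R" "p \<noteq> q" and f: "supported R f"
    and r: "r \<notin> \<Union>R" "0 < r" "r < T" and e: "e > 0"
    and space: "\<And>x y. x \<in> \<Union>R \<union> {0, T, r} \<Longrightarrow> y \<in> \<Union>R \<union> {0, T, r} \<Longrightarrow> x < y \<Longrightarrow> x + 10 * e < y"
    and s: "s = 1 \<or> s = -1" and t: "t = 1 \<or> t = -1" and k: "k = 1 \<or> k = -1"
    and v: "band_value R (p + of_int s * e) (p + 2 * of_int s * e) (r + of_int k * e) (r + 2 * of_int k * e) f"
  shows "band_value R (q + of_int t * e) (q + 2 * of_int t * e) (r - of_int k * e) (r - 2 * of_int k * e)
     (\<lambda>x. s * t * f x + s * k * single {p, q} x)"
proof -
  define u u' w w' y y' z z' where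
    "u = p + of_int s * e" and "u' = p + 2 * of_int s * e" and
    "w = r + of_int k * e" and "w' = r + 2 * of_int k * e" and
    "y = q + of_int t * e" and "y' = q + 2 * of_int t * e" and
    "z = r - of_int k * e" and "z' = r - 2 * of_int k * e"
  have u: "u = p + e \<and> u' = p + 2 * e \<or> u = p - e \<and> u' = p - 2 * e"
    using s by (auto simp: u_def u'_def)
  have y: "y = q + e \<and> y' = q + 2 * e \<or> y = q - e \<and> y' = q - 2 * e"
    using t by (auto simp: y_def y'_def)
  have w: "w = r + e \<and> w' = r + 2 * e \<and> z = r - e \<and> z' = r - 2 * e \<or>
      w = r - e \<and> w' = r - 2 * e \<and> z = r + e \<and> z' = r + 2 * e"
    using k by (auto simp: w_def w'_def z_def z'_def)
  define R2 where "R2 = R \<union> band u u' w w' \<union> band y y' z z'"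
  have pq: "p \<in> \<Union>R" "q \<in> \<Union>R"
    using c by blast+
  have far: "a + 10 * e < b \<or> b + 10 * e < a" if "a \<in> \<Union>R \<union> {0, T, r}" "b \<in> \<Union>R \<union> {0, T, r}" "a \<noteq> b" for a b
    using space[of a b] space[of b a] that by (metis linorder_neqE_linordered_idom)
  have farp: "x = p \<or> p + 10 * e < x \<or> x + 10 * e < p" and farq: "x = q \<or> q + 10 * e < x \<or> x + 10 * e < q"
    and farr: "r + 10 * e < x \<or> x + 10 * e < r" if "x \<in> \<Union>R" for x
    using far[of p x] far[of q x] far[of r x] that pq r by blast+
  have pqr: "p + 10 * e < q \<or> q + 10 * e < p" "p + 10 * e < r \<or> r + 10 * e < p" "q + 10 * e < r \<or> r + 10 * e < q"
    using far[of p q] farr[of p] farr[of q] pq c by auto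
  have bounds: "10 * e < p" "p + 10 * e < T" "10 * e < q" "q + 10 * e < T" "10 * e < r" "r + 10 * e < T"
    using space[of 0 p] space[of p T] space[of 0 q] space[of q T] space[of 0 r] space[of r T]
      ends_bounds[OF R] pq r by auto
  have ends: "x \<in> \<Union>R2 \<longleftrightarrow> x \<in> \<Union>R \<or> x \<in> {u, u', w, w', y, y', z, z'}" for x
    by (auto simp: R2_def)
  have near_u: "p - 2 * e \<le> x \<and> x \<le> p + 2 * e \<and> x \<noteq> p" if "x \<in> {u, u'}" for x
    using u e that by auto
  have near_y: "q - 2 * e \<le> x \<and> x \<le> q + 2 * e \<and> x \<noteq> q" if "x \<in> {y, y'}" for x
    using y e that by auto
  have near_w: "r - 2 * e \<le> x \<and> x \<le> r + 2 * e" if "x \<in> {w, w', z, z'}" for x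
    using w e that by auto
  \<comment> \<open>Every end is an old one or belongs to the cluster at \<open>p\<close>,
    \<open>q\<close> or \<open>r\<close>. The three local statements below follow from this and
    yield all adjacencies.\<close>
  have cases: "x \<in> \<Union>R \<or> x \<in> {u, u'} \<or> x \<in> {y, y'} \<or> x \<in> {w, w', z, z'}" if "x \<in> \<Union>R2" for x
    using that unfolding ends by blast
  have local_p: "x = p \<or> x \<in> {u, u'} \<or> x < p - 5 * e \<or> p + 5 * e < x" if x: "x \<in> \<Union>R2" for x
    using cases[OF x]
  proof (elim disjE)
    show ?thesis if "x \<in> \<Union>R"
      using farp[OF that] e by linarith
    show ?thesis if "x \<in> {y, y'}"
      using near_y[OF that] pqr(1) e by linarith
    show ?thesis if "x \<in> {w, w', z, z'}"
      using near_w[OF that] pqr(2) e by linarith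
  qed blast
  have local_q: "x = q \<or> x \<in> {y, y'} \<or> x < q - 5 * e \<or> q + 5 * e < x" if x: "x \<in> \<Union>R2" for x
    using cases[OF x]
  proof (elim disjE)
    show ?thesis if "x \<in> \<Union>R"
      using farq[OF that] e by linarith
    show ?thesis if "x \<in> {u, u'}"
      using near_u[OF that] pqr(1) e by linarith
    show ?thesis if "x \<in> {w, w', z, z'}"
      using near_w[OF that] pqr(3) e by linarith
  qed blast
  have local_r: "x \<in> {w, w', z, z'} \<or> x < r - 5 * e \<or> r + 5 * e < x" if x: "x \<in> \<Union>R2" for x
    using cases[OF x]
  proof (elim disjE)
    show ?thesis if "x \<in> \<Union>R"
      using farr[OF that] e by linarith
    show ?thesis if "x \<in> {u, u'}"
      using near_u[OF that] pqr(2) e by linarith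
    show ?thesis if "x \<in> {y, y'}"
      using near_y[OF that] pqr(3) e by linarith
  qed blast
  have freeI: "between_free R2 a b" if "a \<noteq> b"
      "\<And>x. x \<in> \<Union>R2 \<Longrightarrow> (x \<le> a \<or> b \<le> x) \<and> (x \<le> b \<or> a \<le> x)" for a b
    using that unfolding between_free_def by (meson leD)
  have free: "between_free R2 p u" "between_free R2 u u'"
    by (rule freeI; insert u e; (drule local_p)?; auto)+
  have free': "between_free R2 y q" "between_free R2 y y'"
    by (rule freeI; insert y e; (drule local_q)?; auto)+
  have free'': "between_free R2 w z" "between_free R2 w w'" "between_free R2 z z'"
    by (rule freeI; insert w e; (drule local_r)?; auto)+
  have out: "x \<notin> \<Union>R" if x: "x \<in> {u, u', w, w', y, y', z, z'}" for x
  proof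
    assume xR: "x \<in> \<Union>R"
    from x consider "x \<in> {u, u'}" | "x \<in> {y, y'}" | "x \<in> {w, w', z, z'}"
      by blast
    then show False
    proof cases
      case 1
      show False
        using near_u[OF 1] farp[OF xR] e by linarith
    next
      case 2
      show False
        using near_y[OF 2] farq[OF xR] e by linarith
    next
      case 3
      show False
        using near_w[OF 3] farr[OF xR] e by linarith
    qed
  qed
  have sep: "a \<noteq> b" if "a \<in> {u, u'}" "b \<in> {y, y'}" for a b
    using near_u[OF that(1)] near_y[OF that(2)] pqr(1) e by linarith
  have sep': "a \<noteq> b" if "a \<in> {u, u'}" "b \<in> {w, w', z, z'}" for a b
    using near_u[OF that(1)] near_w[OF that(2)] pqr(2) e by linarith
  have sep'': "a \<noteq> b" if "a \<in> {y, y'}" "b \<in> {w, w', z, z'}" for a b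
    using near_y[OF that(1)] near_w[OF that(2)] pqr(3) e by linarith
  have "u \<noteq> u'" "y \<noteq> y'" "distinct [w, w', z, z']"
    using u y w e by auto
  then have dist: "distinct [u, u', w, w', y, y', z, z']"
    using sep[of u y] sep[of u y'] sep[of u' y] sep[of u' y'] sep'[of u w] sep'[of u w'] sep'[of u z]
      sep'[of u z'] sep'[of u' w] sep'[of u' w'] sep'[of u' z] sep'[of u' z'] sep''[of y w] sep''[of y w']
      sep''[of y z] sep''[of y z'] sep''[of y' w] sep''[of y' w'] sep''[of y' z] sep''[of y' z'] by simp
  have range: "x \<in> {0<..<T}" if x: "x \<in> {u, u', w, w', y, y', z, z'}" for x
  proof -
    from x consider "x \<in> {u, u'}" | "x \<in> {y, y'}" | "x \<in> {w, w', z, z'}"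
      by blast
    then have "0 < x \<and> x < T"
    proof cases
      case 1
      show ?thesis
        using near_u[OF 1] bounds e by linarith
    next
      case 2
      show ?thesis
        using near_y[OF 2] bounds e by linarith
    next
      case 3
      show ?thesis
        using near_w[OF 3] bounds e by linarith
    qed
    then show ?thesis
      by simp
  qed
  \<comment> \<open>Being adjacent in the largest diagram \<open>R2\<close> passes to its
    subdiagrams, so the adjacencies are checked once for all four insertions.\<close>
  have ok: "band_ok T S a a' b b'"
    if "S \<union> band a a' b b' \<subseteq> R2" "\<Union>S \<inter> {a, a', b, b'} = {}" "distinct [a, a', b, b']"
      "{a, a', b, b'} \<subseteq> {u, u', w, w', y, y', z, z'}" "between_free R2 a a'" "between_free R2 b b'" for S a a' b b'
  proof -
    have sub: "\<Union>(S \<union> band a a' b b') \<subseteq> \<Union>R2"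
      using that(1) by (rule Union_mono)
    have "{a, a', b, b'} \<subseteq> {0<..<T}"
      using that(4) range by blast
    then show ?thesis
      unfolding band_ok_def using that(2,3) between_free_mono[OF that(5) sub]
        between_free_mono[OF that(6) sub] by blast
  qed
  have oks: "band_ok T R u u' w w'" "band_ok T R y y' z z'"
      "band_ok T (R \<union> band y y' z z') u u' w w'" "band_ok T (R \<union> band u u' w w') y y' z z'"
    by (rule ok; (rule free free' free'' | use dist out in \<open>force simp: R2_def\<close>))+
  have dirs: "dir p u = s" "dir y q = - t" "dir w z = - k"
    using s t k e by (auto simp: u_def y_def w_def z_def)
  have "band_value R y y' z z' (\<lambda>x. dir p u * - dir y q * f x + dir p u * - dir w z * single {p, q} x)"
    using free free' free'' v
    by (intro hop[OF R c(1) f oks(1,3,2,4)]) (simp_all add: R2_def u_def u'_def w_def w'_def)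
  then show ?thesis
    unfolding dirs by (simp add: y_def y'_def z_def z'_def)
qed


lemma between_freeI:
  "x \<noteq> y \<Longrightarrow> (\<And>z. z \<in> \<Union>R \<Longrightarrow> z \<le> min x y \<or> max x y \<le> z) \<Longrightarrow> between_free R x y"
  unfolding between_free_def by fastforce

lemma supported_zero: "supported R (\<lambda>v. 0)"
  and supported_uminus: "supported R f \<Longrightarrow> supported R (\<lambda>v. - f v)"
  by (simp_all add: supported_def)

text \<open>The intermediate band may lie on either side of \<open>q\<close>; that both signs of \<open>t\<close> occur gives \<open>four_single\<close>.\<close>

lemma double_hop:
  assumes R: "dg R" and c: "{p, q} \<in> R" "p \<noteq> q" and f: "supported R f"
    and r: "r \<notin> \<Union>R" "0 < r" "r < T" and e: "e > 0"
    and space: "\<And>x y. x \<in> \<Union>R \<union> {0, T, r} \<Longrightarrow> y \<in> \<Union>R \<union> {0, T, r} \<Longrightarrow> x < y \<Longrightarrow> x + 10 * e < y"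
    and t: "t = 1 \<or> t = -1" and k: "k = 1 \<or> k = -1"
    and v: "band_value R (p - e) (p - 2 * e) (r + of_int k * e) (r + 2 * of_int k * e) f"
  shows "band_value R (p + e) (p + 2 * e) (r + of_int k * e) (r + 2 * of_int k * e)
     (\<lambda>x. - f x - 2 * t * k * single {p, q} x)"
proof -
  have c': "{q, p} \<in> R" "q \<noteq> p"
    using c by (auto simp: insert_commute)
  let ?g = "\<lambda>x. - 1 * t * f x + - 1 * k * single {p, q} x"
  have g: "supported R ?g"
    using f c by (auto simp: supported_def)
  \<comment> \<open>The first hop carries the band from \<open>p\<close> to \<open>q\<close> and to
    the other side of \<open>r\<close>; the second, with \<open>- k\<close>, brings it back to
    \<open>p\<close>, now behind it, and to the old side of \<open>r\<close>. Both contribute the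
    same multiple of the chord, and the choice of \<open>t\<close> survives in its sign.\<close>
  have "band_value R (q + of_int t * e) (q + 2 * of_int t * e) (r + of_int (- k) * e) (r + 2 * of_int (- k) * e) ?g"
    using hop_near[OF R c f r e space, of "-1" t k] t k v by simp
  moreover have "- k = 1 \<or> - k = -1"
    using k by auto
  ultimately have "band_value R (p + e) (p + 2 * e) (r + of_int k * e) (r + 2 * of_int k * e)
      (\<lambda>x. t * ?g x - t * k * single {q, p} x)"
    using hop_near[OF R c' g r e space t, of 1 "- k"] by simp
  moreover have "t * (- 1 * t * f x + - 1 * k * single {p, q} x) - t * k * single {q, p} x =
      - f x - 2 * t * k * single {p, q} x" for x
    using t by (auto simp: insert_commute)
  ultimately show ?thesis
    by simp
qed

text \<open>The starting band lies in the gap before \<open>p\<close> with nested chords: the inner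
  one is trivial by R1, hence so is the outer one. Carrying the ends near \<open>p\<close> across
  \<open>p\<close> produces the same band with value \<open>2 P(c)\<close> or
  \<open>- 2 P(c)\<close>, depending on \<open>t\<close>, and \<open>band_value_unique\<close>
  compares the two.\<close>

lemma four_single:
  assumes R: "dg R" and c: "{p, q} \<in> R" "p \<noteq> q"
  shows "rel R (\<lambda>v. 4 * single {p, q} v)"
proof -
  have p: "p \<in> \<Union>R" "0 < p" "p < T"
    using c ends_bounds[OF R, of p] by blast+
  have fin: "finite (\<Union>R)"
    by (rule finite_ends[OF R])
  \<comment> \<open>The last end before \<open>p\<close>, or the cut 0 if there is none.\<close>
  define l where "l = Max (insert 0 {z \<in> \<Union>R. z < p})"
  have "finite {z \<in> \<Union>R. z < p}"
    using fin by (rule rev_finite_subset) blast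
  then have fin': "finite (insert 0 {z \<in> \<Union>R. z < p})"
    by simp
  have "l \<in> insert 0 {z \<in> \<Union>R. z < p}"
    unfolding l_def using fin' by (intro Max_in) auto
  then have "l = 0 \<or> l \<in> \<Union>R \<and> l < p"
    by blast
  moreover from this have "0 \<le> l"
    using ends_bounds[OF R, of l] by (metis less_imp_le order_refl)
  ultimately have l: "l < p" "0 \<le> l" "l \<in> \<Union>R \<union> {0}"
    using p by auto
  have gap: "z \<le> l \<or> p \<le> z" if "z \<in> \<Union>R" for z
    using Max_ge[OF fin', of z] that unfolding l_def[symmetric] by (cases "z < p") auto
  define r where "r = (l + p) / 2"
  have r: "l < r" "r < p"
    using l by (auto simp: r_def)
  have rR: "r \<notin> \<Union>R" "0 < r" "r < T"
    using gap r l p by force+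
  obtain e where e: "e > 0" and space: "\<And>x y. x \<in> \<Union>R \<union> {0, T, r} \<Longrightarrow> y \<in> \<Union>R \<union> {0, T, r} \<Longrightarrow> x < y \<Longrightarrow> x + 10 * e < y"
    using exists_spacing[of "\<Union>R \<union> {0, T, r}"] fin by (metis finite.emptyI finite_UnI finite_insert)
  have rp: "l + 10 * e < r" "r + 10 * e < p" "p + 10 * e < T"
    using space[of l r] space[of r p] space[of p T] r p l by auto
  have far: "z \<le> l \<or> z = p \<or> p + 10 * e < z" if "z \<in> \<Union>R" for z
    using gap[OF that] space[of p z] that p by fastforce
  define X where "X = band (p - e) (p - 2 * e) (r + e) (r + 2 * e)"
  define Y where "Y = band (p + e) (p + 2 * e) (r + e) (r + 2 * e)"
  have ends: "\<Union>(R \<union> X) = \<Union>R \<union> {p - e, p - 2 * e, r + e, r + 2 * e}"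
      "\<Union>(R \<union> Y) = \<Union>R \<union> {p + e, p + 2 * e, r + e, r + 2 * e}"
    unfolding X_def Y_def by blast+
  have freeX: "between_free (R \<union> X) a b" if "a \<noteq> b" "l < a" "a < p" "l < b" "b < p"
      "\<And>z. z \<in> {p - e, p - 2 * e, r + e, r + 2 * e} \<Longrightarrow> \<not> (a < z \<and> z < b) \<and> \<not> (b < z \<and> z < a)" for a b
  proof (rule between_freeI[OF that(1)])
    fix z assume "z \<in> \<Union>(R \<union> X)"
    then consider "z \<in> \<Union>R" | "z \<in> {p - e, p - 2 * e, r + e, r + 2 * e}"
      unfolding ends by blast
    then show "z \<le> min a b \<or> max a b \<le> z"
    proof cases
      case 1
      show ?thesis
        using gap[OF 1] that(2-5) by linarith
    next
      case 2
      show ?thesis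
        using that(6)[OF 2] by linarith
    qed
  qed
  have okX: "band_ok T R (p - e) (p - 2 * e) (r + e) (r + 2 * e)"
    unfolding band_ok_def X_def[symmetric]
  proof (intro conjI)
    show "between_free (R \<union> X) (p - e) (p - 2 * e)" "between_free (R \<union> X) (r + e) (r + 2 * e)"
      using rp e by (intro freeX; force)+
    show "{p - e, p - 2 * e, r + e, r + 2 * e} \<inter> \<Union>R = {}"
      using rp e gap by fastforce
  qed (use rp e l p in auto)
  have okY: "band_ok T R (p + e) (p + 2 * e) (r + e) (r + 2 * e)"
    unfolding band_ok_def Y_def[symmetric]
  proof (intro conjI)
    show "between_free (R \<union> Y) (p + e) (p + 2 * e)" "between_free (R \<union> Y) (r + e) (r + 2 * e)"
      unfolding between_free_def ends using rp e far by fastforce+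
    show "{p + e, p + 2 * e, r + e, r + 2 * e} \<inter> \<Union>R = {}"
      using rp e far by fastforce
  qed (use rp e l p in auto)
  note dX = dg_band[OF R okX, folded X_def]
  have "rel (R \<union> X) (single {p - 2 * e, r + 2 * e})"
    using rp e by (intro rel_R1 dX freeX) (auto simp: X_def)
  moreover have "rel (R \<union> X) (\<lambda>v. single {p - e, r + e} v + single {p - 2 * e, r + 2 * e} v)"
    using okX band_notin[OF okX] unfolding band_ok_def X_def[symmetric]
    by (intro rel_R2 dX) (auto simp: X_def)
  ultimately have "rel (R \<union> X) (\<lambda>v. single {p - e, r + e} v + single {p - 2 * e, r + 2 * e} v -
      single {p - 2 * e, r + 2 * e} v)"
    using rel_diff[OF dX] by blast
  then have v: "band_value R (p - e) (p - 2 * e) (r + of_int 1 * e) (r + 2 * of_int 1 * e) (\<lambda>v. 0)"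
    by (simp add: band_value_def X_def)
  have w: "band_value R (p + e) (p + 2 * e) (r + e) (r + 2 * e) (\<lambda>x. - 0 - 2 * t * 1 * single {p, q} x)"
    if "t = 1 \<or> t = -1" for t
    using double_hop[OF R c supported_zero rR e space that _ v] by simp
  have "rel R (\<lambda>x. (- 0 - 2 * (- 1) * 1 * single {p, q} x) - (- 0 - 2 * 1 * 1 * single {p, q} x))"
    using c by (intro band_value_unique[OF R okY] w) (auto simp: supported_def)
  then show ?thesis
    by simp
qed

lemma four_rel: "dg R \<Longrightarrow> c \<in> R \<Longrightarrow> rel R (\<lambda>v. 4 * single c v)"
proof -
  assume R: "dg R" "c \<in> R"
  then obtain p q where "c = {p, q}" "p \<noteq> q"
    using dg unfolding linear_diagram_def by (metis card_2_iff)
  then show ?thesis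
    using four_single R by blast
qed

text \<open>With both bands present, \<open>{u', v'}\<close> forms an R2 pair with its partner
  \<open>{u, v}\<close> and another one with \<open>{t, w}\<close>; so these two have equal
  values.\<close>

lemma merge:
  assumes R: "dg R" and f: "supported R f"
    and X: "band_ok T R u u' v v'" "band_ok T (R \<union> band t t' w w') u u' v v'"
    and Y: "band_ok T R t t' w w'" "band_ok T (R \<union> band u u' v v') t t' w w'"
    and free: "between_free (R \<union> band u u' v v' \<union> band t t' w w') u' t"
      "between_free (R \<union> band u u' v v' \<union> band t t' w w') v' w"
  shows "band_value R u u' v v' f \<longleftrightarrow> band_value R t t' w w' f"
proof -
  define R2 where "R2 = R \<union> band u u' v v' \<union> band t t' w w'"
  have RX: "dg (R \<union> band u u' v v')" and RY: "dg (R \<union> band t t' w w')"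
    using dg_band[OF R] X(1) Y(1) by blast+
  have R2: "dg R2"
    unfolding R2_def by (rule dg_band[OF RX Y(2)])
  have R2': "R2 = R \<union> band t t' w w' \<union> band u u' v v'"
    unfolding R2_def by blast
  have new: "{u, v} \<notin> R" "{u', v'} \<notin> R" "{t, w} \<notin> R" "{t', w'} \<notin> R"
    using band_notin X(1) Y(1) by blast+
  have ne: "{u, v} \<noteq> {t, w}" "{u, v} \<noteq> {t', w'}" "{u', v'} \<noteq> {t, w}" "{u', v'} \<noteq> {t', w'}"
  proof -
    have "{u, v} \<in> R \<union> band u u' v v'" "{u', v'} \<in> R \<union> band u u' v v'"
      by simp_all
    then show "{u, v} \<noteq> {t, w}" "{u, v} \<noteq> {t', w'}" "{u', v'} \<noteq> {t, w}" "{u', v'} \<noteq> {t', w'}"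
      using band_notin[OF Y(2)] by metis+
  qed
  have "rel R2 (\<lambda>x. single {u, v} x + single {u', v'} x)"
  proof (rule rel_R2[OF R2])
    have "band_ok T (R \<union> band t t' w w') u u' v v'"
      by (rule X(2))
    then show "between_free R2 u u'" "between_free R2 v v'"
      by (simp_all add: band_ok_def R2')
    show "{u, v} \<noteq> {u', v'}"
      using band_notin[OF X(1)] by blast
  qed (simp_all add: R2_def)
  moreover have "rel R2 (\<lambda>x. single {u', v'} x + single {t, w} x)"
    using ne free by (intro rel_R2[OF R2]) (simp_all add: R2_def)
  ultimately have "rel R2 (\<lambda>x. (single {u, v} x + single {u', v'} x) - (single {u', v'} x + single {t, w} x))"
    by (rule rel_diff[OF R2])
  then have eq: "rel R2 (\<lambda>x. single {u, v} x - single {t, w} x)"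
    by simp
  have "band_value R u u' v v' f \<longleftrightarrow> rel R2 (\<lambda>x. single {u, v} x - f x)"
    using rel_band[OF RX Y(2), of "\<lambda>x. single {u, v} x - f x"] f new ne
    by (simp add: R2_def band_value_def supported_def)
  also have "\<dots> \<longleftrightarrow> rel R2 (\<lambda>x. single {t, w} x - f x)"
    using rel_diff[OF R2 _ eq, of "\<lambda>x. single {u, v} x - f x"] rel_add[OF R2 _ eq, of "\<lambda>x. single {t, w} x - f x"]
    by (auto simp: algebra_simps)
  also have "\<dots> \<longleftrightarrow> band_value R t t' w w' f"
    using rel_band[OF RY X(2), of "\<lambda>x. single {t, w} x - f x"] f new ne
    by (simp add: R2' band_value_def supported_def)
  finally show ?thesis .
qed

text \<open>A band joins the gap after \<open>s\<close> to the gap after \<open>m\<close>; the signs \<open>i\<close> and \<open>j\<close> prescribe the order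
  of its two chords in these gaps, so that it is crossing if \<open>i = j\<close> and parallel otherwise.\<close>

definition placed ::
    "real set set \<Rightarrow> real \<Rightarrow> int \<Rightarrow> real \<Rightarrow> int \<Rightarrow> real \<Rightarrow> real \<Rightarrow> real \<Rightarrow> real \<Rightarrow> bool" where
  "placed R s i m j a a' b b' \<longleftrightarrow> 0 \<le> s \<and> s < a \<and> s < a' \<and> a < m \<and> a' < m \<and> m < b \<and> m < b' \<and> b < T \<and> b' < T \<and>
     (if i = 1 then a < a' else a' < a) \<and> (if j = 1 then b < b' else b' < b) \<and>
     (\<forall>z\<in>\<Union>R. \<not> (s < z \<and> z \<le> max a a') \<and> \<not> (m < z \<and> z \<le> max b b'))"

section \<open>Bands joining prescribed gaps\<close>

lemma placedD:
  assumes "placed R s i m j a a' b b'"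
  shows "0 \<le> s" "s < a" "s < a'" "a < m" "a' < m" "m < b" "m < b'" "b < T" "b' < T" "a \<noteq> a'" "b \<noteq> b'"
    and "z \<in> \<Union>R \<Longrightarrow> z \<le> s \<or> a < z \<and> a' < z"
    and "z \<in> \<Union>R \<Longrightarrow> z \<le> m \<or> b < z \<and> b' < z"
proof -
  have *: "\<not> (s < z \<and> z \<le> max a a') \<and> \<not> (m < z \<and> z \<le> max b b')" if "z \<in> \<Union>R"
    using assms that unfolding placed_def by blast
  show "z \<le> s \<or> a < z \<and> a' < z" if "z \<in> \<Union>R"
    using *[OF that] by linarith
  show "z \<le> m \<or> b < z \<and> b' < z" if "z \<in> \<Union>R"
    using *[OF that] by linarith
qed (use assms in \<open>auto simp: placed_def split: if_splits\<close>)

text \<open>The set \<open>F\<close> admits the ends of a second band that is already present, as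
  long as none of them lies between paired ends.\<close>

lemma placed_band_ok:
  assumes R: "dg R" and p: "placed R s i m j a a' b b'"
    and S: "\<Union>S \<subseteq> \<Union>R \<union> F" "\<And>x. x \<in> F \<Longrightarrow> x < min a a' \<or> max a a' < x" "\<And>x. x \<in> F \<Longrightarrow> x < min b b' \<or> max b b' < x"
  shows "band_ok T S a a' b b'"
proof -
  note D = placedD[OF p]
  have ends: "z \<in> \<Union>R \<or> z \<in> F \<or> z \<in> {a, a', b, b'}" if "z \<in> \<Union>(S \<union> band a a' b b')" for z
    using that S(1) by blast
  show ?thesis
    unfolding band_ok_def
  proof (intro conjI)
    show "distinct [a, a', b, b']" "{a, a', b, b'} \<subseteq> {0<..<T}"
      using D(1-11) by auto
    have "z \<notin> {a, a', b, b'}" if "z \<in> \<Union>S" for z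
    proof -
      have "z \<in> \<Union>R \<or> z \<in> F"
        using that S(1) by blast
      then show ?thesis
      proof
        assume "z \<in> \<Union>R"
        then show ?thesis
          using D(1-11) D(12,13)[of z] by auto
      next
        assume "z \<in> F"
        then show ?thesis
          using S(2,3)[of z] by auto
      qed
    qed
    then show "{a, a', b, b'} \<inter> \<Union>S = {}"
      by blast
    show "between_free (S \<union> band a a' b b') a a'"
    proof (rule between_freeI[OF D(10)])
      fix z assume "z \<in> \<Union>(S \<union> band a a' b b')"
      from ends[OF this] show "z \<le> min a a' \<or> max a a' \<le> z"
        using D(1-11) D(12)[of z] S(2)[of z] by fastforce
    qed
    show "between_free (S \<union> band a a' b b') b b'"
    proof (rule between_freeI[OF D(11)])
      fix z assume "z \<in> \<Union>(S \<union> band a a' b b')"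
      from ends[OF this] show "z \<le> min b b' \<or> max b b' \<le> z"
        using D(1-11) D(13)[of z] S(3)[of z] by fastforce
    qed
  qed
qed

text \<open>\<open>merge\<close> needs the second chord of one band next to the first chord of the
  other in both gaps. With the new ends \<open>c\<close>, \<open>c'\<close> before \<open>a\<close>,
  \<open>a'\<close>, this forces \<open>d\<close>, \<open>d'\<close> to come before
  \<open>b\<close>, \<open>b'\<close> for crossing bands and after them for parallel ones.\<close>

lemma placed_merge:
  assumes R: "dg R" and f: "supported R f"
    and X: "placed R s i m j a a' b b'" and Y: "placed R s i m j c c' d d'"
    and ij: "i = 1 \<or> i = -1" "j = 1 \<or> j = -1"
    and left: "max c c' < min a a'" and right: "if i = j then max d d' < min b b' else max b b' < min d d'"
  shows "band_value R a a' b b' f \<longleftrightarrow> band_value R c c' d d' f"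
proof -
  note DX = placedD[OF X] and DY = placedD[OF Y]
  have ends: "\<Union>(S \<union> band x x' y y') = \<Union>S \<union> {x, x', y, y'}" for S x x' y y'
    by blast
  have right': "max d d' < min b b' \<or> max b b' < min d d'"
    using right by presburger
  have okX: "band_ok T R a a' b b'" and okY: "band_ok T R c c' d d'"
    using placed_band_ok[OF R X, of R "{}"] placed_band_ok[OF R Y, of R "{}"] by auto
  have okX': "band_ok T (R \<union> band c c' d d') a a' b b'"
    by (rule placed_band_ok[OF R X, of _ "{c, c', d, d'}"])
      (use ends left right' DX(1-9) DY(1-9) in auto)
  have okY': "band_ok T (R \<union> band a a' b b') c c' d d'"
    by (rule placed_band_ok[OF R Y, of _ "{a, a', b, b'}"])
      (use ends left right' DX(1-9) DY(1-9) in auto)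
  define R2 where "R2 = R \<union> band a a' b b' \<union> band c c' d d'"
  have R2': "R2 = R \<union> band c c' d d' \<union> band a a' b b'"
    unfolding R2_def by blast
  have left': "c < a" "c < a'" "c' < a" "c' < a'"
    using left by auto
  have in2: "z \<in> \<Union>R \<or> z = a \<or> z = a' \<or> z = b \<or> z = b' \<or> z = c \<or> z = c' \<or> z = d \<or> z = d'" if "z \<in> \<Union>R2" for z
    using that unfolding R2_def by blast
  show ?thesis
  proof (cases "i = 1")
    case True
    have o: "c < c'" "a < a'" "j = 1 \<and> d < d' \<and> d' < b \<and> b < b' \<or> j \<noteq> 1 \<and> b' < b \<and> b < d' \<and> d' < d"
      using X Y True right ij unfolding placed_def by (auto split: if_splits)
    have "between_free R2 c' a"
    proof (rule between_freeI)
      fix z assume "z \<in> \<Union>R2"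
      from in2[OF this] have "z \<le> s \<or> a < z \<and> c' < z \<or>
          z = a \<or> z = a' \<or> z = b \<or> z = b' \<or> z = c \<or> z = c' \<or> z = d \<or> z = d'"
        using DX(12)[of z] DY(12)[of z] by blast
      then show "z \<le> min c' a \<or> max c' a \<le> z"
        by (elim disjE) (use DX(2-7) DY(2-7) left' o(1,2) in linarith)+
    qed (use left in auto)
    moreover have "between_free R2 d' b"
    proof (rule between_freeI)
      fix z assume "z \<in> \<Union>R2"
      from in2[OF this] have *: "z \<le> m \<or> b < z \<and> d' < z \<or>
          z = a \<or> z = a' \<or> z = b \<or> z = b' \<or> z = c \<or> z = c' \<or> z = d \<or> z = d'"
        using DX(13)[of z] DY(13)[of z] by blast
      from o(3) show "z \<le> min d' b \<or> max d' b \<le> z"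
      proof (elim disjE conjE)
        assume "d < d'" "d' < b" "b < b'"
        with * show ?thesis
          by (elim disjE) (use DX(4-7) DY(4-7) in linarith)+
      next
        assume "b' < b" "b < d'" "d' < d"
        with * show ?thesis
          by (elim disjE) (use DX(4-7) DY(4-7) in linarith)+
      qed
    qed (use right' in auto)
    ultimately show ?thesis
      using merge[OF R f okY okY' okX okX'] by (simp add: R2')
  next
    case False
    have o: "c' < c" "a' < a" "j = -1 \<and> d' < d \<and> d < b' \<and> b' < b \<or> j = 1 \<and> b < b' \<and> b' < d \<and> d < d'"
      using X Y False right ij unfolding placed_def by (auto split: if_splits)
    have "between_free R2 a' c"
    proof (rule between_freeI)
      fix z assume "z \<in> \<Union>R2"
      from in2[OF this] have "z \<le> s \<or> a' < z \<and> c < z \<or>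
          z = a \<or> z = a' \<or> z = b \<or> z = b' \<or> z = c \<or> z = c' \<or> z = d \<or> z = d'"
        using DX(12)[of z] DY(12)[of z] by blast
      then show "z \<le> min a' c \<or> max a' c \<le> z"
        by (elim disjE) (use DX(2-7) DY(2-7) left' o(1,2) in linarith)+
    qed (use left in auto)
    moreover have "between_free R2 b' d"
    proof (rule between_freeI)
      fix z assume "z \<in> \<Union>R2"
      from in2[OF this] have *: "z \<le> m \<or> b' < z \<and> d < z \<or>
          z = a \<or> z = a' \<or> z = b \<or> z = b' \<or> z = c \<or> z = c' \<or> z = d \<or> z = d'"
        using DX(13)[of z] DY(13)[of z] by blast
      from o(3) show "z \<le> min b' d \<or> max b' d \<le> z"
      proof (elim disjE conjE)
        assume "d' < d" "d < b'" "b' < b"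
        with * show ?thesis
          by (elim disjE) (use DX(4-7) DY(4-7) in linarith)+
      next
        assume "b < b'" "b' < d" "d < d'"
        with * show ?thesis
          by (elim disjE) (use DX(4-7) DY(4-7) in linarith)+
      qed
    qed (use right' in auto)
    ultimately show ?thesis
      using merge[OF R f okX okX' okY okY'] by (simp add: R2_def)
  qed
qed

definition marked_value ::
    "real set set \<Rightarrow> real \<Rightarrow> int \<Rightarrow> real \<Rightarrow> int \<Rightarrow> (real set \<Rightarrow> int) \<Rightarrow> bool" where
  "marked_value R s i m j f \<longleftrightarrow>
     (\<forall>a a' b b'. placed R s i m j a a' b b' \<longrightarrow> band_value R a a' b b' f)"

lemma two_points:
  fixes x t :: real
  assumes "x < t" "i = 1 \<or> i = (-1::int)"
  obtains a a' where "x < a" "x < a'" "a < t" "a' < t" "if i = 1 then a < a' else a' < a"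
proof -
  obtain a where a: "x < a" "a < t"
    using dense assms(1) by blast
  obtain a' where a': "a < a'" "a' < t"
    using dense a(2) by blast
  show thesis
    using that[of a a'] that[of a' a] a a' assms(2) by auto
qed

text \<open>Two bands of the same type need not be separated as \<open>placed_merge\<close> demands.
  Both are compared with a third one, whose left ends lie before all others in their gap and whose
  right ends lie before both bands if these are crossing and behind both if they are
  parallel.\<close>

lemma marked_valueI:
  assumes R: "dg R" and f: "supported R f" and ij: "i = 1 \<or> i = -1" "j = 1 \<or> j = -1"
    and X: "placed R s i m j a a' b b'" and v: "band_value R a a' b b' f"
  shows "marked_value R s i m j f"
  unfolding marked_value_def
proof (intro allI impI)
  fix c c' d d' assume Y: "placed R s i m j c c' d d'"
  note DX = placedD[OF X] and DY = placedD[OF Y]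
  have "s < min (min a a') (min c c')"
    using DX(2,3) DY(2,3) by simp
  then obtain u u' where u: "s < u" "s < u'" "u < min (min a a') (min c c')" "u' < min (min a a') (min c c')"
      "if i = 1 then u < u' else u' < u"
    using two_points[OF _ ij(1)] by metis
  then have u': "max u u' < min (min a a') (min c c')"
    by simp
  obtain w w' where w: "m < w" "m < w'" "w < T" "w' < T" "if j = 1 then w < w' else w' < w"
      "if i = j then max w w' < min (min b b') (min d d') else max (max b b') (max d d') < min w w'"
      "\<And>z. z \<in> \<Union>R \<Longrightarrow> z \<le> m \<or> w < z \<and> w' < z"
  proof (cases "i = j")
    case True
    have "m < min (min b b') (min d d')"
      using DX(6,7) DY(6,7) by simp
    then obtain w w' where w: "m < w" "m < w'" "w < min (min b b') (min d d')" "w' < min (min b b') (min d d')"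
        "if j = 1 then w < w' else w' < w"
      using two_points[OF _ ij(2)] by metis
    show thesis
    proof (rule that[OF w(1,2) _ _ w(5)])
      show "z \<le> m \<or> w < z \<and> w' < z" if "z \<in> \<Union>R" for z
        using DX(13)[OF that] w(3,4) by auto
    qed (use w DX True in auto)
  next
    case False
    obtain g where g: "max (max b b') (max d d') < g" "g < T" "\<And>z. z \<in> \<Union>R \<Longrightarrow> max (max b b') (max d d') < z \<Longrightarrow> g < z"
      using exists_room[OF finite_ends[OF R], of "max (max b b') (max d d')" T] DX(8,9) DY(8,9) by auto
    obtain w w' where w: "max (max b b') (max d d') < w" "max (max b b') (max d d') < w'" "w < g" "w' < g"
        "if j = 1 then w < w' else w' < w"
      using two_points[OF g(1) ij(2)] by metis
    show thesis
    proof (rule that[of w w'])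
      show "z \<le> m \<or> w < z \<and> w' < z" if "z \<in> \<Union>R" for z
        using DX(13)[OF that] DY(13)[OF that] g(3)[OF that] w(3,4) by auto
    qed (use w g DX False in auto)
  qed
  have Z: "placed R s i m j u u' w w'"
    unfolding placed_def
  proof (intro conjI ballI)
    fix z assume z: "z \<in> \<Union>R"
    show "\<not> (s < z \<and> z \<le> max u u')"
      using DX(12)[OF z] u' by auto
    show "\<not> (m < z \<and> z \<le> max w w')"
      using w(7)[OF z] by auto
  qed (use u w DX in auto)
  have "band_value R u u' w w' f"
    using placed_merge[OF R f X Z ij] u' w(6) v by (auto split: if_splits)
  then show "band_value R c c' d d' f"
    using placed_merge[OF R f Y Z ij] u' w(6) by (auto split: if_splits)
qed


lemma marked_swap:
  assumes R: "dg R" and ij: "i = 1 \<or> i = -1" "j = 1 \<or> j = -1" and v: "marked_value R s i m j f"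
  shows "marked_value R s (- i) m (- j) (\<lambda>v. - f v)"
  unfolding marked_value_def
proof (intro allI impI)
  fix a a' b b' assume X: "placed R s (- i) m (- j) a a' b b'"
  have X': "placed R s i m j a' a b' b"
    using X ij unfolding placed_def by (auto simp: max.commute split: if_splits)
  then have "band_ok T R a' a b' b"
    using placed_band_ok[OF R X', of R "{}"] by simp
  then show "band_value R a a' b b' (\<lambda>v. - f v)"
    using band_value_swap[OF R] v X' unfolding marked_value_def by blast
qed

lemma marked_cong:
  assumes R: "dg R" and fg: "supported R f" "supported R g" and v: "marked_value R s i m j f"
    and rel: "rel R (\<lambda>v. f v - g v)"
  shows "marked_value R s i m j g"
  unfolding marked_value_def
proof (intro allI impI)
  fix a a' b b' assume X: "placed R s i m j a a' b b'"
  then have "band_ok T R a a' b b'"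
    using placed_band_ok[OF R X, of R "{}"] by simp
  then show "band_value R a a' b b' g"
    using band_value_cong[OF R _ fg _ rel] v X unfolding marked_value_def by blast
qed

text \<open>The freedom in \<open>m'\<close> yields a band that is placed for the mark
  \<open>m\<close> and whose right ends lie even beyond \<open>m'\<close>;
  \<open>slide_right_many\<close> needs one that serves both marks.\<close>

lemma placed_exists:
  assumes R: "dg R" and sm: "0 \<le> s" "s < m" "m \<le> m'" "m' < T" and ij: "i = 1 \<or> i = -1" "j = 1 \<or> j = -1"
    and free: "\<And>z. z \<in> \<Union>R \<Longrightarrow> \<not> (m < z \<and> z \<le> m')"
  obtains a a' b b' where "placed R s i m j a a' b b'" "m' < b" "m' < b'"
proof -
  obtain g where g: "s < g" "g < m" "\<And>z. z \<in> \<Union>R \<Longrightarrow> s < z \<Longrightarrow> g < z"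
    using exists_room[OF finite_ends[OF R] sm(2)] by metis
  obtain h where h: "m' < h" "h < T" "\<And>z. z \<in> \<Union>R \<Longrightarrow> m' < z \<Longrightarrow> h < z"
    using exists_room[OF finite_ends[OF R] sm(4)] by metis
  obtain a a' where a: "s < a" "s < a'" "a < g" "a' < g" "if i = 1 then a < a' else a' < a"
    using two_points[OF g(1) ij(1)] by metis
  obtain b b' where b: "m' < b" "m' < b'" "b < h" "b' < h" "if j = 1 then b < b' else b' < b"
    using two_points[OF h(1) ij(2)] by metis
  have "placed R s i m j a a' b b'"
    unfolding placed_def
  proof (intro conjI ballI)
    fix z assume z: "z \<in> \<Union>R"
    show "\<not> (s < z \<and> z \<le> max a a')"
      using g(3)[OF z] a by auto
    show "\<not> (m < z \<and> z \<le> max b b')"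
      using h(3)[OF z] free[OF z] b by auto
  qed (use sm a b g h in auto)
  then show thesis
    using that b by blast
qed

text \<open>As \<open>4 P(c)\<close> vanishes, \<open>2 P(c)\<close> equals its negative, and the
  signs produced by \<open>double_hop\<close> may be forgotten.\<close>

lemma rel_mult_four:
  assumes R: "dg R" and k: "k = 1 \<or> k = (-1::int)" and c: "c \<in> R"
  shows "rel R (\<lambda>v. (f v + 2 * k * single c v) - (f v + 2 * single c v))"
proof (cases "k = 1")
  case True
  then show ?thesis
    using rel_zero[OF R] by simp
next
  case False
  then show ?thesis
    using k rel_uminus[OF R four_rel[OF R c]] by (simp add: algebra_simps)
qed

text \<open>The ends in the left gap pass over \<open>p\<close>. Reversing \<open>j\<close> while
  keeping \<open>i\<close> exchanges crossing and parallel bands.\<close>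

lemma slide_left:
  assumes R: "dg R" and f: "supported R f" and c: "{p, q} \<in> R" "p \<noteq> q"
    and s: "0 \<le> s" "s < p" "p < m" "m < T" and free: "\<And>z. z \<in> \<Union>R \<Longrightarrow> z \<le> s \<or> p \<le> z"
    and ij: "i = 1 \<or> i = -1" "j = 1 \<or> j = -1" and v: "marked_value R s i m j f"
  shows "marked_value R p i m (- j) (\<lambda>v. f v + 2 * single {p, q} v)"
proof -
  \<comment> \<open>\<open>double_hop\<close> mirrors the two chords at \<open>p\<close>, from order
    -1 to order 1, and negates \<open>f\<close>. Exchanging the names of the two chords undoes both
    and reverses \<open>j\<close> instead. The case \<open>i = 1\<close> is obtained from this by
    the same exchange at the start.\<close>
  have minus: "marked_value R p (-1) m (- j) (\<lambda>v. f v + 2 * single {p, q} v)"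
    if f: "supported R f" and j: "j = 1 \<or> j = -1" and v: "marked_value R s (-1) m j f" for f j
  proof -
    obtain g where g: "m < g" "g < T" "\<And>z. z \<in> \<Union>R \<Longrightarrow> m < z \<Longrightarrow> g < z"
      using exists_room[OF finite_ends[OF R] s(4)] by metis
    \<comment> \<open>\<open>double_hop\<close> places the other ends around a point that is not an
      end: the middle of a free stretch after \<open>m\<close>.\<close>
    define r where "r = (m + g) / 2"
    have r: "m < r" "r < g"
      using g by (auto simp: r_def)
    have rR: "r \<notin> \<Union>R" "0 < r" "r < T"
      using g(1,2) g(3)[of r] r s by (metis less_asym, linarith+)
    obtain e where e: "e > 0" and space: "\<And>x y. x \<in> \<Union>R \<union> {0, T, r, s, m, g} \<Longrightarrow>
        y \<in> \<Union>R \<union> {0, T, r, s, m, g} \<Longrightarrow> x < y \<Longrightarrow> x + 10 * e < y"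
      using exists_spacing[of "\<Union>R \<union> {0, T, r, s, m, g}"] finite_ends[OF R]
      by (metis finite.emptyI finite_UnI finite_insert)
    have p: "p \<in> \<Union>R"
      using c by blast
    have sp: "s + 10 * e < p" "p + 10 * e < m" "m + 10 * e < r" "r + 10 * e < g"
      using space[of s p] space[of p m] space[of m r] space[of r g] p s r by auto
    have far: "z \<le> s \<or> z = p \<or> p + 10 * e < z" if "z \<in> \<Union>R" for z
      using free[OF that] space[of p z] that p by fastforce
    have X: "placed R s (-1) m j (p - e) (p - 2 * e) (r + of_int j * e) (r + 2 * of_int j * e)"
      unfolding placed_def
    proof (intro conjI ballI)
      fix z assume z: "z \<in> \<Union>R"
      show "\<not> (s < z \<and> z \<le> max (p - e) (p - 2 * e))"
        using free[OF z] e by auto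
      show "\<not> (m < z \<and> z \<le> max (r + of_int j * e) (r + 2 * of_int j * e))"
        using g(3)[OF z] sp e j by auto
    qed (use s sp e g j in auto)
    have Y: "placed R p 1 m j (p + e) (p + 2 * e) (r + of_int j * e) (r + 2 * of_int j * e)"
      unfolding placed_def
    proof (intro conjI ballI)
      fix z assume z: "z \<in> \<Union>R"
      show "\<not> (p < z \<and> z \<le> max (p + e) (p + 2 * e))"
        using far[OF z] s e by auto
      show "\<not> (m < z \<and> z \<le> max (r + of_int j * e) (r + 2 * of_int j * e))"
        using g(3)[OF z] sp e j by auto
    qed (use s sp e g j in auto)
    have "band_value R (p + e) (p + 2 * e) (r + of_int j * e) (r + 2 * of_int j * e)
        (\<lambda>x. - f x - 2 * 1 * j * single {p, q} x)"
      using v X unfolding marked_value_def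
      by (intro double_hop[OF R c f rR e space]) (use j in auto)
    then have "marked_value R p 1 m j (\<lambda>x. - f x - 2 * 1 * j * single {p, q} x)"
      by (intro marked_valueI[OF R _ _ j Y]) (use f c in \<open>auto simp: supported_def\<close>)
    from marked_swap[OF R _ j this] have "marked_value R p (-1) m (- j) (\<lambda>x. f x + 2 * j * single {p, q} x)"
      by (simp add: add.commute)
    then show ?thesis
      using rel_mult_four[OF R j c(1)]
      by (rule marked_cong[OF R, rotated 2]) (use f c in \<open>auto simp: supported_def\<close>)
  qed
  show ?thesis
  proof (cases "i = 1")
    case False
    then show ?thesis
      using minus[OF f ij(2)] v ij by auto
  next
    case True
    have j': "- j = 1 \<or> - j = -1"
      using ij by auto
    have "marked_value R s (-1) m (- j) (\<lambda>v. - f v)"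
      using marked_swap[OF R ij v] True by simp
    from minus[OF supported_uminus[OF f] j' this]
    have "marked_value R p (-1) m j (\<lambda>v. - f v + 2 * single {p, q} v)"
      by simp
    from marked_swap[OF R _ ij(2) this] True
    have "marked_value R p i m (- j) (\<lambda>v. f v + 2 * (-1) * single {p, q} v)"
      by simp
    then show ?thesis
      using rel_mult_four[OF R _ c(1), of "-1" f]
      by (rule marked_cong[OF R, rotated 2]) (use f c in \<open>auto simp: supported_def\<close>)
  qed
qed

text \<open>The mirror image of \<open>slide_left\<close>, obtained by exchanging the roles of the
  two gaps with \<open>band_value_commute\<close>; so \<open>i\<close> is reversed instead of
  \<open>j\<close>.\<close>

lemma slide_right:
  assumes R: "dg R" and f: "supported R f" and c: "{p, q} \<in> R" "p \<noteq> q"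
    and s: "0 \<le> s" "s < m" "m < p" and free: "\<And>z. z \<in> \<Union>R \<Longrightarrow> z \<le> m \<or> p \<le> z"
    and ij: "i = 1 \<or> i = -1" "j = 1 \<or> j = -1" and v: "marked_value R s i m j f"
  shows "marked_value R s (- i) p j (\<lambda>v. f v + 2 * single {p, q} v)"
proof -
  have p: "p \<in> \<Union>R" "p < T"
    using c ends_bounds[OF R, of p] by blast+
  have minus: "marked_value R s (- i) p (-1) (\<lambda>v. f v + 2 * single {p, q} v)"
    if f: "supported R f" and i: "i = 1 \<or> i = -1" and v: "marked_value R s i m (-1) f" for f i
  proof -
    obtain g where g: "s < g" "g < m" "\<And>z. z \<in> \<Union>R \<Longrightarrow> s < z \<Longrightarrow> g < z"
      using exists_room[OF finite_ends[OF R] s(2)] by metis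
    define r where "r = (s + g) / 2"
    have r: "s < r" "r < g"
      using g by (auto simp: r_def)
    have rR: "r \<notin> \<Union>R" "0 < r" "r < T"
      using g(1,2) g(3)[of r] r s p by (metis less_asym, linarith+)
    obtain e where e: "e > 0" and space: "\<And>x y. x \<in> \<Union>R \<union> {0, T, r, s, m, g} \<Longrightarrow>
        y \<in> \<Union>R \<union> {0, T, r, s, m, g} \<Longrightarrow> x < y \<Longrightarrow> x + 10 * e < y"
      using exists_spacing[of "\<Union>R \<union> {0, T, r, s, m, g}"] finite_ends[OF R]
      by (metis finite.emptyI finite_UnI finite_insert)
    have sp: "s + 10 * e < r" "r + 10 * e < g" "g + 10 * e < m" "m + 10 * e < p" "p + 10 * e < T"
      using space[of s r] space[of r g] space[of g m] space[of m p] space[of p T] p s r g by auto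
    have far: "z \<le> m \<or> z = p \<or> p + 10 * e < z" if "z \<in> \<Union>R" for z
      using free[OF that] space[of p z] that p by fastforce
    have X: "placed R s i m (-1) (r + of_int i * e) (r + 2 * of_int i * e) (p - e) (p - 2 * e)"
      unfolding placed_def
    proof (intro conjI ballI)
      fix z assume z: "z \<in> \<Union>R"
      show "\<not> (m < z \<and> z \<le> max (p - e) (p - 2 * e))"
        using free[OF z] e by auto
      show "\<not> (s < z \<and> z \<le> max (r + of_int i * e) (r + 2 * of_int i * e))"
        using g(3)[OF z] sp e i by auto
    qed (use s sp e g i in auto)
    have Y: "placed R s i p 1 (r + of_int i * e) (r + 2 * of_int i * e) (p + e) (p + 2 * e)"
      unfolding placed_def
    proof (intro conjI ballI)
      fix z assume z: "z \<in> \<Union>R"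
      show "\<not> (p < z \<and> z \<le> max (p + e) (p + 2 * e))"
        using far[OF z] s e by auto
      show "\<not> (s < z \<and> z \<le> max (r + of_int i * e) (r + 2 * of_int i * e))"
        using g(3)[OF z] sp e i by auto
    qed (use s sp e g i in auto)
    have "band_value R (p - e) (p - 2 * e) (r + of_int i * e) (r + 2 * of_int i * e) f"
      using v X unfolding marked_value_def by (subst band_value_commute) blast
    then have "band_value R (p + e) (p + 2 * e) (r + of_int i * e) (r + 2 * of_int i * e)
        (\<lambda>x. - f x - 2 * 1 * i * single {p, q} x)"
      by (intro double_hop[OF R c f rR e space]) (use i in auto)
    then have "band_value R (r + of_int i * e) (r + 2 * of_int i * e) (p + e) (p + 2 * e)
        (\<lambda>x. - f x - 2 * 1 * i * single {p, q} x)"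
      by (subst band_value_commute)
    then have "marked_value R s i p 1 (\<lambda>x. - f x - 2 * 1 * i * single {p, q} x)"
      by (intro marked_valueI[OF R _ i _ Y]) (use f c in \<open>auto simp: supported_def\<close>)
    from marked_swap[OF R i _ this] have "marked_value R s (- i) p (-1) (\<lambda>x. f x + 2 * i * single {p, q} x)"
      by (simp add: add.commute)
    then show ?thesis
      using rel_mult_four[OF R i c(1)]
      by (rule marked_cong[OF R, rotated 2]) (use f c in \<open>auto simp: supported_def\<close>)
  qed
  show ?thesis
  proof (cases "j = 1")
    case False
    then show ?thesis
      using minus[OF f ij(1)] v ij by auto
  next
    case True
    have i': "- i = 1 \<or> - i = -1"
      using ij by auto
    have "marked_value R s (- i) m (-1) (\<lambda>v. - f v)"
      using marked_swap[OF R ij v] True by simp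
    from minus[OF supported_uminus[OF f] i' this]
    have "marked_value R s i p (-1) (\<lambda>v. - f v + 2 * single {p, q} v)"
      by simp
    from marked_swap[OF R ij(1) _ this] True
    have "marked_value R s (- i) p j (\<lambda>v. f v + 2 * (-1) * single {p, q} v)"
      by simp
    then show ?thesis
      using rel_mult_four[OF R _ c(1), of "-1" f]
      by (rule marked_cong[OF R, rotated 2]) (use f c in \<open>auto simp: supported_def\<close>)
  qed
qed

text \<open>A gap lies after its mark, so moving it from mark \<open>s\<close> to mark
  \<open>t\<close> passes the ends in the half-open interval: the one at \<open>t\<close> but not
  the one at \<open>s\<close>. A chord with both ends there counts twice.\<close>

definition crossed :: "real set set \<Rightarrow> real \<Rightarrow> real \<Rightarrow> real set \<Rightarrow> int" where
  "crossed R s t v = (if v \<in> R then int (card (v \<inter> {s<..t})) else 0)"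

lemma supported_crossed: "supported R f \<Longrightarrow> supported R (\<lambda>v. f v + 2 * crossed R s t v)"
  by (simp add: supported_def crossed_def)

lemma crossed_none: "\<Union>R \<inter> {s<..t} = {} \<Longrightarrow> crossed R s t v = 0"
proof -
  assume *: "\<Union>R \<inter> {s<..t} = {}"
  have "v \<inter> {s<..t} = {}" if "v \<in> R"
    using * that by blast
  then show ?thesis
    by (simp add: crossed_def)
qed

lemma first_crossing:
  assumes R: "dg R" and ne: "\<Union>R \<inter> {s<..t} \<noteq> {}"
  obtains p q where "{p, q} \<in> R" "p \<noteq> q" "s < p" "p \<le> t" "\<And>z. z \<in> \<Union>R \<Longrightarrow> z \<le> s \<or> p \<le> z"
    "card (\<Union>R \<inter> {s<..t}) = Suc (card (\<Union>R \<inter> {p<..t}))"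
    "\<And>v. crossed R s t v = crossed R p t v + single {p, q} v"
proof -
  define p where "p = Min (\<Union>R \<inter> {s<..t})"
  have fin: "finite (\<Union>R \<inter> {s<..t})"
    using finite_ends[OF R] by blast
  have p: "p \<in> \<Union>R" "s < p" "p \<le> t"
    using Min_in[OF fin ne] by (auto simp: p_def)
  have min: "p \<le> z" if "z \<in> \<Union>R" "s < z" "z \<le> t" for z
    using Min_le[OF fin, of z] that by (simp add: p_def)
  obtain c where c: "c \<in> R" "p \<in> c"
    using p by blast
  have lin: "linear_diagram T R"
    by (rule dg[OF R])
  obtain q where q: "c = {p, q}" "p \<noteq> q"
  proof -
    have "card c = 2"
      using c lin by (simp add: linear_diagram_def)
    then have "card (c - {p}) = 1"
      using c(2) by simp
    then obtain q where "c - {p} = {q}"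
      by (metis card_1_singletonE)
    then have "c = {p, q}" "p \<noteq> q"
      using c(2) by auto
    then show thesis
      by (rule that)
  qed
  have split: "A \<inter> {s<..t} = (A \<inter> {p<..t}) \<union> (A \<inter> {p})" if A: "A \<subseteq> \<Union>R" for A
  proof (rule Set.set_eqI)
    fix e
    show "e \<in> A \<inter> {s<..t} \<longleftrightarrow> e \<in> (A \<inter> {p<..t}) \<union> (A \<inter> {p})"
    proof (cases "e \<in> A")
      case True
      then have "e \<in> \<Union>R"
        using A by blast
      then have "p \<le> e" if "s < e" "e \<le> t"
        using min that by blast
      then have "s < e \<and> e \<le> t \<longleftrightarrow> p < e \<and> e \<le> t \<or> e = p"
        using p(2,3) by (cases "s < e \<and> e \<le> t") auto
      then show ?thesis
        using True by simp
    qed simp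
  qed
  have card: "card (A \<inter> {s<..t}) = card (A \<inter> {p<..t}) + of_bool (p \<in> A)" if A: "A \<subseteq> \<Union>R" for A
  proof -
    have "finite A"
      using A finite_ends[OF R] finite_subset by blast
    then show ?thesis
      unfolding split[OF A] by (subst card_Un_disjoint) auto
  qed
  show thesis
  proof (rule that[of p q])
    show "z \<le> s \<or> p \<le> z" if "z \<in> \<Union>R" for z
      using min[OF that] p(3) by (metis le_cases not_le order_trans)
    show "card (\<Union>R \<inter> {s<..t}) = Suc (card (\<Union>R \<inter> {p<..t}))"
      using card[of "\<Union>R"] p by simp
    show "crossed R s t v = crossed R p t v + single {p, q} v" for v
    proof (cases "v \<in> R")
      case True
      have "disjnt v c" if "v \<noteq> c"
        using lin c(1) True that unfolding linear_diagram_def by (simp add: pairwise_def)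
      then have "v = {p, q} \<longleftrightarrow> p \<in> v"
        using c(2) q(1) by (auto simp: disjnt_def)
      then show ?thesis
        using card[OF Union_upper[OF True]] True by (simp add: crossed_def)
    next
      case False
      then show ?thesis
        using c q by (auto simp: crossed_def)
    qed
  qed (use c q p in auto)
qed

section \<open>Sliding the ends of a band past many chord ends\<close>

lemma slide_left_many:
  assumes R: "dg R" and f: "supported R f" and s: "0 \<le> s" "s \<le> s'" "s' < m" "m < T"
    and ij: "i = 1 \<or> i = -1" "j = 1 \<or> j = -1" and v: "marked_value R s i m j f"
  shows "marked_value R s' i m (j * (-1) ^ card (\<Union>R \<inter> {s<..s'})) (\<lambda>v. f v + 2 * crossed R s s' v)"
  using f s ij v
proof (induction "card (\<Union>R \<inter> {s<..s'})" arbitrary: s j f)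
  case 0
  then have none: "\<Union>R \<inter> {s<..s'} = {}"
    using finite_ends[OF R] by simp
  have "placed R s i m j a a' b b'" if "placed R s' i m j a a' b b'" for a a' b b'
    using that none 0 unfolding placed_def by fastforce
  then show ?case
    using 0 crossed_none[OF none] unfolding none marked_value_def by simp
next
  case (Suc n)
  then have "\<Union>R \<inter> {s<..s'} \<noteq> {}"
    by force
  from first_crossing[OF R this] obtain p q where p: "{p, q} \<in> R" "p \<noteq> q" "s < p" "p \<le> s'"
      "\<And>z. z \<in> \<Union>R \<Longrightarrow> z \<le> s \<or> p \<le> z" "card (\<Union>R \<inter> {s<..s'}) = Suc (card (\<Union>R \<inter> {p<..s'}))"
      "\<And>v. crossed R s s' v = crossed R p s' v + single {p, q} v"
    by metis
  have "marked_value R p i m (- j) (\<lambda>v. f v + 2 * single {p, q} v)"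
    using Suc.prems p by (intro slide_left[OF R _ p(1,2) _ p(3)]) auto
  then have "marked_value R s' i m (- j * (-1) ^ card (\<Union>R \<inter> {p<..s'}))
      (\<lambda>v. f v + 2 * single {p, q} v + 2 * crossed R p s' v)"
    using Suc.prems p Suc.hyps(2) by (intro Suc.hyps(1)) (auto simp: supported_def)
  then show ?case
    using p by (simp add: algebra_simps)
qed

lemma slide_right_many:
  assumes R: "dg R" and f: "supported R f" and s: "0 \<le> s" "s < m" "m \<le> m'" "m' < T"
    and ij: "i = 1 \<or> i = -1" "j = 1 \<or> j = -1" and v: "marked_value R s i m j f"
  shows "marked_value R s (i * (-1) ^ card (\<Union>R \<inter> {m<..m'})) m' j (\<lambda>v. f v + 2 * crossed R m m' v)"
  using f s ij v
proof (induction "card (\<Union>R \<inter> {m<..m'})" arbitrary: m i f)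
  case 0
  then have none: "\<Union>R \<inter> {m<..m'} = {}"
    using finite_ends[OF R] by simp
  then have free: "\<not> (m < z \<and> z \<le> m')" if "z \<in> \<Union>R" for z
    using that by auto
  \<comment> \<open>A band placed for the mark \<open>m'\<close> may have left ends beyond
    \<open>m\<close>, so not every such band is placed for \<open>m\<close>. One common band is
    enough by \<open>marked_valueI\<close>.\<close>
  obtain a a' b b' where X: "placed R s i m j a a' b b'" "m' < b" "m' < b'"
    using placed_exists[OF R 0(3-6) 0(7,8) free] by metis
  have "placed R s i m' j a a' b b'"
    using X 0(5) unfolding placed_def by fastforce
  then have "marked_value R s i m' j f"
    using marked_valueI[OF R 0(2) 0(7,8)] 0(9) X(1) unfolding marked_value_def by blast
  then show ?case
    using crossed_none[OF none] unfolding none by simp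
next
  case (Suc n)
  then have "\<Union>R \<inter> {m<..m'} \<noteq> {}"
    by force
  from first_crossing[OF R this] obtain p q where p: "{p, q} \<in> R" "p \<noteq> q" "m < p" "p \<le> m'"
      "\<And>z. z \<in> \<Union>R \<Longrightarrow> z \<le> m \<or> p \<le> z" "card (\<Union>R \<inter> {m<..m'}) = Suc (card (\<Union>R \<inter> {p<..m'}))"
      "\<And>v. crossed R m m' v = crossed R p m' v + single {p, q} v"
    by metis
  have "marked_value R s (- i) p j (\<lambda>v. f v + 2 * single {p, q} v)"
    using Suc.prems p by (intro slide_right[OF R _ p(1,2) _ _ p(3)]) auto
  then have "marked_value R s (- i * (-1) ^ card (\<Union>R \<inter> {p<..m'})) m' j
      (\<lambda>v. f v + 2 * single {p, q} v + 2 * crossed R p m' v)"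
    using Suc.prems p Suc.hyps(2) by (intro Suc.hyps(1)) (auto simp: supported_def)
  then show ?case
    using p by (simp add: algebra_simps)
qed

text \<open>A band right behind both ends of the chord; its first chord and \<open>{p, q}\<close>
  form an R2 pair, hence the minus sign. In the convention of \<open>placed\<close> it counts as
  crossing.\<close>

lemma marked_start:
  assumes R: "dg R" and c: "{p, q} \<in> R" "p < q"
  shows "marked_value R p 1 q 1 (\<lambda>v. - single {p, q} v)"
proof -
  have pq: "p \<in> \<Union>R" "q \<in> \<Union>R" "0 < p" "p < T" "0 < q" "q < T"
    using c ends_bounds[OF R, of p] ends_bounds[OF R, of q] by blast+
  obtain e where e: "e > 0" and space: "\<And>x y. x \<in> \<Union>R \<union> {0, T} \<Longrightarrow> y \<in> \<Union>R \<union> {0, T} \<Longrightarrow> x < y \<Longrightarrow> x + 10 * e < y"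
    using exists_spacing[of "\<Union>R \<union> {0, T}"] finite_ends[OF R]
    by (metis finite.emptyI finite_UnI finite_insert)
  have sp: "p + 10 * e < q" "q + 10 * e < T"
    using space[of p q] space[of q T] pq c by auto
  have far: "z \<le> p \<or> p + 10 * e < z" "z \<le> q \<or> q + 10 * e < z" if "z \<in> \<Union>R" for z
    using space[of p z] space[of q z] that pq by fastforce+
  have X: "placed R p 1 q 1 (p + e) (p + 2 * e) (q + e) (q + 2 * e)"
    unfolding placed_def
  proof (intro conjI ballI)
    fix z assume z: "z \<in> \<Union>R"
    show "\<not> (p < z \<and> z \<le> max (p + e) (p + 2 * e))" "\<not> (q < z \<and> z \<le> max (q + e) (q + 2 * e))"
      using far[OF z] e by auto
  qed (use sp e pq in auto)
  have ok: "band_ok T R (p + e) (p + 2 * e) (q + e) (q + 2 * e)"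
    using placed_band_ok[OF R X, of R "{}"] by simp
  define R2 where "R2 = R \<union> band (p + e) (p + 2 * e) (q + e) (q + 2 * e)"
  have ends: "z \<in> \<Union>R \<or> z = p + e \<or> z = p + 2 * e \<or> z = q + e \<or> z = q + 2 * e" if "z \<in> \<Union>R2" for z
    using that unfolding R2_def by blast
  have "rel R2 (\<lambda>v. single {p + e, q + e} v + single {p, q} v)"
  proof (rule rel_R2)
    show "dg R2"
      unfolding R2_def by (rule dg_band[OF R ok])
    show "{p + e, q + e} \<noteq> {p, q}"
      using band_notin[OF ok] c by metis
    show "between_free R2 (p + e) p"
    proof (rule between_freeI)
      fix z assume "z \<in> \<Union>R2"
      from ends[OF this] have "z \<le> p \<or> p + 10 * e < z \<or> z = p + e \<or> z = p + 2 * e \<or> z = q + e \<or> z = q + 2 * e"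
        using far(1)[of z] by blast
      then show "z \<le> min (p + e) p \<or> max (p + e) p \<le> z"
        by (elim disjE) (use e sp in linarith)+
    qed (use e in auto)
    show "between_free R2 (q + e) q"
    proof (rule between_freeI)
      fix z assume "z \<in> \<Union>R2"
      from ends[OF this] have "z \<le> q \<or> q + 10 * e < z \<or> z = p + e \<or> z = p + 2 * e \<or> z = q + e \<or> z = q + 2 * e"
        using far(2)[of z] by blast
      then show "z \<le> min (q + e) q \<or> max (q + e) q \<le> z"
        by (elim disjE) (use e sp in linarith)+
    qed (use e in auto)
  qed (use c in \<open>auto simp: R2_def\<close>)
  then have "band_value R (p + e) (p + 2 * e) (q + e) (q + 2 * e) (\<lambda>v. - single {p, q} v)"
    by (simp add: band_value_def R2_def)
  then show ?thesis
    by (intro marked_valueI[OF R _ _ _ X]) (use c in \<open>auto simp: supported_def\<close>)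
qed

text \<open>Both pairs of ends lie in one and the same gap, where \<open>m\<close> merely separates
  them, and the chords are nested. The inner chord, which is the second or the first according to
  \<open>i\<close>, is trivial by R1, and so is its R2 partner.\<close>

lemma marked_trivial:
  assumes R: "dg R" and f: "supported R f" and s: "0 \<le> s" "s < m" "m < T"
    and ij: "i = 1 \<or> i = -1" "j = - i" and v: "marked_value R s i m j f"
    and free: "\<And>z. z \<in> \<Union>R \<Longrightarrow> z \<le> s \<or> m < z"
  shows "rel R f"
proof -
  have j: "j = 1 \<or> j = -1"
    using ij by auto
  obtain a a' b b' where X: "placed R s i m j a a' b b'"
    using placed_exists[OF R s(1,2) order_refl s(3) ij(1) j] by force
  note D = placedD[OF X]
  have ok: "band_ok T R a a' b b'"
    using placed_band_ok[OF R X, of R "{}"] by simp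
  define R2 where "R2 = R \<union> band a a' b b'"
  have R2: "dg R2"
    unfolding R2_def by (rule dg_band[OF R ok])
  have ends: "z \<le> s \<or> a < z \<and> a' < z \<and> b < z \<and> b' < z \<or> z = a \<or> z = a' \<or> z = b \<or> z = b'" if "z \<in> \<Union>R2" for z
  proof (cases "z \<in> \<Union>R")
    case True
    then show ?thesis
      using free[OF True] D(12,13)[OF True] D(2-7) by linarith
  next
    case False
    then show ?thesis
      using that unfolding R2_def by blast
  qed
  have sum: "rel R2 (\<lambda>v. single {a, b} v + single {a', b'} v)"
    using ok band_notin[OF ok] by (intro rel_R2[OF R2]) (auto simp: R2_def band_ok_def)
  have one: "rel R2 (single {a, b})"
  proof (cases "i = 1")
    case True
    then have o: "a < a'" "b' < b"
      using X ij unfolding placed_def by auto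
    have "between_free R2 a' b'"
    proof (rule between_freeI)
      fix z assume "z \<in> \<Union>R2"
      from ends[OF this] show "z \<le> min a' b' \<or> max a' b' \<le> z"
        by (elim disjE conjE) (use D(2-7) o in linarith)+
    qed (use D in auto)
    then have "rel R2 (single {a', b'})"
      by (intro rel_R1[OF R2]) (simp_all add: R2_def)
    from rel_diff[OF R2 sum this] show ?thesis
      by simp
  next
    case False
    then have o: "a' < a" "b < b'"
      using X ij unfolding placed_def by auto
    have "between_free R2 a b"
    proof (rule between_freeI)
      fix z assume "z \<in> \<Union>R2"
      from ends[OF this] show "z \<le> min a b \<or> max a b \<le> z"
        by (elim disjE conjE) (use D(2-7) o in linarith)+
    qed (use D in auto)
    then show ?thesis
      by (intro rel_R1[OF R2]) (simp_all add: R2_def)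
  qed
  have "rel R2 (\<lambda>v. single {a, b} v - f v)"
    using v X unfolding marked_value_def band_value_def R2_def by blast
  from rel_diff[OF R2 one this] have "rel R2 f"
    by simp
  then show ?thesis
    using rel_band_supported[OF R ok f] by (simp add: R2_def)
qed

lemma marked_unique:
  assumes R: "dg R" and fg: "supported R f" "supported R g" and s: "0 \<le> s" "s < m" "m < T"
    and ij: "i = 1 \<or> i = -1" "j = 1 \<or> j = -1" and v: "marked_value R s i m j f" "marked_value R s i m j g"
  shows "rel R (\<lambda>v. f v - g v)"
proof -
  obtain a a' b b' where X: "placed R s i m j a a' b b'"
    using placed_exists[OF R s(1,2) order_refl s(3) ij] by force
  then show ?thesis
    using placed_band_ok[OF R X, of R "{}"] v
    by (intro band_value_unique[OF R _ fg]) (auto simp: marked_value_def)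
qed

end

section \<open>Weights on the line and the relations that produce them\<close>

definition count_below :: "real set \<Rightarrow> real \<Rightarrow> nat" where
  "count_below F t = card {e \<in> F. e < t}"

definition linear_odd :: "real set set \<Rightarrow> real set set" where
  "linear_odd R = {c \<in> R. even (\<Sum>p\<in>c. count_below (\<Union>R) p)}"

text \<open>The value \<open>val\<close> for the circle cut at 0; \<open>val_circle\<close>
  identifies the two.\<close>

definition linear_val :: "real set set \<Rightarrow> real set \<Rightarrow> int" where
  "linear_val R c = 1 + (\<Sum>p\<in>c. 2 * int (count_below (\<Union>(linear_odd R)) p) - int (count_below (\<Union>R) p mod 2))"

context linear_relations
begin

text \<open>By \<open>four_rel\<close> four times any chord is a relation, so exponents matter only
  modulo 4.\<close>

lemma rel_cong_mod4:
  assumes R: "dg R" and f: "rel R f" and fg: "\<And>v. v \<in> R \<Longrightarrow> [f v = g v] (mod 4)"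
  shows "rel R g"
proof -
  have fin: "finite R"
    using dg[OF R] by (simp add: linear_diagram_def)
  define k where "k v = (f v - g v) div 4" for v
  have k: "f v - g v = 4 * k v" if "v \<in> R" for v
    using fg[OF that] by (simp add: k_def cong_iff_dvd_diff)
  have "rel R (\<lambda>v. \<Sum>c\<in>R. k c * (4 * single c v))"
    using rel_scale[OF R four_rel[OF R]] by (intro rel_sum[OF R fin]) blast
  from rel_diff[OF R f this] show ?thesis
  proof (rule rel_cong[OF R])
    fix v assume v: "v \<in> R"
    have "(\<Sum>c\<in>R. k c * (4 * single c v)) = (\<Sum>c\<in>R. if v = c then 4 * k c else 0)"
      by (intro sum.cong) auto
    also have "\<dots> = 4 * k v"
      using fin v by simp
    finally show "f v - (\<Sum>c\<in>R. k c * (4 * single c v)) = g v"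
      using k[OF v] by simp
  qed
qed

text \<open>The exponents, modulo 4, of a band that starts along \<open>{p, q}\<close> and is slid
  behind all ends. Sliding counts the ends of \<open>v\<close> after \<open>p\<close> and after
  \<open>q\<close>; as \<open>v\<close> has two ends, the counts before them give the same modulo
  4.\<close>

definition closing_relation :: "real \<Rightarrow> real \<Rightarrow> real set \<Rightarrow> int" where
  "closing_relation p q v = - single {p, q} v + 2 * int (count_below v p) + 2 * int (count_below v q)"

text \<open>The end \<open>t\<close> itself is counted neither before nor after, which makes the
  total odd.\<close>

lemma end_count:
  assumes R: "dg R" and t: "t \<in> \<Union>R" and top: "\<And>z. z \<in> \<Union>R \<Longrightarrow> z \<le> u"
  shows "odd (card (\<Union>R \<inter> {t<..u}) + count_below (\<Union>R) t)"
    and "v \<in> R \<Longrightarrow> card (v \<inter> {t<..u}) + count_below v t + of_bool (t \<in> v) = 2"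
proof -
  have split: "card (A \<inter> {t<..u}) + count_below A t + of_bool (t \<in> A) = card A"
    if A: "A \<subseteq> \<Union>R" for A
  proof -
    have fin: "finite A"
      using A finite_ends[OF R] finite_subset by blast
    have "A = (A \<inter> {t<..u}) \<union> ({e \<in> A. e < t} \<union> A \<inter> {t})"
      using A top by force
    then have "card A = card ((A \<inter> {t<..u}) \<union> ({e \<in> A. e < t} \<union> A \<inter> {t}))"
      by simp
    also have "\<dots> = card (A \<inter> {t<..u}) + card ({e \<in> A. e < t} \<union> A \<inter> {t})"
      using fin by (intro card_Un_disjoint) auto
    also have "card ({e \<in> A. e < t} \<union> A \<inter> {t}) = card {e \<in> A. e < t} + card (A \<inter> {t})"
      using fin by (intro card_Un_disjoint) auto
    finally show ?thesis
      by (simp add: count_below_def)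
  qed
  have lin: "finite R" "disjoint R" "\<And>c. c \<in> R \<Longrightarrow> card c = 2"
    using dg[OF R] by (auto simp: linear_diagram_def)
  have "card (\<Union>R) = (\<Sum>c\<in>R. card c)"
    using lin by (intro card_Union_disjoint) (auto intro: card_ge_0_finite)
  also have "\<dots> = (\<Sum>c\<in>R. 2)"
    using lin by (intro sum.cong) auto
  finally have "even (card (\<Union>R))"
    by simp
  then show "odd (card (\<Union>R \<inter> {t<..u}) + count_below (\<Union>R) t)"
    using split[of "\<Union>R"] t by simp presburger
  show "card (v \<inter> {t<..u}) + count_below v t + of_bool (t \<in> v) = 2" if "v \<in> R"
    using split[OF Union_upper[OF that]] lin(3)[OF that] by simp
qed

text \<open>The number of ends passed on either side determines the type of the final band: by
  \<open>marked\<close> it is parallel if \<open>{p, q}\<close> is even and crossing if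
  \<open>{p, q}\<close> is odd. In the odd case its value need not vanish, so only a comparison of
  two chords is obtained.\<close>

lemma chord_relations:
  assumes R: "dg R"
  shows "{p, q} \<in> R \<Longrightarrow> p < q \<Longrightarrow> odd (count_below (\<Union>R) p + count_below (\<Union>R) q) \<Longrightarrow>
      rel R (closing_relation p q)"
    and "{p, q} \<in> R \<Longrightarrow> p < q \<Longrightarrow> even (count_below (\<Union>R) p + count_below (\<Union>R) q) \<Longrightarrow>
      {p', q'} \<in> R \<Longrightarrow> p' < q' \<Longrightarrow> even (count_below (\<Union>R) p' + count_below (\<Union>R) q') \<Longrightarrow>
      rel R (\<lambda>v. (-1) ^ count_below (\<Union>R) p * closing_relation p q v -
        (-1) ^ count_below (\<Union>R) p' * closing_relation p' q' v)"
proof -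
  \<comment> \<open>The last end, or 0 if there is none. The point \<open>u\<close> chosen below
    splits the last gap, so that the marks \<open>M\<close> and \<open>u\<close> both lie behind all
    other ends.\<close>
  define M where "M = Max (insert 0 (\<Union>R))"
  have fin: "finite (insert 0 (\<Union>R))"
    using finite_ends[OF R] by simp
  have M: "0 \<le> M" "\<And>z. z \<in> \<Union>R \<Longrightarrow> z \<le> M"
    unfolding M_def using fin by (simp_all add: Max_ge)
  have MT: "M < T" if c: "c \<in> R" for c
  proof -
    have "c \<noteq> {}"
      using dg[OF R] c unfolding linear_diagram_def by force
    then obtain z where "z \<in> \<Union>R"
      using c by blast
    then have "0 < T"
      using ends_bounds[OF R, of z] by linarith
    moreover have "M \<in> insert 0 (\<Union>R)"
      unfolding M_def using fin by (intro Max_in) auto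
    ultimately show ?thesis
      using ends_bounds[OF R, of M] by auto
  qed
  define u where "u = (M + T) / 2"
  have u: "M < u" "u < T" if "c \<in> R" for c
    using MT[OF that] by (auto simp: u_def)
  define n where "n = count_below (\<Union>R)"
  define F where "F p q = (\<lambda>v. - single {p, q} v + 2 * crossed R q u v + 2 * crossed R p M v)" for p q
  have sign: "(-1) ^ card (\<Union>R \<inter> {t<..w}) = - ((-1) ^ n t :: int)"
    if "t \<in> \<Union>R" "M \<le> w" for t w
  proof -
    have "odd (card (\<Union>R \<inter> {t<..w}) + n t)"
      unfolding n_def using that M by (intro end_count(1)[OF R that(1)]) force
    then show ?thesis
      by (cases "even (n t)") auto
  qed
  have supp: "supported R (F p q)" if "{p, q} \<in> R" for p q
    using that by (auto simp: F_def supported_def crossed_def)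
  have marked: "marked_value R M (- ((-1) ^ n q)) u (- ((-1) ^ n p)) (F p q)"
    if c: "{p, q} \<in> R" "p < q" for p q
  proof -
    have pq: "p \<in> \<Union>R" "q \<in> \<Union>R" "0 < p" "p \<le> M" "q \<le> M"
      using c ends_bounds[OF R, of p] M(2) by blast+
    have s: "supported R (\<lambda>v. - single {p, q} v)"
      using c by (auto simp: supported_def)
    \<comment> \<open>The right ends go first: the left mark must stay below the right one, which it
      would not if it were moved to \<open>M\<close> while the right mark is still
      \<open>q\<close>.\<close>
    have "marked_value R p (1 * (-1) ^ card (\<Union>R \<inter> {q<..u})) u 1 (\<lambda>v. - single {p, q} v + 2 * crossed R q u v)"
      using pq c u[OF c(1)] by (intro slide_right_many[OF R s] marked_start[OF R c]) auto
    then have "marked_value R p (- ((-1) ^ n q)) u 1 (\<lambda>v. - single {p, q} v + 2 * crossed R q u v)"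
      using sign[OF pq(2)] u[OF c(1)] by simp
    then have "marked_value R M (- ((-1) ^ n q)) u (1 * (-1) ^ card (\<Union>R \<inter> {p<..M}))
        (\<lambda>v. - single {p, q} v + 2 * crossed R q u v + 2 * crossed R p M v)"
      using pq u[OF c(1)] by (intro slide_left_many[OF R supported_crossed[OF s]]) (auto simp: minus_one_power_iff)
    then show ?thesis
      using sign[OF pq(1), of M] by (simp add: F_def)
  qed
  have F_cong: "[F p q v = closing_relation p q v] (mod 4)" if c: "{p, q} \<in> R" "p < q" and v: "v \<in> R" for p q v
  proof -
    have pq: "p \<in> \<Union>R" "q \<in> \<Union>R"
      using c by blast+
    have "card (v \<inter> {q<..u}) + count_below v q + of_bool (q \<in> v) = 2"
      using M(2) u[OF c(1)] by (intro end_count(2)[OF R pq(2) _ v]) force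
    moreover have "card (v \<inter> {p<..M}) + count_below v p + of_bool (p \<in> v) = 2"
      using M(2) by (intro end_count(2)[OF R pq(1) _ v])
    moreover have "p \<in> v \<longleftrightarrow> q \<in> v"
    proof -
      have "disjoint R"
        using dg[OF R] by (simp add: linear_diagram_def)
      then have "disjnt v {p, q}" if "v \<noteq> {p, q}"
        using pairwiseD[OF _ v c(1) that] by blast
      then show ?thesis
        by (auto simp: disjnt_def)
    qed
    ultimately have "int (card (v \<inter> {q<..u})) = 2 - int (count_below v q) - of_bool (p \<in> v)"
        "int (card (v \<inter> {p<..M})) = 2 - int (count_below v p) - of_bool (p \<in> v)"
      by (auto split: if_splits)
    then have "F p q v - closing_relation p q v = 4 * (2 - of_bool (p \<in> v) - int (count_below v p) - int (count_below v q))"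
      using v by (simp add: F_def closing_relation_def crossed_def)
    then show ?thesis
      by (simp add: cong_iff_dvd_diff)
  qed
  have pm: "- ((-1) ^ k) = (1::int) \<or> - ((-1) ^ k) = (-1::int)" for k :: nat
    by (cases "even k") auto
  show "rel R (closing_relation p q)"
    if c: "{p, q} \<in> R" "p < q" and odd: "odd (count_below (\<Union>R) p + count_below (\<Union>R) q)"
  proof -
    have "rel R (F p q)"
    proof (rule marked_trivial[OF R supp[OF c(1)] M(1) _ _ pm _ marked[OF c]])
      show "- ((-1) ^ n p) = - (- ((-1) ^ n q :: int))"
        using odd by (auto simp: n_def minus_one_power_iff)
      show "z \<le> M \<or> u < z" if "z \<in> \<Union>R" for z
        using M(2)[OF that] by blast
    qed (use u[OF c(1)] in auto)
    then show ?thesis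
      by (rule rel_cong_mod4[OF R _ F_cong[OF c]])
  qed
  show "rel R (\<lambda>v. (-1) ^ count_below (\<Union>R) p * closing_relation p q v -
        (-1) ^ count_below (\<Union>R) p' * closing_relation p' q' v)"
    if c: "{p, q} \<in> R" "p < q" and ev: "even (count_below (\<Union>R) p + count_below (\<Union>R) q)"
      and c': "{p', q'} \<in> R" "p' < q'" and ev': "even (count_below (\<Union>R) p' + count_below (\<Union>R) q')"
  proof -
    \<comment> \<open>The final crossing bands may have \<open>i = j = 1\<close> or
      \<open>i = j = -1\<close>; in the second case the chords are exchanged, which negates the
      value.\<close>
    have normal: "marked_value R M 1 u 1 (\<lambda>v. - ((-1) ^ n p) * F p q v)"
      if c: "{p, q} \<in> R" "p < q" and ev: "even (n p + n q)" for p q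
    proof (cases "even (n p)")
      case True
      then show ?thesis
        using marked_swap[OF R _ _ marked[OF c]] ev by simp
    next
      case False
      then show ?thesis
        using marked[OF c] ev by simp
    qed
    have "rel R (\<lambda>v. - ((-1) ^ n p) * F p q v - - ((-1) ^ n p') * F p' q' v)"
      using u[OF c(1)] M(1) normal c c' ev ev' supp[OF c(1)] supp[OF c'(1)]
      by (intro marked_unique[OF R, of _ _ M u 1 1]) (auto simp: n_def supported_def)
    from rel_uminus[OF R this] have "rel R (\<lambda>v. (-1) ^ n p * F p q v - (-1) ^ n p' * F p' q' v)"
      by simp
    then show ?thesis
      unfolding n_def using F_cong[OF c] F_cong[OF c']
      by (elim rel_cong_mod4[OF R]) (intro cong_diff cong_scalar_left)
  qed
qed

section \<open>Reduction of all chords to one odd chord\<close>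

lemma ordered_ends:
  assumes "dg R" "c \<in> R"
  obtains p q where "c = {p, q}" "p < q"
proof -
  have "card c = 2"
    using dg[OF assms(1)] assms(2) by (simp add: linear_diagram_def)
  then obtain x y where "c = {x, y}" "x \<noteq> y"
    by (auto simp: card_2_iff)
  then show ?thesis
    using that[of x y] that[of y x] by (metis insert_commute linorder_neqE_linordered_idom)
qed

lemma linear_odd_iff:
  "{p, q} \<in> R \<Longrightarrow> p < q \<Longrightarrow> {p, q} \<in> linear_odd R \<longleftrightarrow> even (count_below (\<Union>R) p + count_below (\<Union>R) q)"
  by (simp add: linear_odd_def)

text \<open>Doubling the closing relation makes its counts multiples of 4 and leaves only the chord
  itself.\<close>

lemma double_even:
  assumes R: "dg R" and c: "c \<in> R" "c \<notin> linear_odd R"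
  shows "rel R (\<lambda>v. 2 * single c v)"
proof -
  obtain p q where pq: "c = {p, q}" "p < q"
    using ordered_ends[OF R c(1)] by metis
  then have "rel R (closing_relation p q)"
    using chord_relations(1)[OF R] c linear_odd_iff by metis
  from rel_scale[OF R this, of 2] show ?thesis
  proof (rule rel_cong_mod4[OF R])
    fix v
    have "2 * closing_relation p q v - 2 * single c v = 4 * (int (count_below v p) + int (count_below v q) - single c v)"
      unfolding pq closing_relation_def by (simp only: algebra_simps)
    then show "[2 * closing_relation p q v = 2 * single c v] (mod 4)"
      by (simp only: cong_iff_dvd_diff dvd_triv_left)
  qed
qed

text \<open>Doubling removes the counts as in \<open>double_even\<close>, and the signs in front
  become irrelevant modulo 4.\<close>

lemma double_odd:
  assumes R: "dg R" and c: "c \<in> linear_odd R" and c': "c' \<in> linear_odd R"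
  shows "rel R (\<lambda>v. 2 * single c v - 2 * single c' v)"
proof -
  have mem: "c \<in> R" "c' \<in> R"
    using c c' by (auto simp: linear_odd_def)
  obtain p q where pq: "c = {p, q}" "p < q"
    using ordered_ends[OF R mem(1)] by metis
  obtain p' q' where pq': "c' = {p', q'}" "p' < q'"
    using ordered_ends[OF R mem(2)] by metis
  have "rel R (\<lambda>v. (-1) ^ count_below (\<Union>R) p * closing_relation p q v -
        (-1) ^ count_below (\<Union>R) p' * closing_relation p' q' v)"
    using c c' mem linear_odd_iff unfolding pq(1) pq'(1)
    by (intro chord_relations(2)[OF R _ pq(2) _ _ pq'(2)]) (metis pq(2) pq'(2))+
  from rel_scale[OF R this, of 2] show ?thesis
  proof (rule rel_cong_mod4[OF R])
    fix v
    have double: "[2 * ((-1) ^ k * closing_relation p q v) = 2 * single {p, q} v] (mod 4)" for k p q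
    proof -
      have "[2 * ((-1) ^ k * x) = 2 * x] (mod 4)" for x :: int
        by (cases "even k") (simp_all add: cong_iff_dvd_diff)
      moreover have "2 * closing_relation p q v - 2 * single {p, q} v =
          4 * (int (count_below v p) + int (count_below v q) - single {p, q} v)"
        unfolding closing_relation_def by (simp only: algebra_simps)
      then have "[2 * closing_relation p q v = 2 * single {p, q} v] (mod 4)"
        by (simp only: cong_iff_dvd_diff dvd_triv_left)
      ultimately show ?thesis
        by (rule cong_trans)
    qed
    show "[2 * ((-1) ^ count_below (\<Union>R) p * closing_relation p q v -
        (-1) ^ count_below (\<Union>R) p' * closing_relation p' q' v) = 2 * single c v - 2 * single c' v] (mod 4)"
      unfolding pq(1) pq'(1) right_diff_distrib by (intro cong_diff double)
  qed
qed

text \<open>In an expression with even exponents the even chords drop out and each odd chord may be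
  replaced by \<open>c\<close>.\<close>

lemma rel_double_sum:
  assumes R: "dg R"
  shows "linear_odd R = {} \<Longrightarrow> rel R (\<lambda>v. 2 * k v)"
    and "c \<in> linear_odd R \<Longrightarrow> rel R (\<lambda>v. 2 * k v - 2 * (\<Sum>d\<in>linear_odd R. k d) * single c v)"
proof -
  have fin: "finite R"
    using dg[OF R] by (simp add: linear_diagram_def)
  have expand: "(\<Sum>d\<in>R. k d * (2 * single d v)) = 2 * k v" if "v \<in> R" for v
  proof -
    have "(\<Sum>d\<in>R. k d * (2 * single d v)) = (\<Sum>d\<in>R. if v = d then 2 * k d else 0)"
      by (intro sum.cong) auto
    then show ?thesis
      using fin that by simp
  qed
  show "rel R (\<lambda>v. 2 * k v)" if "linear_odd R = {}"
  proof -
    have "rel R (\<lambda>v. \<Sum>d\<in>R. k d * (2 * single d v))"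
      using that rel_scale[OF R double_even[OF R]] by (intro rel_sum[OF R fin]) blast
    then show ?thesis
      by (rule rel_cong[OF R]) (rule expand)
  qed
  show "rel R (\<lambda>v. 2 * k v - 2 * (\<Sum>d\<in>linear_odd R. k d) * single c v)" if c: "c \<in> linear_odd R"
  proof -
    have "rel R (\<lambda>v. 2 * single d v - of_bool (d \<in> linear_odd R) * (2 * single c v))" if "d \<in> R" for d
      using double_even[OF R that] double_odd[OF R _ c, of d] by (cases "d \<in> linear_odd R") simp_all
    then have "rel R (\<lambda>v. \<Sum>d\<in>R. k d * (2 * single d v - of_bool (d \<in> linear_odd R) * (2 * single c v)))"
      using rel_scale[OF R] by (intro rel_sum[OF R fin]) blast
    then show ?thesis
    proof (rule rel_cong[OF R])
      fix v assume v: "v \<in> R"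
      have "(\<Sum>d\<in>R. k d * of_bool (d \<in> linear_odd R)) = (\<Sum>d\<in>R. if d \<in> linear_odd R then k d else 0)"
        by (intro sum.cong) auto
      also have "\<dots> = (\<Sum>d\<in>linear_odd R. k d)"
        using fin by (subst sum.inter_filter[symmetric]) (auto simp: linear_odd_def intro!: sum.cong)
      finally have "(\<Sum>d\<in>R. k d * (of_bool (d \<in> linear_odd R) * (2 * single c v))) =
          2 * (\<Sum>d\<in>linear_odd R. k d) * single c v"
        by (simp only: mult.assoc[symmetric] sum_distrib_right[symmetric])
      then show "(\<Sum>d\<in>R. k d * (2 * single d v - of_bool (d \<in> linear_odd R) * (2 * single c v))) =
          2 * k v - 2 * (\<Sum>d\<in>linear_odd R. k d) * single c v"
        unfolding right_diff_distrib sum_subtractf expand[OF v] by simp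
    qed
  qed
qed

lemma sum_count_below:
  assumes R: "dg R"
  shows "(\<Sum>d\<in>linear_odd R. int (count_below d t)) = int (count_below (\<Union>(linear_odd R)) t)"
proof -
  have lin: "finite R" "disjoint R" "\<And>c. c \<in> R \<Longrightarrow> card c = 2"
    using dg[OF R] by (auto simp: linear_diagram_def)
  have sub: "linear_odd R \<subseteq> R"
    by (auto simp: linear_odd_def)
  have "{e \<in> \<Union>(linear_odd R). e < t} = (\<Union>d\<in>linear_odd R. {e \<in> d. e < t})"
    by blast
  moreover have "card (\<Union>d\<in>linear_odd R. {e \<in> d. e < t}) = (\<Sum>d\<in>linear_odd R. card {e \<in> d. e < t})"
  proof (rule card_UN_disjoint)
    show "finite (linear_odd R)"
      using sub lin(1) finite_subset by blast
    show "\<forall>i\<in>linear_odd R. finite {e \<in> i. e < t}"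
    proof
      fix d assume "d \<in> linear_odd R"
      then have "finite d"
        using lin(3)[of d] sub by (intro card_ge_0_finite) auto
      then show "finite {e \<in> d. e < t}"
        by simp
    qed
    show "\<forall>i\<in>linear_odd R. \<forall>j\<in>linear_odd R. i \<noteq> j \<longrightarrow> {e \<in> i. e < t} \<inter> {e \<in> j. e < t} = {}"
      using sub lin(2) unfolding pairwise_def disjnt_def by blast
  qed
  ultimately show ?thesis
    by (simp add: count_below_def)
qed

text \<open>Summing, over the odd chords, the numbers of their ends before a point gives the number
  of odd ends there. This is how the term with \<open>o\<close> in the weight arises.\<close>

lemma closing_reduced:
  assumes R: "dg R" and c0: "c0 \<in> linear_odd R"
  shows "rel R (\<lambda>v. closing_relation p q v - (- single {p, q} v +
    2 * int (count_below (\<Union>(linear_odd R)) p + count_below (\<Union>(linear_odd R)) q) * single c0 v))"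
proof -
  have "(\<Sum>d\<in>linear_odd R. int (count_below d p) + int (count_below d q)) =
      int (count_below (\<Union>(linear_odd R)) p + count_below (\<Union>(linear_odd R)) q)"
    using sum_count_below[OF R] by (simp add: sum.distrib)
  then have "rel R (\<lambda>v. 2 * (int (count_below v p) + int (count_below v q)) -
      2 * int (count_below (\<Union>(linear_odd R)) p + count_below (\<Union>(linear_odd R)) q) * single c0 v)"
    using rel_double_sum(2)[OF R c0, of "\<lambda>v. int (count_below v p) + int (count_below v q)"] by simp
  then show ?thesis
    by (rule rel_cong[OF R]) (simp add: closing_relation_def algebra_simps)
qed

text \<open>An odd number is its own inverse modulo 4, so the exponent is the quotient of the two
  values; written as a product of two values it is insensitive to a common sign of all
  values.\<close>

lemma linear_universal:
  assumes R: "dg R" and c: "c \<in> R"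
  shows "linear_odd R = {} \<Longrightarrow> rel R (single c)"
    and "c0 \<in> linear_odd R \<Longrightarrow> rel R (\<lambda>v. single c v - linear_val R c * linear_val R c0 * single c0 v)"
proof -
  define n ob where "n = count_below (\<Union>R)" and "ob = count_below (\<Union>(linear_odd R))"
  obtain p q where pq: "c = {p, q}" "p < q"
    using ordered_ends[OF R c] by metis
  have odd_iff: "c \<in> linear_odd R \<longleftrightarrow> even (n p + n q)"
    using linear_odd_iff c pq by (simp add: n_def)
  have val: "linear_val R c = 1 + (2 * int (ob p) - int (n p mod 2)) + (2 * int (ob q) - int (n q mod 2))"
    using pq by (simp add: linear_val_def n_def ob_def)
  show "rel R (single c)" if none: "linear_odd R = {}"
  proof -
    have "rel R (closing_relation p q)"
      using chord_relations(1)[OF R] c pq odd_iff none by (simp add: n_def)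
    from rel_diff[OF R rel_double_sum(1)[OF R none, of "\<lambda>v. int (count_below v p) + int (count_below v q)"] this]
    show ?thesis
      by (simp add: closing_relation_def pq algebra_simps)
  qed
  show "rel R (\<lambda>v. single c v - linear_val R c * linear_val R c0 * single c0 v)" if c0: "c0 \<in> linear_odd R"
  proof -
    have c0R: "c0 \<in> R"
      using c0 by (simp add: linear_odd_def)
    obtain p0 q0 where pq0: "c0 = {p0, q0}" "p0 < q0"
      using ordered_ends[OF R c0R] by metis
    have ev0: "even (n p0 + n q0)"
      using linear_odd_iff c0R c0 pq0 by (simp add: n_def)
    have val0: "linear_val R c0 = 1 + (2 * int (ob p0) - int (n p0 mod 2)) + (2 * int (ob q0) - int (n q0 mod 2))"
      using pq0 by (simp add: linear_val_def n_def ob_def)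
    define x x0 where "x = int (ob p + ob q)" and "x0 = int (ob p0 + ob q0)"
    have red: "rel R (\<lambda>v. closing_relation p q v - (- single c v + 2 * x * single c0 v))"
        "rel R (\<lambda>v. closing_relation p0 q0 v - (- single c0 v + 2 * x0 * single c0 v))"
      using closing_reduced[OF R c0] unfolding x_def x0_def ob_def pq(1) pq0(1) by blast+
    show ?thesis
    proof (cases "c \<in> linear_odd R")
      case False
      then have "rel R (closing_relation p q)"
        using chord_relations(1)[OF R] c pq odd_iff by (simp add: n_def)
      from rel_diff[OF R red(1) this] have "rel R (\<lambda>v. single c v - 2 * x * single c0 v)"
        by (simp add: algebra_simps)
      moreover have "[2 * x = linear_val R c * linear_val R c0] (mod 4)"
      proof -
        have "linear_val R c = 2 * x"
          using False odd_iff unfolding val x_def by (auto simp: mod2_eq_if)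
        moreover have "odd (linear_val R c0)"
          using ev0 unfolding val0 by (auto simp: mod2_eq_if)
        then obtain k where "linear_val R c0 = 2 * k + 1"
          by (auto elim: oddE)
        ultimately have "2 * x - linear_val R c * linear_val R c0 = 4 * (- (x * k))"
          by (simp add: algebra_simps)
        then show ?thesis
          by (simp only: cong_iff_dvd_diff dvd_triv_left)
      qed
      then have "[single c v - 2 * x * single c0 v = single c v - linear_val R c * linear_val R c0 * single c0 v] (mod 4)" for v
        by (intro cong_diff cong_refl cong_scalar_right)
      ultimately show ?thesis
        by (rule rel_cong_mod4[OF R])
    next
      case True
      \<comment> \<open>The sign that the parity terms leave in an odd value:
        \<open>linear_val R c = 2 * x + s\<close>, and likewise for \<open>c0\<close>.\<close>
      define s s0 :: int where "s = (-1) ^ n p" and "s0 = (-1) ^ n p0"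
      have sgn: "s = 1 \<or> s = -1" "s0 = 1 \<or> s0 = -1"
        unfolding s_def s0_def by (cases "even (n p)"; simp) (cases "even (n p0)"; simp)
      have "rel R (\<lambda>v. s * closing_relation p q v - s0 * closing_relation p0 q0 v)"
        using chord_relations(2)[OF R, of p q p0 q0] c c0R pq pq0 odd_iff True ev0
        by (simp add: n_def s_def s0_def)
      from rel_diff[OF R rel_diff[OF R rel_scale[OF R red(1), of s] rel_scale[OF R red(2), of s0]] this]
      have "rel R (\<lambda>v. s * (single c v - 2 * x * single c0 v) - s0 * (1 - 2 * x0) * single c0 v)"
        by (simp add: algebra_simps)
      from rel_scale[OF R this, of s]
      have "rel R (\<lambda>v. single c v - 2 * x * single c0 v - s * s0 * (1 - 2 * x0) * single c0 v)"
        using sgn(1) by (auto simp: algebra_simps)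
      moreover have "[2 * x + s * s0 * (1 - 2 * x0) = linear_val R c * linear_val R c0] (mod 4)"
      proof -
        have "linear_val R c = 2 * x + s" "linear_val R c0 = 2 * x0 + s0"
          using True odd_iff ev0 unfolding val val0 x_def x0_def s_def s0_def
          by (auto simp: mod2_eq_if)
        \<comment> \<open>Apart from \<open>4 * x * x0\<close> there are terms with the factors
          \<open>1 - s0\<close> and \<open>s0 + 1\<close>, one of which is 0 and the other
          2.\<close>
        moreover have "\<exists>k. 2 * x + s * s0 * (1 - 2 * x0) - (2 * x + s) * (2 * x0 + s0) = 4 * k"
        proof -
          have "2 * x + s * s0 * (1 - 2 * x0) - (2 * x + s) * (2 * x0 + s0) =
              2 * (1 - s0) * x - 2 * s * (s0 + 1) * x0 - 4 * x * x0"
            by (simp add: algebra_simps)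
          also have "\<dots> = 4 * ((if s0 = 1 then 0 else x) - (if s0 = 1 then s * x0 else 0) - x * x0)"
            using sgn(2) by auto
          finally show ?thesis
            by blast
        qed
        ultimately show ?thesis
          by (auto simp: cong_iff_dvd_diff)
      qed
      then have "[single c v - (2 * x + s * s0 * (1 - 2 * x0)) * single c0 v =
          single c v - linear_val R c * linear_val R c0 * single c0 v] (mod 4)" for v
        by (intro cong_diff cong_refl cong_scalar_right)
      then have "[single c v - 2 * x * single c0 v - s * s0 * (1 - 2 * x0) * single c0 v =
          single c v - linear_val R c * linear_val R c0 * single c0 v] (mod 4)" for v
        by (simp add: algebra_simps)
      ultimately show ?thesis
        by (rule rel_cong_mod4[OF R])
    qed
  qed
qed

end

section \<open>Universality\<close>

definition relation :: "('g, 'b) monoid_scheme \<Rightarrow> ('c \<Rightarrow> 'g) \<Rightarrow> 'c set \<Rightarrow> ('c \<Rightarrow> int) \<Rightarrow> bool" where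
  "relation G x A f \<longleftrightarrow> finprod G (\<lambda>v. x v [^]\<^bsub>G\<^esub> f v) A = \<one>\<^bsub>G\<^esub>"

context comm_group
begin

lemma finprod_pow_add:
  assumes x: "x \<in> A \<rightarrow> carrier G"
  shows "finprod G (\<lambda>v. x v [^] (f v + g v :: int)) A =
    finprod G (\<lambda>v. x v [^] f v) A \<otimes> finprod G (\<lambda>v. x v [^] g v) A"
proof -
  have c: "(\<lambda>v. x v [^] h v) \<in> A \<rightarrow> carrier G" for h :: "_ \<Rightarrow> int"
    using x by auto
  show ?thesis
    unfolding finprod_multf[OF c c, symmetric]
    using x by (intro finprod_cong') (auto simp: int_pow_mult Pi_iff)
qed

lemma relation_diff:
  assumes x: "x \<in> A \<rightarrow> carrier G" and f: "relation G x A f" and g: "relation G x A g"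
  shows "relation G x A (\<lambda>v. f v - g v)"
proof -
  have "(\<lambda>v. x v [^] (f v - g v)) \<in> A \<rightarrow> carrier G"
    using x by auto
  moreover have "finprod G (\<lambda>v. x v [^] (f v - g v + g v)) A = \<one>"
    using f by (simp add: relation_def)
  ultimately show ?thesis
    using g unfolding finprod_pow_add[OF x] relation_def by simp
qed

lemma relation_zero: "relation G x A (\<lambda>v. 0)"
  by (simp add: relation_def)

lemma relation_cong:
  assumes x: "x \<in> A \<rightarrow> carrier G" and f: "relation G x A f" and fg: "\<And>v. v \<in> A \<Longrightarrow> f v = g v"
  shows "relation G x A g"
proof -
  have "finprod G (\<lambda>v. x v [^] g v) A = finprod G (\<lambda>v. x v [^] f v) A"
    using x fg by (intro finprod_cong') auto
  then show ?thesis
    using f by (simp add: relation_def)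
qed

lemma finprod_pow_single:
  assumes x: "x \<in> A \<rightarrow> carrier G" and A: "finite A" "c \<in> A"
  shows "finprod G (\<lambda>v. x v [^] (k * of_bool (v = c) :: int)) A = x c [^] k"
proof -
  have xc: "x c \<in> carrier G"
    using x A by auto
  have "finprod G (\<lambda>v. x v [^] (k * of_bool (v = c) :: int)) A =
      finprod G (\<lambda>v. if v = c then x v [^] k else \<one>) A"
    using x by (intro finprod_cong') (auto simp: int_pow_closed[OF xc])
  also have "\<dots> = x c [^] k"
    using x A by (intro finprod_singleton_swap) auto
  finally show ?thesis .
qed

lemma int_pow_cong_mod4:
  assumes x: "x \<in> carrier G" "x [^] (4::int) = \<one>" and ab: "[a = b] (mod 4)"
  shows "x [^] (a::int) = x [^] b"
proof -
  obtain k where "a - b = 4 * k"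
    using ab by (auto simp: cong_iff_dvd_diff elim: dvdE)
  then have "a = 4 * k + b"
    by simp
  moreover have "x [^] (4 * k) = (x [^] (4::int)) [^] k"
    by (rule int_pow_pow[OF x(1), symmetric])
  ultimately have "x [^] a = (x [^] (4::int)) [^] k \<otimes> x [^] b"
    using int_pow_mult[OF x(1), of "4 * k" b] by simp
  then show ?thesis
    using x by simp
qed

end

text \<open>The domain is a subgroup containing all \<open>x v\<close>, hence also the product of
  their powers, and there the map is an injective homomorphism. Injectivity gives the direction back
  from \<open>H\<close> to \<open>G\<close>, on which the removal of bands rests.\<close>

lemma partial_iso_relation:
  assumes G: "comm_group G" and H: "comm_group H" and m: "partial_iso G H m"
    and A: "finite A" and xy: "\<And>v. v \<in> A \<Longrightarrow> m (x v) = Some (y v)"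
  shows "relation G x A f \<longleftrightarrow> relation H y A f"
proof -
  interpret G: comm_group G by fact
  interpret H: comm_group H by fact
  have sub: "subgroup (dom m) G" and subH: "subgroup (ran m) H"
    and iso: "(\<lambda>x. the (m x)) \<in> iso (G\<lparr>carrier := dom m\<rparr>) (H\<lparr>carrier := ran m\<rparr>)"
    using m by (auto simp: partial_iso_def)
  define h where "h = (\<lambda>x. the (m x))"
  have S: "group (G\<lparr>carrier := dom m\<rparr>)"
    using sub by (rule G.subgroup_imp_group)
  have inj: "inj_on h (dom m)"
    using iso by (auto simp: iso_def bij_betw_def h_def)
  have mult: "h (a \<otimes>\<^bsub>G\<^esub> b) = h a \<otimes>\<^bsub>H\<^esub> h b" if "a \<in> dom m" "b \<in> dom m" for a b
    using iso that by (auto simp: iso_def hom_def h_def)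
  have "h \<in> dom m \<rightarrow> carrier H"
    using iso subgroup.subset[OF subH] by (auto simp: iso_def hom_def h_def)
  then interpret hom: group_hom "G\<lparr>carrier := dom m\<rparr>" H h
    using S H.is_group mult by (intro group_hom.intro group_hom_axioms.intro) (auto simp: hom_def)
  have xd: "x v \<in> dom m" "h (x v) = y v" if "v \<in> A" for v
    using xy[OF that] by (auto simp: h_def)
  have xG: "x v \<in> carrier G" if "v \<in> A" for v
    using xd(1)[OF that] subgroup.subset[OF sub] by blast
  have yH: "y v \<in> carrier H" if "v \<in> A" for v
    using xd[OF that] hom.hom_closed[of "x v"] by auto
  have pow: "x v [^]\<^bsub>G\<^esub> k \<in> dom m" "h (x v [^]\<^bsub>G\<^esub> k) = y v [^]\<^bsub>H\<^esub> k" if v: "v \<in> A" for v and k :: int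
  proof -
    show "x v [^]\<^bsub>G\<^esub> k \<in> dom m"
      by (rule G.subgroup_int_pow_closed[OF sub xd(1)[OF v]])
    show "h (x v [^]\<^bsub>G\<^esub> k) = y v [^]\<^bsub>H\<^esub> k"
      using hom.hom_int_pow[of "x v" k] xd[OF v] G.int_pow_consistent[OF sub xd(1)[OF v], of k] by simp
  qed
  have "finprod G (\<lambda>v. x v [^]\<^bsub>G\<^esub> f v) B \<in> dom m \<and>
      h (finprod G (\<lambda>v. x v [^]\<^bsub>G\<^esub> f v) B) = finprod H (\<lambda>v. y v [^]\<^bsub>H\<^esub> f v) B" if "B \<subseteq> A" for B
    using finite_subset[OF that A] that
  proof (induction B rule: finite_induct)
    case empty
    then show ?case
      using subgroup.one_closed[OF sub] hom.hom_one by simp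
  next
    case (insert v B)
    then have v: "v \<in> A" and B: "B \<subseteq> A"
      by auto
    have "(\<lambda>v. x v [^]\<^bsub>G\<^esub> f v) \<in> B \<rightarrow> carrier G" "(\<lambda>v. y v [^]\<^bsub>H\<^esub> f v) \<in> B \<rightarrow> carrier H"
      using xG yH B by auto
    then show ?case
      using insert.IH[OF B] insert.hyps pow[OF v] xG[OF v] yH[OF v] mult subgroup.m_closed[OF sub] by simp
  qed
  then have "finprod G (\<lambda>v. x v [^]\<^bsub>G\<^esub> f v) A \<in> dom m"
      "h (finprod G (\<lambda>v. x v [^]\<^bsub>G\<^esub> f v) A) = finprod H (\<lambda>v. y v [^]\<^bsub>H\<^esub> f v) A"
    by auto
  moreover have "h \<one>\<^bsub>G\<^esub> = \<one>\<^bsub>H\<^esub>" "\<one>\<^bsub>G\<^esub> \<in> dom m"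
    using hom.hom_one subgroup.one_closed[OF sub] by auto
  ultimately show ?thesis
    unfolding relation_def using inj_on_eq_iff[OF inj, of "finprod G (\<lambda>v. x v [^]\<^bsub>G\<^esub> f v) A" "\<one>\<^bsub>G\<^esub>"]
    by simp
qed

section \<open>Drawing linear diagrams on the core circle\<close>

definition circle_point :: "complex \<Rightarrow> real \<Rightarrow> complex" where
  "circle_point r t = r * exp (\<i> * of_real t)"

abbreviation circle_diagram :: "complex \<Rightarrow> real set set \<Rightarrow> diagram" where
  "circle_diagram r \<equiv> (`) ((`) (circle_point r))"

lemma circle_point_core: "r \<in> core \<Longrightarrow> circle_point r t \<in> core"
  by (simp add: circle_point_def norm_mult)

lemma ang_circle_point: "r \<in> core \<Longrightarrow> 0 \<le> t \<Longrightarrow> t < 2 * pi \<Longrightarrow> ang r (circle_point r t) = t"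
  unfolding ang_def circle_point_def by (rule Arg2pi_unique[of 1]) (auto simp: core_nonzero)

lemma circle_point_ang: "r \<in> core \<Longrightarrow> z \<in> core \<Longrightarrow> circle_point r (ang r z) = z"
  by (simp add: circle_point_def exp_ang)

lemma inj_circle_point: "r \<in> core \<Longrightarrow> inj_on (circle_point r) {0<..<2 * pi}"
  using ang_circle_point[of r] by (intro inj_on_inverseI[of _ "ang r"]) auto

lemma adj_adjacent:
  assumes D: "chord_diagram D" and r: "r \<in> core" and uv: "adj r D u v"
  shows "adjacent D u v"
proof -
  have core: "u \<in> core" "v \<in> core"
    using chord_ends_subset_core[OF D] uv by (auto simp: adj_def)
  have next_end: "next_end D x y" if "adj r D x y" "ang r x < ang r y" "x \<in> core" "y \<in> core" for x y
    using that in_open_arc_iff[OF r that(3,4)] unfolding next_end_def adj_def by auto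
  have "ang r u \<noteq> ang r v"
    using ang_inj[OF r core] uv by (simp add: adj_def)
  then show ?thesis
    using next_end[OF uv _ core] next_end[OF uv[THEN adj_commute[THEN iffD1]] _ core(2,1)]
    unfolding adjacent_def by linarith
qed

locale based_diagrams =
  fixes r :: complex and R :: "real set set"
  assumes r: "r \<in> core" and lin: "linear_diagram (2 * pi) R"
begin

lemma ends_range: "z \<in> \<Union>R \<Longrightarrow> 0 < z \<and> z < 2 * pi"
  using lin unfolding linear_diagram_def by fastforce

lemma ends_image: "chord_ends (circle_diagram r R) = circle_point r ` \<Union>R"
  by blast

lemma ang_end: "z \<in> \<Union>R \<Longrightarrow> ang r (circle_point r z) = z"
  using ends_range[of z] by (intro ang_circle_point[OF r]) auto

lemma inj_ends: "inj_on (circle_point r) (\<Union>R)"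
proof (rule inj_on_subset[OF inj_circle_point[OF r]])
  show "\<Union>R \<subseteq> {0<..<2 * pi}"
    using ends_range by (metis greaterThanLessThan_iff subsetI)
qed

lemma inj_chords: "inj_on ((`) (circle_point r)) R"
proof (rule inj_onI)
  fix c d assume "c \<in> R" "d \<in> R" "circle_point r ` c = circle_point r ` d"
  then show "c = d"
    using inj_on_image_eq_iff[OF inj_ends, of c d] by (simp add: Union_upper)
qed

lemma chord_diagram_circle: "chord_diagram (circle_diagram r R)"
  unfolding chord_diagram_def pairwise_def
proof (intro conjI ballI impI)
  show "finite (circle_diagram r R)"
    using lin by (simp add: linear_diagram_def)
next
  fix c assume "c \<in> circle_diagram r R"
  then obtain d where d: "d \<in> R" "c = circle_point r ` d"
    by blast
  show "c \<subseteq> core"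
    using d circle_point_core[OF r] by blast
  have "card c = card d"
    unfolding d(2) by (rule card_image[OF inj_on_subset[OF inj_ends Union_upper[OF d(1)]]])
  then show "card c = 2"
    using lin d(1) by (simp add: linear_diagram_def)
next
  fix x y assume "x \<in> circle_diagram r R" "y \<in> circle_diagram r R" "x \<noteq> y"
  then obtain c d where cd: "c \<in> R" "x = circle_point r ` c" "d \<in> R" "y = circle_point r ` d" "c \<noteq> d"
    by blast
  then have "c \<inter> d = {}"
    using lin unfolding linear_diagram_def pairwise_def disjnt_def by blast
  then show "disjnt x y"
    unfolding disjnt_def cd(2,4)
    using inj_on_image_Int[OF inj_ends Union_upper[OF cd(1)] Union_upper[OF cd(3)]] by simp
qed

lemma between_free_adj:
  assumes "u \<in> \<Union>R" "v \<in> \<Union>R" "between_free R u v"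
  shows "adj r (circle_diagram r R) (circle_point r u) (circle_point r v)"
proof -
  have "circle_point r u \<noteq> circle_point r v"
    using inj_onD[OF inj_ends] assms unfolding between_free_def by blast
  then show ?thesis
    using assms ang_end unfolding adj_def ends_image between_free_def by auto
qed

lemma between_free_adjacent:
  "u \<in> \<Union>R \<Longrightarrow> v \<in> \<Union>R \<Longrightarrow> between_free R u v \<Longrightarrow>
    adjacent (circle_diagram r R) (circle_point r u) (circle_point r v)"
  using adj_adjacent[OF chord_diagram_circle r between_free_adj] .

lemma next_end_iff_dir:
  assumes "u \<in> \<Union>R" "v \<in> \<Union>R" "between_free R u v" "z \<in> \<Union>R" "z \<noteq> u" "z \<noteq> v"
  shows "next_end (circle_diagram r R) (circle_point r u) (circle_point r v) \<longleftrightarrow> u < v"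
proof -
  have "circle_point r z \<noteq> circle_point r u" "circle_point r z \<noteq> circle_point r v"
    using inj_onD[OF inj_ends] assms by blast+
  moreover have "circle_point r z \<in> chord_ends (circle_diagram r R)"
    using assms unfolding ends_image by blast
  ultimately show ?thesis
    using next_end_iff_less[OF chord_diagram_circle r between_free_adj[OF assms(1-3)]] ang_end assms by metis
qed

lemma count_below_circle:
  assumes "F \<subseteq> \<Union>R" "t \<in> \<Union>R"
  shows "below r (circle_point r ` F) (circle_point r t) = count_below F t"
proof -
  have "{e \<in> circle_point r ` F. ang r e < ang r (circle_point r t)} = circle_point r ` {e \<in> F. e < t}"
  proof (rule Set.set_eqI)
    fix x
    show "x \<in> {e \<in> circle_point r ` F. ang r e < ang r (circle_point r t)} \<longleftrightarrow> x \<in> circle_point r ` {e \<in> F. e < t}"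
    proof (cases "x \<in> circle_point r ` F")
      case True
      then obtain e where e: "e \<in> F" "x = circle_point r e"
        by blast
      then have eR: "e \<in> \<Union>R"
        using assms by blast
      have "x \<in> circle_point r ` {e \<in> F. e < t} \<longleftrightarrow> e < t"
        using inj_on_image_mem_iff[OF inj_ends eR, of "{e \<in> F. e < t}"] assms(1) e by auto
      then show ?thesis
        using True e(2) ang_end[OF eR] ang_end[OF assms(2)] by simp
    qed blast
  qed
  moreover have "card (circle_point r ` {e \<in> F. e < t}) = card {e \<in> F. e < t}"
    using assms(1) by (intro card_image inj_on_subset[OF inj_ends]) auto
  ultimately show ?thesis
    by (simp add: below_def count_below_def)
qed

lemma doubleton_chord:
  assumes "c \<in> R"
  obtains p q where "c = {p, q}" "p \<noteq> q" "p \<in> \<Union>R" "q \<in> \<Union>R" "circle_point r p \<noteq> circle_point r q"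
proof -
  have "card c = 2"
    using assms lin by (simp add: linear_diagram_def)
  then obtain p q where pq: "c = {p, q}" "p \<noteq> q"
    by (auto simp: card_2_iff)
  then have "p \<in> \<Union>R" "q \<in> \<Union>R"
    using assms by blast+
  then show ?thesis
    using that[of p q] pq inj_onD[OF inj_ends, of p q] by blast
qed

lemma odd_chords_circle: "odd_chords (circle_diagram r R) = circle_diagram r (linear_odd R)"
proof -
  have "circle_point r ` c \<in> odd_chords (circle_diagram r R) \<longleftrightarrow> c \<in> linear_odd R" if c: "c \<in> R" for c
  proof -
    obtain p q where pq: "c = {p, q}" "p \<noteq> q" "p \<in> \<Union>R" "q \<in> \<Union>R" "circle_point r p \<noteq> circle_point r q"
      using doubleton_chord[OF c] by metis
    have "circle_point r ` c = {circle_point r p, circle_point r q}"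
      using pq by simp
    moreover have "circle_point r ` c \<in> circle_diagram r R"
      using c by blast
    ultimately show ?thesis
      using odd_chords_iff[OF chord_diagram_circle r _ pq(5)] count_below_circle[OF order_refl] pq c
      unfolding ends_image by (simp add: linear_odd_def)
  qed
  then show ?thesis
    using odd_chords_subset[of "circle_diagram r R"] unfolding linear_odd_def by blast
qed

lemma val_circle:
  assumes c: "c \<in> R"
  shows "val r (circle_diagram r R) (circle_point r ` c) = linear_val R c"
proof -
  obtain p q where pq: "c = {p, q}" "p \<noteq> q" "p \<in> \<Union>R" "q \<in> \<Union>R" "circle_point r p \<noteq> circle_point r q"
    using doubleton_chord[OF c] by metis
  have odd: "odd_ends (circle_diagram r R) = circle_point r ` \<Union>(linear_odd R)"
    unfolding odd_chords_circle by (simp only: image_Union)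
  have "\<Union>(linear_odd R) \<subseteq> \<Union>R"
    by (auto simp: linear_odd_def)
  then have "wt r (circle_diagram r R) (circle_point r t) =
      2 * int (count_below (\<Union>(linear_odd R)) t) - int (count_below (\<Union>R) t mod 2)" if "t \<in> \<Union>R" for t
    unfolding wt_def odd ends_image using count_below_circle[OF _ that] by simp
  then show ?thesis
    using pq by (simp add: val_doubleton linear_val_def)
qed

end

lemma linear_diagram_band:
  assumes R: "linear_diagram T R" and ok: "band_ok T R a a' b b'"
  shows "linear_diagram T (R \<union> band a a' b b')"
proof -
  have ok': "distinct [a, a', b, b']" "{a, a', b, b'} \<subseteq> {0<..<T}" "{a, a', b, b'} \<inter> \<Union>R = {}"
    using ok by (auto simp: band_ok_def)
  show ?thesis
    unfolding linear_diagram_def pairwise_def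
  proof (intro conjI ballI impI)
    show "finite (R \<union> band a a' b b')"
      using R by (simp add: linear_diagram_def)
  next
    fix c assume "c \<in> R \<union> band a a' b b'"
    then have "c \<in> R \<or> c = {a, b} \<or> c = {a', b'}"
      by blast
    then show "c \<subseteq> {0<..<T}" "card c = 2"
      using R ok'(1,2) unfolding linear_diagram_def by (elim disjE; simp)+
  next
    fix c d assume cd: "c \<in> R \<union> band a a' b b'" "d \<in> R \<union> band a a' b b'" "c \<noteq> d"
    have new: "x \<subseteq> {a, a', b, b'}" if "x \<in> band a a' b b'" for x
      using that by auto
    show "disjnt c d"
    proof (cases "c \<in> R"; cases "d \<in> R")
      assume "c \<in> R" "d \<in> R"
      then show ?thesis
        using R cd(3) unfolding linear_diagram_def pairwise_def by blast
    next
      assume "c \<in> R" "d \<notin> R"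
      then show ?thesis
        using new[of d] cd(2) ok'(3) unfolding disjnt_def by blast
    next
      assume "c \<notin> R" "d \<in> R"
      then show ?thesis
        using new[of c] cd(1) ok'(3) unfolding disjnt_def by blast
    next
      assume "c \<notin> R" "d \<notin> R"
      then have "c = {a, b} \<and> d = {a', b'} \<or> c = {a', b'} \<and> d = {a, b}"
        using cd by blast
      then show ?thesis
        using ok'(1) by (auto simp: disjnt_def)
    qed
  qed
qed

section \<open>Parity functors as models of the linear relations\<close>

lemma functor_facts:
  assumes "oriented_parity_functor K G M P" "D \<in> K"
  shows "comm_group (G D)" "v \<in> D \<Longrightarrow> P D v \<in> carrier (G D)"
    and "elementary D f \<Longrightarrow> chord_diagram (target D f) \<Longrightarrow> partial_iso (G D) (G (target D f)) (M D [f])"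
    and "elementary D f \<Longrightarrow> push D f v = Some v' \<Longrightarrow> M D [f] (P D v) = Some (P (target D f) v')"
    and "elementary D (R1_dec v) \<Longrightarrow> P D v = \<one>\<^bsub>G D\<^esub>"
    and "v \<noteq> w \<Longrightarrow> elementary D (R2_dec {v, w}) \<Longrightarrow> P D v \<otimes>\<^bsub>G D\<^esub> P D w = \<one>\<^bsub>G D\<^esub>"
    and "R3_triangle D a1 b1 b2 c2 c3 a3 \<Longrightarrow>
        P D {a1, a3} [^]\<^bsub>G D\<^esub> chord_sign D c3 a3 a1 b1 \<otimes>\<^bsub>G D\<^esub>
        P D {b1, b2} [^]\<^bsub>G D\<^esub> chord_sign D a1 b1 b2 c2 \<otimes>\<^bsub>G D\<^esub>
        P D {c2, c3} [^]\<^bsub>G D\<^esub> chord_sign D b2 c2 c3 a3 = \<one>\<^bsub>G D\<^esub>"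
proof -
  note F = assms(1)[unfolded oriented_parity_functor_def diagram_functor_def]
  note C = F[THEN conjunct1]
  note P = F[THEN conjunct2]
  show "comm_group (G D)"
    by (rule C[THEN conjunct1, rule_format, OF assms(2)])
  show "P D v \<in> carrier (G D)" if "v \<in> D"
    by (rule P[THEN conjunct1, rule_format, OF assms(2) that])
  show "partial_iso (G D) (G (target D f)) (M D [f])" if f: "elementary D f" "chord_diagram (target D f)"
  proof -
    have "morphism D [f]"
      using f by simp
    from C[THEN conjunct2, THEN conjunct1, rule_format, OF assms(2) this] show ?thesis
      by simp
  qed
  show "M D [f] (P D v) = Some (P (target D f) v')" if "elementary D f" "push D f v = Some v'"
    by (rule P[THEN conjunct2, THEN conjunct1, rule_format, OF assms(2) conjI[OF that]])
  show "P D v = \<one>\<^bsub>G D\<^esub>" if "elementary D (R1_dec v)"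
    by (rule P[THEN conjunct2, THEN conjunct2, THEN conjunct1, rule_format, OF assms(2) that])
  show "P D v \<otimes>\<^bsub>G D\<^esub> P D w = \<one>\<^bsub>G D\<^esub>" if "v \<noteq> w" "elementary D (R2_dec {v, w})"
    by (rule P[THEN conjunct2, THEN conjunct2, THEN conjunct2, THEN conjunct1, rule_format,
          OF assms(2) conjI[OF that]])
  show "P D {a1, a3} [^]\<^bsub>G D\<^esub> chord_sign D c3 a3 a1 b1 \<otimes>\<^bsub>G D\<^esub>
        P D {b1, b2} [^]\<^bsub>G D\<^esub> chord_sign D a1 b1 b2 c2 \<otimes>\<^bsub>G D\<^esub>
        P D {c2, c3} [^]\<^bsub>G D\<^esub> chord_sign D b2 c2 c3 a3 = \<one>\<^bsub>G D\<^esub>"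
    if "R3_triangle D a1 b1 b2 c2 c3 a3"
    by (rule P[THEN conjunct2, THEN conjunct2, THEN conjunct2, THEN conjunct2, rule_format, OF assms(2) that])
qed

lemma circle_band:
  assumes r: "r \<in> core" and R: "linear_diagram (2 * pi) R" and ok: "band_ok (2 * pi) R a a' b b'"
  shows "elementary (circle_diagram r R) (R2_inc (circle_diagram r (band a a' b b')))"
    and "target (circle_diagram r R) (R2_inc (circle_diagram r (band a a' b b'))) =
      circle_diagram r (R \<union> band a a' b b')"
    and "v \<in> R \<Longrightarrow> push (circle_diagram r R) (R2_inc (circle_diagram r (band a a' b b'))) (circle_point r ` v) =
      Some (circle_point r ` v)"
proof -
  let ?B = "band a a' b b'"
  have R': "linear_diagram (2 * pi) (R \<union> ?B)"
    by (rule linear_diagram_band[OF R ok])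
  interpret B: based_diagrams r "R \<union> ?B"
    using r R' by unfold_locales
  have un: "circle_diagram r (R \<union> ?B) = circle_diagram r R \<union> circle_diagram r ?B"
    by (rule image_Un)
  have disj: "R \<inter> ?B = {}" and ne: "{a, b} \<noteq> {a', b'}"
    and free: "between_free (R \<union> ?B) a a'" "between_free (R \<union> ?B) b b'"
    using ok by (auto simp: band_ok_def doubleton_eq_iff)
  have "circle_diagram r R \<inter> circle_diagram r ?B = {}"
    using inj_on_image_Int[OF B.inj_chords, of R ?B] disj by (metis Un_upper1 Un_upper2 image_empty)
  moreover have "R2_pair (circle_diagram r (R \<union> ?B)) (circle_diagram r ?B)"
    unfolding R2_pair_def
  proof (intro exI conjI)
    show "circle_diagram r ?B = {circle_point r ` {a, b}, circle_point r ` {a', b'}}"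
      by simp
    show "circle_point r ` {a, b} \<in> circle_diagram r (R \<union> ?B)"
      "circle_point r ` {a', b'} \<in> circle_diagram r (R \<union> ?B)"
      by blast+
    show "circle_point r ` {a, b} \<noteq> circle_point r ` {a', b'}"
      using inj_onD[OF B.inj_chords, of "{a, b}" "{a', b'}"] ne by blast
    show "adjacent (circle_diagram r (R \<union> ?B)) (circle_point r a) (circle_point r a')"
      "adjacent (circle_diagram r (R \<union> ?B)) (circle_point r b) (circle_point r b')"
      using free by (intro B.between_free_adjacent; blast)+
  qed auto
  ultimately show "elementary (circle_diagram r R) (R2_inc (circle_diagram r ?B))"
    using B.chord_diagram_circle un by (simp add: Int_commute)
  show "target (circle_diagram r R) (R2_inc (circle_diagram r ?B)) = circle_diagram r (R \<union> ?B)"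
    using un by simp
  show "push (circle_diagram r R) (R2_inc (circle_diagram r ?B)) (circle_point r ` v) =
      Some (circle_point r ` v)" if "v \<in> R"
    using that by simp
qed

abbreviation circle_relation ::
    "(diagram \<Rightarrow> 'g monoid) \<Rightarrow> (diagram \<Rightarrow> chord \<Rightarrow> 'g) \<Rightarrow> complex \<Rightarrow> real set set \<Rightarrow>
     (real set \<Rightarrow> int) \<Rightarrow> bool" where
  "circle_relation G P r R \<equiv>
     relation (G (circle_diagram r R)) (\<lambda>c. P (circle_diagram r R) (circle_point r ` c)) R"

text \<open>The functor enters through the insertion of bands: the increasing R2 move induces a
  partial isomorphism that, by (P0), carries the values of the old chords to their values in the
  larger diagram. The relations for single moves are (P1), (P2) and (P3+).\<close>

lemma parity_linear_relations:
  assumes K: "free_knot K" and P: "oriented_parity_functor K G M P" and r: "r \<in> core"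
  shows "linear_relations (2 * pi) (\<lambda>R. linear_diagram (2 * pi) R \<and> circle_diagram r R \<in> K)
    (circle_relation G P r)"
proof
  fix R assume "linear_diagram (2 * pi) R \<and> circle_diagram r R \<in> K"
  then have lin: "linear_diagram (2 * pi) R" and DK: "circle_diagram r R \<in> K"
    by blast+
  define D where "D = circle_diagram r R"
  define x where "x = (\<lambda>c. P D (circle_point r ` c))"
  interpret based_diagrams r R
    using r lin by unfold_locales
  note F = functor_facts[OF P DK, folded D_def]
  interpret GD: comm_group "G D"
    by (rule F(1))
  have x: "x \<in> R \<rightarrow> carrier (G D)"
    using F(2) by (auto simp: x_def D_def)
  have fin: "finite R"
    using lin by (simp add: linear_diagram_def)
  have D: "chord_diagram D"
    using chord_diagram_circle by (simp add: D_def)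
  show "linear_diagram (2 * pi) R"
    by (rule lin)
  show "circle_relation G P r R (\<lambda>v. 0)"
    using GD.relation_zero[of x R] unfolding D_def x_def .
  show "circle_relation G P r R g"
    if "circle_relation G P r R f"
      "\<And>v. v \<in> R \<Longrightarrow> f v = g v" for f g
    using GD.relation_cong[OF x, of f g] that unfolding D_def x_def by blast
  show "circle_relation G P r R (\<lambda>v. f v - g v)"
    if "circle_relation G P r R f"
      "circle_relation G P r R g" for f g
    using GD.relation_diff[OF x, of f g] that unfolding D_def x_def by blast
  show "circle_relation G P r R (single {a, b})"
    if ab: "{a, b} \<in> R" "between_free R a b" for a b
  proof -
    have "a \<in> \<Union>R" "b \<in> \<Union>R"
      using ab by blast+
    then have "adjacent D (circle_point r a) (circle_point r b)"
      using between_free_adjacent[OF _ _ ab(2)] unfolding D_def by blast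
    moreover have "circle_point r ` {a, b} = {circle_point r a, circle_point r b}"
      by simp
    moreover have "circle_point r ` {a, b} \<in> D"
      using ab(1) unfolding D_def by blast
    ultimately have "R1_chord D (circle_point r ` {a, b})"
      unfolding R1_chord_def by blast
    then have "x {a, b} = \<one>\<^bsub>G D\<^esub>"
      unfolding x_def using D by (intro F(5)) simp
    then have "relation (G D) x R (single {a, b})"
      using GD.finprod_pow_single[OF x fin ab(1), of 1] by (simp add: relation_def)
    then show ?thesis
      unfolding D_def x_def .
  qed
  show "circle_relation G P r R
      (\<lambda>v. single {a, b} v + single {a', b'} v)"
    if ab: "{a, b} \<in> R" "{a', b'} \<in> R" "{a, b} \<noteq> {a', b'}" "between_free R a a'" "between_free R b b'" for a b a' b'
  proof -
    have ends: "a \<in> \<Union>R" "b \<in> \<Union>R" "a' \<in> \<Union>R" "b' \<in> \<Union>R"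
      using ab by blast+
    have ne: "circle_point r ` {a, b} \<noteq> circle_point r ` {a', b'}"
      using inj_onD[OF inj_chords _ ab(1,2)] ab(3) by blast
    have "R2_pair D {circle_point r ` {a, b}, circle_point r ` {a', b'}}"
      unfolding R2_pair_def D_def
    proof (intro exI conjI)
      show "circle_point r ` {a, b} \<in> circle_diagram r R" "circle_point r ` {a', b'} \<in> circle_diagram r R"
        using ab by blast+
      show "adjacent (circle_diagram r R) (circle_point r a) (circle_point r a')"
        "adjacent (circle_diagram r R) (circle_point r b) (circle_point r b')"
        by (rule between_free_adjacent[OF ends(1,3) ab(4)], rule between_free_adjacent[OF ends(2,4) ab(5)])
    qed (use ne in auto)
    then have "x {a, b} \<otimes>\<^bsub>G D\<^esub> x {a', b'} = \<one>\<^bsub>G D\<^esub>"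
      unfolding x_def using D ne by (intro F(6)) simp_all
    moreover have "x {a, b} \<in> carrier (G D)" "x {a', b'} \<in> carrier (G D)"
      using x ab by auto
    ultimately have "relation (G D) x R (\<lambda>v. single {a, b} v + single {a', b'} v)"
      using GD.finprod_pow_add[OF x, of "single {a, b}" "single {a', b'}"]
        GD.finprod_pow_single[OF x fin ab(1), of 1] GD.finprod_pow_single[OF x fin ab(2), of 1]
      by (simp add: relation_def)
    then show ?thesis
      unfolding D_def x_def .
  qed
  show "circle_relation G P r R
      (\<lambda>v. dir b2 c2 * single {a1, a3} v + dir c3 a3 * single {b1, b2} v + dir a1 b1 * single {c2, c3} v)"
    if mem: "{a1, a3} \<in> R" "{b1, b2} \<in> R" "{c2, c3} \<in> R"
      and ne: "{a1, a3} \<noteq> {b1, b2}" "{b1, b2} \<noteq> {c2, c3}" "{c2, c3} \<noteq> {a1, a3}"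
      and free: "between_free R a1 b1" "between_free R b2 c2" "between_free R c3 a3" for a1 a3 b1 b2 c2 c3
  proof -
    let ?p = "circle_point r"
    have ends: "a1 \<in> \<Union>R" "a3 \<in> \<Union>R" "b1 \<in> \<Union>R" "b2 \<in> \<Union>R" "c2 \<in> \<Union>R" "c3 \<in> \<Union>R"
      using mem by blast+
    have disj: "c \<inter> d = {}" if "c \<in> R" "d \<in> R" "c \<noteq> d" for c d
      using lin that unfolding linear_diagram_def pairwise_def disjnt_def by blast
    have apart: "b2 \<noteq> a1" "b2 \<noteq> b1" "a1 \<noteq> c2" "a1 \<noteq> c3" "a1 \<noteq> a3"
    proof -
      have "card {a1, a3} = 2" "card {b1, b2} = 2"
        using lin mem by (auto simp: linear_diagram_def)
      then show "a1 \<noteq> a3" "b2 \<noteq> b1"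
        by auto
      show "b2 \<noteq> a1" "a1 \<noteq> c2" "a1 \<noteq> c3"
        using disj[OF mem(1,2) ne(1)] disj[OF mem(3,1) ne(3)] by auto
    qed
    have imgs: "?p ` {a1, a3} = {?p a1, ?p a3}" "?p ` {b1, b2} = {?p b1, ?p b2}" "?p ` {c2, c3} = {?p c2, ?p c3}"
      by simp_all
    have tri: "R3_triangle D (?p a1) (?p b1) (?p b2) (?p c2) (?p c3) (?p a3)"
      unfolding R3_triangle_def imgs[symmetric]
    proof (intro conjI)
      show "?p ` {a1, a3} \<in> D" "?p ` {b1, b2} \<in> D" "?p ` {c2, c3} \<in> D"
        using mem unfolding D_def by blast+
      show "?p ` {a1, a3} \<noteq> ?p ` {b1, b2}" "?p ` {b1, b2} \<noteq> ?p ` {c2, c3}" "?p ` {c2, c3} \<noteq> ?p ` {a1, a3}"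
        using inj_onD[OF inj_chords] mem ne by metis+
      show "adjacent D (?p a1) (?p b1)" "adjacent D (?p b2) (?p c2)" "adjacent D (?p c3) (?p a3)"
        unfolding D_def by (rule between_free_adjacent[OF ends(1,3) free(1)],
          rule between_free_adjacent[OF ends(4,5) free(2)], rule between_free_adjacent[OF ends(6,2) free(3)])
    qed
    have next_end: "next_end D (?p a1) (?p b1) \<longleftrightarrow> a1 < b1" "next_end D (?p b2) (?p c2) \<longleftrightarrow> b2 < c2"
        "next_end D (?p c3) (?p a3) \<longleftrightarrow> c3 < a3"
      unfolding D_def
      using next_end_iff_dir[OF ends(1,3) free(1) ends(4)] next_end_iff_dir[OF ends(4,5) free(2) ends(1)]
        next_end_iff_dir[OF ends(6,2) free(3) ends(1)] apart by blast+
    have signs: "chord_sign D (?p c3) (?p a3) (?p a1) (?p b1) = dir c3 a3 * dir a1 b1"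
        "chord_sign D (?p a1) (?p b1) (?p b2) (?p c2) = dir a1 b1 * dir b2 c2"
        "chord_sign D (?p b2) (?p c2) (?p c3) (?p a3) = dir b2 c2 * dir c3 a3"
      unfolding chord_sign_def next_end by auto
    \<comment> \<open>Each sign of (P3+) is a product of two directions, that is, \<open>k\<close>
      times the third one; the common factor \<open>k\<close> is then removed.\<close>
    define k where "k = dir a1 b1 * dir b2 c2 * dir c3 a3"
    have prod: "x {a1, a3} [^]\<^bsub>G D\<^esub> (dir c3 a3 * dir a1 b1) \<otimes>\<^bsub>G D\<^esub>
        x {b1, b2} [^]\<^bsub>G D\<^esub> (dir a1 b1 * dir b2 c2) \<otimes>\<^bsub>G D\<^esub>
        x {c2, c3} [^]\<^bsub>G D\<^esub> (dir b2 c2 * dir c3 a3) = \<one>\<^bsub>G D\<^esub>"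
      using F(7)[OF tri] unfolding signs imgs[symmetric] x_def .
    have "relation (G D) x R (\<lambda>v. dir c3 a3 * dir a1 b1 * single {a1, a3} v +
        dir a1 b1 * dir b2 c2 * single {b1, b2} v + dir b2 c2 * dir c3 a3 * single {c2, c3} v)"
      unfolding relation_def GD.finprod_pow_add[OF x] GD.finprod_pow_single[OF x fin mem(1)]
        GD.finprod_pow_single[OF x fin mem(2)] GD.finprod_pow_single[OF x fin mem(3)]
      by (rule prod)
    then have rel: "relation (G D) x R (\<lambda>v. k * (dir b2 c2 * single {a1, a3} v + dir c3 a3 * single {b1, b2} v +
        dir a1 b1 * single {c2, c3} v))"
      by (rule GD.relation_cong[OF x]) (auto simp: k_def algebra_simps)
    have "k = 1 \<or> k = -1"
      by (auto simp: k_def)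
    then have "relation (G D) x R (\<lambda>v. dir b2 c2 * single {a1, a3} v + dir c3 a3 * single {b1, b2} v +
        dir a1 b1 * single {c2, c3} v)"
    proof
      assume "k = 1"
      then show ?thesis
        using rel by simp
    next
      assume "k = -1"
      then show ?thesis
        by (intro GD.relation_cong[OF x GD.relation_diff[OF x GD.relation_zero rel]])
          (simp only: mult_minus1 diff_minus_eq_add add_0)
    qed
    then show ?thesis
      unfolding D_def x_def .
  qed
  fix a a' b b' assume ok: "band_ok (2 * pi) R a a' b b'"
  let ?B = "band a a' b b'"
  note band = circle_band[OF r lin ok, folded D_def]
  define D' where "D' = circle_diagram r (R \<union> ?B)"
  have R': "linear_diagram (2 * pi) (R \<union> ?B)"
    by (rule linear_diagram_band[OF lin ok])
  have D'K: "D' \<in> K"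
    using free_knot_target[OF K band(1)] DK band(2) by (simp add: D_def D'_def)
  then show "linear_diagram (2 * pi) (R \<union> ?B) \<and> circle_diagram r (R \<union> ?B) \<in> K"
    using R' by (simp add: D'_def)
  show "circle_relation G P r (R \<union> ?B) f
      \<longleftrightarrow> circle_relation G P r R f"
    if f: "f {a, b} = 0" "f {a', b'} = 0" for f
  proof -
    define y where "y = (\<lambda>c. P D' (circle_point r ` c))"
    interpret GD': comm_group "G D'"
      by (rule functor_facts(1)[OF P D'K])
    have y: "y \<in> R \<union> ?B \<rightarrow> carrier (G D')"
      unfolding y_def using functor_facts(2)[OF P D'K] by (auto simp: D'_def)
    have "chord_diagram D'"
      using free_knot_chord_diagram[OF K D'K] .
    then have iso: "partial_iso (G D) (G D') (M D [R2_inc (circle_diagram r ?B)])"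
      using F(3)[OF band(1)] unfolding band(2) D'_def by blast
    have "M D [R2_inc (circle_diagram r ?B)] (x v) = Some (y v)" if "v \<in> R" for v
      using F(4)[OF band(1) band(3)[OF that]] unfolding band(2) by (simp add: x_def y_def D'_def)
    then have "relation (G D) x R f \<longleftrightarrow> relation (G D') y R f"
      by (rule partial_iso_relation[OF F(1) GD'.comm_group_axioms iso fin])
    moreover have "relation (G D') y (R \<union> ?B) f \<longleftrightarrow> relation (G D') y R f"
    proof -
      have "finprod (G D') (\<lambda>v. y v [^]\<^bsub>G D'\<^esub> f v) (R \<union> ?B) =
          finprod (G D') (\<lambda>v. y v [^]\<^bsub>G D'\<^esub> f v) R \<otimes>\<^bsub>G D'\<^esub> finprod (G D') (\<lambda>v. y v [^]\<^bsub>G D'\<^esub> f v) ?B"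
        using fin y ok by (intro GD'.finprod_Un_disjoint) (auto simp: band_ok_def)
      moreover have "finprod (G D') (\<lambda>v. y v [^]\<^bsub>G D'\<^esub> f v) ?B = \<one>\<^bsub>G D'\<^esub>"
        using f by (intro GD'.finprod_one_eqI) auto
      moreover have "finprod (G D') (\<lambda>v. y v [^]\<^bsub>G D'\<^esub> f v) R \<in> carrier (G D')"
        using y by (intro GD'.finprod_closed) auto
      ultimately show ?thesis
        unfolding relation_def by (simp only: GD'.r_one)
    qed
    ultimately show ?thesis
      unfolding D_def x_def D'_def y_def by blast
  qed
qed

text \<open>The base point is chosen off all ends, which is possible as the circle is infinite; the
  angles of the ends then form a linear diagram whose drawing is \<open>D\<close> itself.\<close>

lemma parity_values:
  assumes K: "free_knot K" and P: "oriented_parity_functor K G M P" and D: "D \<in> K"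
  obtains r where "r \<in> core"
    "\<And>v. odd_chords D = {} \<Longrightarrow> v \<in> D \<Longrightarrow> P D v = \<one>\<^bsub>G D\<^esub>"
    "\<And>v c. c \<in> odd_chords D \<Longrightarrow> v \<in> D \<Longrightarrow> P D v = P D c [^]\<^bsub>G D\<^esub> (val r D v * val r D c)"
    "\<And>v. v \<in> D \<Longrightarrow> P D v [^]\<^bsub>G D\<^esub> (4::int) = \<one>\<^bsub>G D\<^esub>"
proof -
  have diag: "chord_diagram D"
    by (rule free_knot_chord_diagram[OF K D])
  have "infinite core"
  proof
    assume "finite core"
    moreover have "circle_point 1 ` {0<..<2 * pi} \<subseteq> core"
      using circle_point_core[of 1] by auto
    ultimately have "finite (circle_point 1 ` {0<..<2 * pi})"
      using finite_subset by blast
    then show False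
      using finite_imageD[OF _ inj_circle_point[of 1]] infinite_Ioo[of 0 "2 * pi"] by simp
  qed
  then obtain r where r: "r \<in> core" "r \<notin> chord_ends D"
    using finite_chord_ends[OF diag] by (metis finite_subset subsetI)
  define R where "R = (`) (ang r) ` D"
  have ends: "circle_point r (ang r z) = z" "0 < ang r z" if "z \<in> chord_ends D" for z
  proof -
    have z: "z \<in> core" "z \<noteq> r"
      using chord_ends_subset_core[OF diag] that r by blast+
    show "circle_point r (ang r z) = z"
      by (rule circle_point_ang[OF r(1) z(1)])
    have "ang r z \<noteq> ang r r"
      using ang_inj[OF r(1) z(1) r(1)] z by blast
    then show "0 < ang r z"
      using r by (metis ang_ge_0 ang_self order_le_imp_less_or_eq)
  qed
  have restore: "circle_point r ` ang r ` c = c" if c: "c \<in> D" for c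
  proof -
    have "(\<lambda>z. circle_point r (ang r z)) ` c = (\<lambda>z. z) ` c"
      using ends(1) c by (intro image_cong) auto
    then show ?thesis
      by (simp add: image_image)
  qed
  have DR: "circle_diagram r R = D"
  proof -
    have "(\<lambda>c. circle_point r ` ang r ` c) ` D = (\<lambda>c. c) ` D"
      using restore by (intro image_cong) auto
    then show ?thesis
      unfolding R_def image_image[of "(`) (circle_point r)"] by simp
  qed
  have inj: "inj_on (ang r) (chord_ends D)"
    using ends(1) by (metis inj_on_inverseI)
  have lin: "linear_diagram (2 * pi) R"
    unfolding linear_diagram_def pairwise_def disjnt_def
  proof (intro conjI ballI impI)
    show "finite R"
      using diag by (simp add: R_def chord_diagram_def)
  next
    fix c assume "c \<in> R"
    then obtain d where d: "d \<in> D" "c = ang r ` d"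
      by (auto simp: R_def)
    show "c \<subseteq> {0<..<2 * pi}"
    proof
      fix z assume "z \<in> c"
      then obtain e where "e \<in> d" "z = ang r e"
        using d by blast
      moreover from this have "e \<in> chord_ends D"
        using d by blast
      ultimately show "z \<in> {0<..<2 * pi}"
        using ends(2) by simp
    qed
    have "card c = card d"
      unfolding d(2) by (rule card_image[OF inj_on_subset[OF inj Union_upper[OF d(1)]]])
    then show "card c = 2"
      using diag d(1) by (simp add: chord_diagram_def)
  next
    fix x y assume "x \<in> R" "y \<in> R" "x \<noteq> y"
    then obtain c d where cd: "c \<in> D" "x = ang r ` c" "d \<in> D" "y = ang r ` d" "c \<noteq> d"
      by (auto simp: R_def)
    then have "c \<inter> d = {}"
      using chord_unique[OF diag cd(1,3)] by blast
    then show "x \<inter> y = {}"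
      unfolding cd(2,4) using inj_on_image_Int[OF inj Union_upper[OF cd(1)] Union_upper[OF cd(3)]] by simp
  qed
  interpret based_diagrams r R
    using r(1) lin by unfold_locales
  interpret linear_relations "2 * pi" "\<lambda>R. linear_diagram (2 * pi) R \<and> circle_diagram r R \<in> K"
    "circle_relation G P r"
    by (rule parity_linear_relations[OF K P r(1)])
  interpret GD: comm_group "G D"
    by (rule functor_facts(1)[OF P D])
  define x where "x = (\<lambda>c. P D (circle_point r ` c))"
  have x: "x \<in> R \<rightarrow> carrier (G D)"
    unfolding x_def using functor_facts(2)[OF P D] restore by (auto simp: R_def)
  have fin: "finite R"
    using lin by (simp add: linear_diagram_def)
  have dg: "linear_diagram (2 * pi) R \<and> circle_diagram r R \<in> K"
    using lin D DR by simp
  have x_ang: "x (ang r ` v) = P D v" "ang r ` v \<in> R" "linear_val R (ang r ` v) = val r D v" if "v \<in> D" for v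
    using restore[OF that] val_circle[of "ang r ` v"] that DR by (auto simp: x_def R_def)
  have odd: "ang r ` v \<in> linear_odd R" if "v \<in> odd_chords D" for v
  proof -
    have "v \<in> circle_diagram r (linear_odd R)"
      using odd_chords_circle that DR by simp
    then obtain c where c: "c \<in> linear_odd R" "v = circle_point r ` c"
      by blast
    moreover have "c \<subseteq> \<Union>R"
      using c(1) by (auto simp: linear_odd_def)
    then have "ang r ` v = c"
      unfolding c(2) using ang_end by (force simp: image_image)
    ultimately show ?thesis
      by simp
  qed
  show thesis
  proof (rule that[OF r(1)])
    fix v assume v: "v \<in> D"
    show "P D v = \<one>\<^bsub>G D\<^esub>" if "odd_chords D = {}"
    proof -
      have "linear_odd R = {}"
        using odd_chords_circle that DR by simp
      then have "relation (G D) x R (single (ang r ` v))"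
        using linear_universal(1)[OF dg x_ang(2)[OF v]] DR by (simp add: x_def)
      then show ?thesis
        using GD.finprod_pow_single[OF x fin x_ang(2)[OF v], of 1] x_ang(1)[OF v]
          functor_facts(2)[OF P D v] by (simp add: relation_def)
    qed
    show "P D v [^]\<^bsub>G D\<^esub> (4::int) = \<one>\<^bsub>G D\<^esub>"
    proof -
      have "relation (G D) x R (\<lambda>c. 4 * single (ang r ` v) c)"
        using four_rel[OF dg x_ang(2)[OF v]] DR by (simp add: x_def)
      then show ?thesis
        using GD.finprod_pow_single[OF x fin x_ang(2)[OF v], of 4] x_ang(1)[OF v] by (simp add: relation_def)
    qed
    fix c assume c: "c \<in> odd_chords D"
    then have cD: "c \<in> D"
      using odd_chords_subset by blast
    define k where "k = val r D v * val r D c"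
    have "relation (G D) x R (\<lambda>d. single (ang r ` v) d - k * single (ang r ` c) d)"
      using linear_universal(2)[OF dg x_ang(2)[OF v] odd[OF c]] DR x_ang(3)[OF v] x_ang(3)[OF cD]
      by (simp add: x_def k_def)
    then have "relation (G D) x R (\<lambda>d. 1 * single (ang r ` v) d + (- k) * single (ang r ` c) d)"
      by simp
    then have "P D v [^]\<^bsub>G D\<^esub> (1::int) \<otimes>\<^bsub>G D\<^esub> P D c [^]\<^bsub>G D\<^esub> (- k) = \<one>\<^bsub>G D\<^esub>"
      unfolding relation_def GD.finprod_pow_add[OF x] GD.finprod_pow_single[OF x fin x_ang(2)[OF v]]
        GD.finprod_pow_single[OF x fin x_ang(2)[OF cD]] x_ang(1)[OF v] x_ang(1)[OF cD] .
    then have "P D v \<otimes>\<^bsub>G D\<^esub> inv\<^bsub>G D\<^esub> (P D c [^]\<^bsub>G D\<^esub> k) = \<one>\<^bsub>G D\<^esub>"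
      using functor_facts(2)[OF P D] v cD by (simp add: GD.int_pow_neg)
    then show "P D v = P D c [^]\<^bsub>G D\<^esub> (val r D v * val r D c)"
      using functor_facts(2)[OF P D] v cD unfolding k_def
      by (metis GD.int_pow_closed GD.inv_closed GD.inv_equality GD.inv_inv)
  qed
qed

text \<open>All values are powers of one element \<open>g\<close>, with exponents proportional to
  \<open>val\<close>. Replacing \<open>val\<close> by the number of the class costs the sign
  \<open>s\<close>, and \<open>g^4 = 1\<close> makes the resulting map compatible with addition
  modulo 4.\<close>

lemma og_parity_homomorphism:
  assumes K: "free_knot K" and P: "oriented_parity_functor K G M P" and D: "D \<in> K" and C: "odd_class D (C D)"
  obtains \<phi> where "\<phi> \<in> hom (og_group D) (G D)" "\<phi> \<in> extensional (carrier (og_group D))"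
    "\<And>v. v \<in> D \<Longrightarrow> P D v = \<phi> (og_parity C D v)"
proof -
  have diag: "chord_diagram D"
    by (rule free_knot_chord_diagram[OF K D])
  obtain r where r: "r \<in> core"
    and none: "\<And>v. odd_chords D = {} \<Longrightarrow> v \<in> D \<Longrightarrow> P D v = \<one>\<^bsub>G D\<^esub>"
    and some: "\<And>v c. c \<in> odd_chords D \<Longrightarrow> v \<in> D \<Longrightarrow> P D v = P D c [^]\<^bsub>G D\<^esub> (val r D v * val r D c)"
    and four: "\<And>v. v \<in> D \<Longrightarrow> P D v [^]\<^bsub>G D\<^esub> (4::int) = \<one>\<^bsub>G D\<^esub>"
    using parity_values[OF K P D] by metis
  obtain s where s: "s = 1 \<or> s = -1"
      "\<And>v. v \<in> D \<Longrightarrow> [int (og_num (og_parity C D v)) = s * val r D v] (mod 4)"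
    using og_sign[of D r C, OF diag r C] by metis
  interpret GD: comm_group "G D"
    by (rule functor_facts(1)[OF P D])
  have carrier: "og_parity C D v \<in> carrier (og_group D)" for v
    by (simp add: og_parity_def og_group_carrier)
  \<comment> \<open>If there is an odd chord \<open>c\<close>, the element is \<open>P D c\<close>
    and the factor is the value of \<open>c\<close>; otherwise all values of \<open>P\<close> are
    trivial.\<close>
  obtain g k where g: "g \<in> carrier (G D)" "g [^]\<^bsub>G D\<^esub> (4::int) = \<one>\<^bsub>G D\<^esub>"
    and gk: "\<And>v. v \<in> D \<Longrightarrow> P D v = g [^]\<^bsub>G D\<^esub> (k * val r D v)"
  proof (cases "odd_chords D = {}")
    case True
    then show thesis
      using that[of "\<one>\<^bsub>G D\<^esub>" 0] none by simp
  next
    case False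
    then obtain c where c: "c \<in> odd_chords D"
      by blast
    then have "c \<in> D"
      using odd_chords_subset by blast
    then have "P D c \<in> carrier (G D)" "P D c [^]\<^bsub>G D\<^esub> (4::int) = \<one>\<^bsub>G D\<^esub>"
      using four functor_facts(2)[OF P D] by blast+
    then show thesis
    proof (rule that[of "P D c" "val r D c"])
      show "P D v = P D c [^]\<^bsub>G D\<^esub> (val r D c * val r D v)" if "v \<in> D" for v
        using some[OF c that] by (simp only: mult.commute)
    qed
  qed
  define \<phi> where "\<phi> = (\<lambda>x\<in>carrier (og_group D). g [^]\<^bsub>G D\<^esub> (k * s * int (og_num x)))"
  show thesis
  proof (rule that[of \<phi>])
    show "\<phi> \<in> hom (og_group D) (G D)"
    proof (rule homI)
      fix x y assume xy: "x \<in> carrier (og_group D)" "y \<in> carrier (og_group D)"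
      have "[int (og_num (x \<otimes>\<^bsub>og_group D\<^esub> y)) = int (og_num x) + int (og_num y)] (mod 4)"
        by (simp add: og_num_mult zmod_int cong_def)
      then have "[k * s * int (og_num (x \<otimes>\<^bsub>og_group D\<^esub> y)) =
          k * s * int (og_num x) + k * s * int (og_num y)] (mod 4)"
        unfolding distrib_left[symmetric] by (rule cong_scalar_left)
      from GD.int_pow_cong_mod4[OF g this]
      show "\<phi> (x \<otimes>\<^bsub>og_group D\<^esub> y) = \<phi> x \<otimes>\<^bsub>G D\<^esub> \<phi> y"
        using xy og_mult_closed[OF xy] g by (simp add: \<phi>_def GD.int_pow_mult)
    qed (use g in \<open>simp add: \<phi>_def\<close>)
    show "\<phi> \<in> extensional (carrier (og_group D))"
      by (simp add: \<phi>_def)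
    fix v assume v: "v \<in> D"
    have "[k * s * int (og_num (og_parity C D v)) = k * s * (s * val r D v)] (mod 4)"
      by (rule cong_scalar_left[OF s(2)[OF v]])
    also have "k * s * (s * val r D v) = k * val r D v"
      using s(1) by auto
    finally show "P D v = \<phi> (og_parity C D v)"
      using GD.int_pow_cong_mod4[OF g] gk[OF v] carrier by (simp add: \<phi>_def)
  qed
qed

lemma og_generated:
  assumes "odd_chords D \<noteq> {}" "g = O1 \<or> g = O2"
  shows "x = \<one>\<^bsub>og_group D\<^esub> \<or> x = g \<or> x = g \<otimes>\<^bsub>og_group D\<^esub> g \<or> x = g \<otimes>\<^bsub>og_group D\<^esub> (g \<otimes>\<^bsub>og_group D\<^esub> g)"
proof -
  have "og_num x = og_num E0 \<or> og_num x = og_num g \<or> og_num x = og_num (g \<otimes>\<^bsub>og_group D\<^esub> g) \<or>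
      og_num x = og_num (g \<otimes>\<^bsub>og_group D\<^esub> (g \<otimes>\<^bsub>og_group D\<^esub> g))"
    using assms(2) unfolding og_num_mult by (cases x) auto
  then show ?thesis
    by (simp only: og_num_eq_iff og_group_one)
qed

text \<open>The class of any odd chord generates the cyclic group of order 4, so values on chords
  determine a homomorphism. Without odd chords the group is trivial, and extensionality settles
  arguments outside the carrier.\<close>

lemma og_homomorphism_unique:
  assumes H: "group H" and hom: "\<phi> \<in> hom (og_group D) H" "\<psi> \<in> hom (og_group D) H"
    and ext: "\<phi> \<in> extensional (carrier (og_group D))" "\<psi> \<in> extensional (carrier (og_group D))"
    and eq: "\<And>v. v \<in> D \<Longrightarrow> \<phi> (og_parity C D v) = \<psi> (og_parity C D v)"
  shows "\<phi> = \<psi>"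
proof (rule extensionalityI[OF ext])
  fix x assume x: "x \<in> carrier (og_group D)"
  have og: "group (og_group D)"
    using comm_group_og comm_group.axioms(2) by blast
  have one: "\<phi> \<one>\<^bsub>og_group D\<^esub> = \<psi> \<one>\<^bsub>og_group D\<^esub>"
    using hom_one[OF hom(1) og H] hom_one[OF hom(2) og H] by (simp only:)
  show "\<phi> x = \<psi> x"
  proof (cases "odd_chords D = {}")
    case True
    then show ?thesis
      using x one by (simp add: og_group_carrier)
  next
    case False
    then obtain a where a: "a \<in> odd_chords D"
      by blast
    define g where "g = og_parity C D a"
    have g: "g = O1 \<or> g = O2" "g \<in> carrier (og_group D)"
      using a False by (auto simp: g_def og_parity_def og_group_carrier)
    have "\<phi> g = \<psi> g"
      using eq a odd_chords_subset unfolding g_def by blast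
    then show ?thesis
      using og_generated[OF False g(1), of x] one hom_mult[OF hom(1)] hom_mult[OF hom(2)] g(2)
        og_mult_closed[OF g(2) g(2)] by metis
  qed
qed

theorem theorem2:
  fixes K :: "diagram set"
    and G :: "diagram \<Rightarrow> 'g monoid"
    and M :: "diagram \<Rightarrow> move list \<Rightarrow> 'g \<rightharpoonup> 'g"
    and P :: "diagram \<Rightarrow> chord \<Rightarrow> 'g"
  assumes "free_knot K"
  shows "(\<forall>D\<in>K. \<exists>S. odd_class D S) \<and>
    (\<forall>C. (\<forall>D\<in>K. odd_class D (C D)) \<longrightarrow>
      (\<forall>D\<in>K. \<forall>f. elementary D f \<longrightarrow> (\<exists>!m. og_map C D f m)) \<and>
      oriented_parity_functor K og_group (og_mor C) (og_parity C) \<and>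
      (oriented_parity_functor K G M P \<longrightarrow>
        (\<exists>!\<phi>. \<phi> \<in> (\<Pi>\<^sub>E D\<in>K. hom (og_group D) (G D) \<inter> extensional (carrier (og_group D))) \<and>
              (\<forall>D\<in>K. \<forall>v\<in>D. P D v = \<phi> D (og_parity C D v)))))"
proof (intro conjI allI impI ballI)
  show "\<exists>S. odd_class D S" if "D \<in> K" for D
    by (rule odd_class_exists[OF free_knot_chord_diagram[OF assms that]])
  fix C assume C: "\<forall>D\<in>K. odd_class D (C D)"
  show "\<exists>!m. og_map C D f m" if "D \<in> K" "elementary D f" for D f
    using og_mor_single(3)[of D f C] that C free_knot_target[OF assms] by blast
  show "oriented_parity_functor K og_group (og_mor C) (og_parity C)"
    by (rule og_parity_functor[OF assms C])
  assume P: "oriented_parity_functor K G M P"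
  have "\<forall>D\<in>K. \<exists>\<phi>. \<phi> \<in> hom (og_group D) (G D) \<inter> extensional (carrier (og_group D)) \<and>
      (\<forall>v\<in>D. P D v = \<phi> (og_parity C D v))"
    using og_parity_homomorphism[of K G M P _ C, OF assms P] C by (metis IntI)
  then obtain \<Phi> where \<Phi>: "\<And>D. D \<in> K \<Longrightarrow> \<Phi> D \<in> hom (og_group D) (G D) \<inter> extensional (carrier (og_group D))"
      "\<And>D v. D \<in> K \<Longrightarrow> v \<in> D \<Longrightarrow> P D v = \<Phi> D (og_parity C D v)"
    by metis
  show "\<exists>!\<phi>. \<phi> \<in> (\<Pi>\<^sub>E D\<in>K. hom (og_group D) (G D) \<inter> extensional (carrier (og_group D))) \<and>
      (\<forall>D\<in>K. \<forall>v\<in>D. P D v = \<phi> D (og_parity C D v))"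
  \<comment> \<open>Families are total functions, so uniqueness requires a fixed value outside
    \<open>K\<close>.\<close>
  proof (rule ex1I[of _ "restrict \<Phi> K"])
    show "restrict \<Phi> K \<in> (\<Pi>\<^sub>E D\<in>K. hom (og_group D) (G D) \<inter> extensional (carrier (og_group D))) \<and>
        (\<forall>D\<in>K. \<forall>v\<in>D. P D v = restrict \<Phi> K D (og_parity C D v))"
      using \<Phi> by auto
  next
    fix \<psi> assume \<psi>: "\<psi> \<in> (\<Pi>\<^sub>E D\<in>K. hom (og_group D) (G D) \<inter> extensional (carrier (og_group D))) \<and>
        (\<forall>D\<in>K. \<forall>v\<in>D. P D v = \<psi> D (og_parity C D v))"
    have "\<psi> D = \<Phi> D" if D: "D \<in> K" for D
    proof (rule og_homomorphism_unique)
      show "group (G D)"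
        using functor_facts(1)[OF P D] comm_group.axioms(2) by blast
      show "\<psi> D (og_parity C D v) = \<Phi> D (og_parity C D v)" if "v \<in> D" for v
        using \<psi> \<Phi>(2)[OF D that] D that by metis
    qed (use \<psi> \<Phi>(1)[OF D] D in \<open>auto simp: PiE_iff\<close>)
    moreover have "\<psi> \<in> extensional K"
      using \<psi> by (simp add: PiE_iff)
    ultimately show "\<psi> = restrict \<Phi> K"
      by (intro extensionalityI[of _ K]) auto
  qed
qed

end
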